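(* Let $A$ be a complex abelian variety of dimension $n$, with exponential map $\exp_A:\mathbb{C}^n\to A$. Let $V\subseteq \mathbb{C}^n\times A$ be an algebraic subvariety with dominant projection to $\mathbb{C}^n$, that is, its projection to $\mathbb{C}^n$ has dimension $n$. Then there is $\mathbf{z}\in\mathbb{C}^n$ such that $(\mathbf{z},\exp_A(\mathbf{z}))\in V$.
   Context: Varieties are over $\mathbb{C}$ and are identified with their sets of complex points. For an abelian variety $A$ of dimension $n$, $\exp_A:\mathbb{C}^n\to A$ is the exponential map of the complex Lie group $A$ (its Lie algebra being identified with $\mathbb{C}^n$); it is a surjective complex analytic homomorphism whose kernel is a lattice of rank $2n$ in $\mathbb{C}^n$. *)

theory Defs
  imports "HOL-Analysis.Analysis" "HOL-Algebra.Group"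
begin

text \<open>Polynomial functions: the complex algebra of functions generated by a set \<open>X\<close> of
  coordinate functions.  As the field is infinite, these are the polynomials in the coordinates.\<close>

inductive_set poly_funs :: "('a \<Rightarrow> complex) set \<Rightarrow> ('a \<Rightarrow> complex) set"
  for X :: "('a \<Rightarrow> complex) set" where
  const: "(\<lambda>_. c) \<in> poly_funs X"
| coord: "f \<in> X \<Longrightarrow> f \<in> poly_funs X"
| add: "f \<in> poly_funs X \<Longrightarrow> g \<in> poly_funs X \<Longrightarrow> (\<lambda>v. f v + g v) \<in> poly_funs X"
| mult: "f \<in> poly_funs X \<Longrightarrow> g \<in> poly_funs X \<Longrightarrow> (\<lambda>v. f v * g v) \<in> poly_funs X"

definition polys :: "(complex ^ 'n::finite \<Rightarrow> complex) set" where
  "polys = poly_funs (range (\<lambda>i x. x $ i))"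

definition polys2 :: "((complex ^ 'n::finite) \<times> (complex ^ 'm::finite) \<Rightarrow> complex) set" where
  "polys2 = poly_funs (range (\<lambda>i v. fst v $ i) \<union> range (\<lambda>j v. snd v $ j))"

definition hom_polys :: "nat \<Rightarrow> (complex ^ 'm::finite \<Rightarrow> complex) set" where
  "hom_polys d = {f \<in> polys. \<forall>c x. f (c *s x) = c ^ d * f x}"

text \<open>Polynomials in two groups of variables, homogeneous in the second group only,
  respectively in each group.\<close>

definition snd_hom_polys ::
    "nat \<Rightarrow> ((complex ^ 'n::finite) \<times> (complex ^ 'm::finite) \<Rightarrow> complex) set" where
  "snd_hom_polys d = {f \<in> polys2. \<forall>c z x. f (z, c *s x) = c ^ d * f (z, x)}"

definition bihom_polys ::
    "nat \<Rightarrow> nat \<Rightarrow> ((complex ^ 'n::finite) \<times> (complex ^ 'm::finite) \<Rightarrow> complex) set" where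
  "bihom_polys d e = {f \<in> polys2. \<forall>b c x y. f (b *s x, c *s y) = b ^ d * c ^ e * f (x, y)}"

text \<open>Complex projective space, of dimension \<open>CARD('m) - 1\<close>.  The value \<open>proj_class 0\<close> carries no
  meaning: \<open>proj_class\<close> is only ever applied to nonzero vectors below.\<close>

definition proj_rel :: "complex ^ 'm::finite \<Rightarrow> complex ^ 'm \<Rightarrow> bool" where
  "proj_rel x y \<longleftrightarrow> x \<noteq> 0 \<and> y \<noteq> 0 \<and> (\<exists>c. y = c *s x)"

lemma part_equivp_proj_rel: "part_equivp (proj_rel :: complex ^ 'm::finite \<Rightarrow> _)"
proof (rule part_equivpI)
  have "(1 :: complex ^ 'm) \<noteq> 0" by simp
  then have "proj_rel (1 :: complex ^ 'm) 1"
    unfolding proj_rel_def by (blast intro: vector_smult_lid[symmetric])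
  then show "\<exists>x :: complex ^ 'm. proj_rel x x" ..
  show "symp (proj_rel :: complex ^ 'm \<Rightarrow> _)"
  proof (rule sympI)
    fix x y :: "complex ^ 'm"
    assume "proj_rel x y"
    then obtain c where c: "x \<noteq> 0" "y \<noteq> 0" "y = c *s x"
      unfolding proj_rel_def by blast
    from c(2) have "c \<noteq> 0" unfolding c(3) by auto
    then have "x = inverse c *s y" unfolding c(3) by (simp add: vector_smult_assoc)
    with c(1,2) show "proj_rel y x" unfolding proj_rel_def by blast
  qed
  show "transp (proj_rel :: complex ^ 'm \<Rightarrow> _)"
    unfolding proj_rel_def by (rule transpI) (metis vector_smult_assoc)
qed

quotient_type 'm proj = "complex ^ ('m::finite)" / partial: proj_rel
  morphisms proj_rep proj_class
  by (rule part_equivp_proj_rel)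

lemma proj_class_eq_iff:
  assumes "x \<noteq> 0" "y \<noteq> 0"
  shows "proj_class x = proj_class y \<longleftrightarrow> (\<exists>c. y = c *s x)"
proof -
  have refl: "proj_rel v v" if "v \<noteq> 0" for v :: "complex ^ 'a"
    using that unfolding proj_rel_def by (blast intro: vector_smult_lid[symmetric])
  have "proj_rel x y \<longleftrightarrow> proj_class x = proj_class y"
    using Quotient3_rel[OF Quotient3_proj, of x y] refl assms by blast
  then show ?thesis using assms by (simp add: proj_rel_def)
qed

text \<open>In each Zariski topology the basic open sets are the non-vanishing loci of single
  polynomials, suitably homogeneous; these are closed under finite intersections.\<close>

definition affine_zariski :: "(complex ^ 'n::finite) topology" where
  "affine_zariski = topology_generated_by {{z. f z \<noteq> 0} |f. f \<in> polys}"

definition proj_zariski :: "'m::finite proj topology" where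
  "proj_zariski = topology_generated_by
     {{proj_class x |x. x \<noteq> 0 \<and> f x \<noteq> 0} |f d. f \<in> hom_polys d}"

definition affine_proj_zariski :: "((complex ^ 'n::finite) \<times> 'm::finite proj) topology" where
  "affine_proj_zariski = topology_generated_by
     {{(z, proj_class x) |z x. x \<noteq> 0 \<and> f (z, x) \<noteq> 0} |f d. f \<in> snd_hom_polys d}"

definition proj_proj_zariski :: "('m::finite proj \<times> 'm proj) topology" where
  "proj_proj_zariski = topology_generated_by
     {{(proj_class x, proj_class y) |x y. x \<noteq> 0 \<and> y \<noteq> 0 \<and> f (x, y) \<noteq> 0} |f d e. f \<in> bihom_polys d e}"

definition irreducible_closedin :: "'a topology \<Rightarrow> 'a set \<Rightarrow> bool" where
  "irreducible_closedin X C \<longleftrightarrow> closedin X C \<and> C \<noteq> {} \<and>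
     (\<forall>D E. closedin X D \<and> closedin X E \<and> C \<subseteq> D \<union> E \<longrightarrow> C \<subseteq> D \<or> C \<subseteq> E)"

text \<open>Krull dimension of a topological space (with the convention that the empty space has
  dimension \<open>0\<close>).\<close>

definition krull_dim :: "'a topology \<Rightarrow> enat" where
  "krull_dim X = Sup {enat k |k. \<exists>C. (\<forall>i\<le>k. irreducible_closedin X (C i)) \<and>
                                     (\<forall>i<k. C i \<subset> C (Suc i))}"

text \<open>Morphisms from a subset \<open>A\<close> of projective space, respectively from \<open>A \<times> A\<close>, to projective
  space: Zariski-locally given by a tuple of polynomials of the same (bi)degree without common
  zero.\<close>

definition regular_map :: "'m::finite proj set \<Rightarrow> ('m proj \<Rightarrow> 'm proj) \<Rightarrow> bool" where
  "regular_map A f \<longleftrightarrow>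
     (\<forall>p\<in>A. \<exists>U d F. openin proj_zariski U \<and> p \<in> U \<and> (\<forall>k. F k \<in> hom_polys d) \<and>
        (\<forall>x. x \<noteq> 0 \<and> proj_class x \<in> U \<inter> A \<longrightarrow>
           (\<chi> k. F k x) \<noteq> 0 \<and> f (proj_class x) = proj_class (\<chi> k. F k x)))"

definition regular_map2 ::
    "'m::finite proj set \<Rightarrow> ('m proj \<Rightarrow> 'm proj \<Rightarrow> 'm proj) \<Rightarrow> bool" where
  "regular_map2 A f \<longleftrightarrow>
     (\<forall>p\<in>A. \<forall>q\<in>A. \<exists>U d e F. openin proj_proj_zariski U \<and> (p, q) \<in> U \<and>
        (\<forall>k. F k \<in> bihom_polys d e) \<and>
        (\<forall>x y. x \<noteq> 0 \<and> y \<noteq> 0 \<and> (proj_class x, proj_class y) \<in> U \<inter> A \<times> A \<longrightarrow>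
           (\<chi> k. F k (x, y)) \<noteq> 0 \<and>
           f (proj_class x) (proj_class y) = proj_class (\<chi> k. F k (x, y))))"

text \<open>A complex abelian variety: an irreducible projective variety, given as a closed subset of some
  projective space, with a group structure whose operations are morphisms.\<close>

definition abelian_variety :: "'m::finite proj monoid \<Rightarrow> bool" where
  "abelian_variety A \<longleftrightarrow> group A \<and> irreducible_closedin proj_zariski (carrier A) \<and>
     regular_map2 (carrier A) (mult A) \<and> regular_map (carrier A) (m_inv A)"

definition variety_dim :: "'m::finite proj set \<Rightarrow> enat" where
  "variety_dim S = krull_dim (subtopology proj_zariski S)"

definition affine_dim :: "(complex ^ 'n::finite) set \<Rightarrow> enat" where
  "affine_dim S = krull_dim (subtopology affine_zariski S)"

text \<open>Holomorphic maps in several variables: complex-linear Frechet derivative at each point.  A map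
  to projective space is holomorphic if it has holomorphic nowhere zero local lifts to the
  homogeneous coordinates.\<close>

definition holomorphic_lift ::
    "(complex ^ 'n::finite \<Rightarrow> 'm::finite proj) \<Rightarrow> (complex ^ 'n) set \<Rightarrow>
     (complex ^ 'n \<Rightarrow> complex ^ 'm) \<Rightarrow> bool" where
  "holomorphic_lift e U h \<longleftrightarrow> open U \<and>
     (\<forall>w\<in>U. \<exists>D. (h has_derivative D) (at w) \<and> (\<forall>c v. D (c *s v) = c *s D v)) \<and>
     (\<forall>w\<in>U. h w \<noteq> 0 \<and> e w = proj_class (h w))"

definition holomorphic_to_proj :: "(complex ^ 'n::finite \<Rightarrow> 'm::finite proj) \<Rightarrow> bool" where
  "holomorphic_to_proj e \<longleftrightarrow> (\<forall>z. \<exists>U h. z \<in> U \<and> holomorphic_lift e U h)"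

text \<open>The tangent space of projective space at the class of \<open>a\<close> is the space of homogeneous
  coordinates modulo the line through \<open>a\<close>; hence the differential at \<open>0\<close> is injective iff the
  derivative of a lift meets that line only at the image of \<open>0\<close>.\<close>

definition injective_differential_at_0 ::
    "(complex ^ 'n::finite \<Rightarrow> 'm::finite proj) \<Rightarrow> bool" where
  "injective_differential_at_0 e \<longleftrightarrow>
     (\<exists>U h D. 0 \<in> U \<and> holomorphic_lift e U h \<and> (h has_derivative D) (at 0) \<and>
        (\<forall>v c. D v = c *s h 0 \<longrightarrow> v = 0))"

text \<open>The exponential map of the commutative complex Lie group \<open>A\<close>: the holomorphic homomorphism whose
  differential at \<open>0\<close> is the chosen identification of the affine space with the Lie algebra.  When
  \<open>A\<close> has dimension \<open>CARD('n)\<close>, an injective differential is an isomorphism onto the Lie algebra,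
  and every such identification is allowed.\<close>

definition exponential_map ::
    "'m::finite proj monoid \<Rightarrow> (complex ^ 'n::finite \<Rightarrow> 'm proj) \<Rightarrow> bool" where
  "exponential_map A e \<longleftrightarrow> (\<forall>z. e z \<in> carrier A) \<and> (\<forall>z w. e (z + w) = e z \<otimes>\<^bsub>A\<^esub> e w) \<and>
     holomorphic_to_proj e \<and> injective_differential_at_0 e"

definition lattice_of_rank :: "nat \<Rightarrow> 'a::real_vector set \<Rightarrow> bool" where
  "lattice_of_rank r L \<longleftrightarrow> (\<exists>B. finite B \<and> independent B \<and> card B = r \<and>
     L = {\<Sum>b\<in>B. of_int (k b) *\<^sub>R b |k :: 'a \<Rightarrow> int. True})"

end

theory Submission
  imports Defs "HOL-Library.Function_Algebras" "HOL-Computational_Algebra.Fundamental_Theorem_Algebra"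
begin

text \<open>
  The idea is to find a continuous section of \<open>V\<close> over a large ball whose image in the compact group
  \<open>A\<close> is small, to lift it through the exponential map, and to apply Brouwer's theorem.

  As \<open>fst ` V\<close> has full dimension, no nonzero polynomial vanishes on it. An ideal that contains the
  equations of \<open>V\<close> in an affine chart and is maximal among those without nonzero polynomials in \<open>z\<close>
  alone is prime, and modulo it every function is algebraic over the polynomials in \<open>z\<close>. Adjoining
  the coordinates one at a time, with simple roots because of characteristic zero, gives a
  continuous section \<open>\<xi>\<close> of \<open>V\<close> over any ball that avoids a certain hypersurface.

  The quotients of the coordinates of \<open>\<xi>\<close> are algebraic as well. On a ball of fixed radius \<open>R\<close> around
  \<open>t u\<close>, with \<open>u\<close> generic and \<open>t\<close> large, their equations are close to the equations formed by the
  leading forms at \<open>u\<close>, so by connectedness the section stays near one of finitely many points of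
  projective space. Hence it lifts to a map \<open>L\<close> into a ball of small radius \<open>\<epsilon>\<close>. If \<open>R\<close> is the
  covering radius of the kernel lattice plus \<open>\<epsilon>\<close>, then \<open>z \<mapsto> L z + l\<close> maps the ball to itself for some
  lattice point \<open>l\<close>, and a fixed point is the required \<open>z\<close>.
\<close>

section \<open>Polynomial functions\<close>

text \<open>The order of the choices shapes the proof. The radius \<open>R\<close> and the tolerance
  allowed around a limit point come from the kernel lattice, whereas a section of \<open>V\<close>
  is only available over balls that miss a hypersurface, so the ball is placed last and may lie
  anywhere. A tolerance that suits every such ball exists because the limit points form a finite set
  fixed in advance, independent of \<open>R\<close> and of the tolerance. That in turn needs
  coordinates algebraic over the polynomials in \<open>z\<close>, since a merely continuous section
  could drift through infinitely many points of \<open>A\<close>. The fibres of \<open>V\<close>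
  over the affine space may have positive dimension; the passage to a larger ideal cuts
  \<open>V\<close> down to a part that is generically finite over it, without any theory of
  components or hyperplane sections. The lift \<open>L\<close> is equally elementary: in a ball of
  radius below half the shortest kernel vector a preimage under the exponential map is unique, and a
  function with closed graph into a compact set is continuous.\<close>

lemma sum_fun_apply: "(\<Sum>i\<in>I. f i) x = (\<Sum>i\<in>I. f i x)"
  for f :: "'i \<Rightarrow> 'a \<Rightarrow> 'b::comm_monoid_add"
  by (induction I rule: infinite_finite_induct) auto

lemma prod_fun_apply: "(\<Prod>i\<in>I. f i) x = (\<Prod>i\<in>I. f i x)"
  for f :: "'i \<Rightarrow> 'a \<Rightarrow> 'b::comm_monoid_mult"
  by (induction I rule: infinite_finite_induct) auto

lemma power_fun_apply: "(f ^ k) x = f x ^ k" for f :: "'a \<Rightarrow> 'b::monoid_mult"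
  by (induction k) auto

lemmas fun_ring_apply = sum_fun_apply prod_fun_apply power_fun_apply

abbreviation cfun :: "complex \<Rightarrow> 'a \<Rightarrow> complex" where
  "cfun c \<equiv> (\<lambda>_. c)"

lemma poly_funs_add: "f \<in> poly_funs X \<Longrightarrow> g \<in> poly_funs X \<Longrightarrow> f + g \<in> poly_funs X"
  unfolding plus_fun_def by (rule poly_funs.add)

lemma poly_funs_mult: "f \<in> poly_funs X \<Longrightarrow> g \<in> poly_funs X \<Longrightarrow> f * g \<in> poly_funs X"
  unfolding times_fun_def by (rule poly_funs.mult)

lemma poly_funs_0: "0 \<in> poly_funs X"
  unfolding zero_fun_def by (rule poly_funs.const)

lemma poly_funs_1: "1 \<in> poly_funs X"
  unfolding one_fun_def by (rule poly_funs.const)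

lemma poly_funs_uminus: "f \<in> poly_funs X \<Longrightarrow> - f \<in> poly_funs X"
  using poly_funs_mult[OF poly_funs.const[of "-1"], of f] by (simp add: times_fun_def fun_Compl_def)

lemma poly_funs_diff: "f \<in> poly_funs X \<Longrightarrow> g \<in> poly_funs X \<Longrightarrow> f - g \<in> poly_funs X"
  using poly_funs_add[of f X "- g"] poly_funs_uminus[of g X] by simp

lemma poly_funs_sum: "(\<And>i. i \<in> I \<Longrightarrow> f i \<in> poly_funs X) \<Longrightarrow> (\<Sum>i\<in>I. f i) \<in> poly_funs X"
  by (induction I rule: infinite_finite_induct) (auto intro: poly_funs_0 poly_funs_add)

lemma poly_funs_prod: "(\<And>i. i \<in> I \<Longrightarrow> f i \<in> poly_funs X) \<Longrightarrow> (\<Prod>i\<in>I. f i) \<in> poly_funs X"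
  by (induction I rule: infinite_finite_induct) (auto intro: poly_funs_1 poly_funs_mult)

lemma poly_funs_power: "f \<in> poly_funs X \<Longrightarrow> f ^ k \<in> poly_funs X"
  by (induction k) (auto intro: poly_funs_1 poly_funs_mult)

lemma poly_funs_mono: assumes "X \<subseteq> Y" shows "poly_funs X \<subseteq> poly_funs Y"
proof
  fix f assume "f \<in> poly_funs X"
  then show "f \<in> poly_funs Y"
    by induction (use assms in \<open>auto intro: poly_funs.intros\<close>)
qed

lemmas poly_funs_closed = poly_funs.const poly_funs_add poly_funs_mult poly_funs_0 poly_funs_1
  poly_funs_uminus poly_funs_diff poly_funs_sum poly_funs_prod poly_funs_power

lemma poly_funs_comp:
  assumes "f \<in> poly_funs X" "\<And>g. g \<in> X \<Longrightarrow> g \<circ> h \<in> poly_funs Y"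
  shows "f \<circ> h \<in> poly_funs Y"
  using assms(1)
  by induction (use assms(2) in \<open>auto intro: poly_funs.intros simp: o_def\<close>)

section \<open>Spans of monomials, and linear relations by counting\<close>

definition scale_fun :: "complex \<Rightarrow> ('a \<Rightarrow> complex) \<Rightarrow> 'a \<Rightarrow> complex" where
  "scale_fun c f = cfun c * f"

interpretation cfuns: vector_space scale_fun
  by standard (auto simp: fun_eq_iff algebra_simps scale_fun_def)

text \<open>Families are used instead of sets because different indices may give the same function;
  a repetition is then itself a relation, with coefficients 1 and -1.\<close>

lemma linear_relation_of_card_less:
  fixes f :: "'i \<Rightarrow> 'a \<Rightarrow> complex"
  assumes "finite I" "finite G" "card G < card I" "\<And>i. i \<in> I \<Longrightarrow> f i \<in> cfuns.span G"
  obtains c where "\<exists>i\<in>I. c i \<noteq> 0" "(\<Sum>i\<in>I. cfun (c i) * f i) = 0"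
proof (cases "inj_on f I")
  case False
  then obtain i j where ij: "i \<in> I" "j \<in> I" "i \<noteq> j" "f i = f j"
    by (auto simp: inj_on_def)
  define c :: "'i \<Rightarrow> complex" where "c = (\<lambda>k. if k = i then 1 else if k = j then -1 else 0)"
  have "(\<Sum>k\<in>I. cfun (c k) * f k) = (\<Sum>k\<in>{i,j}. cfun (c k) * f k)"
    by (rule sum.mono_neutral_right) (use assms ij in \<open>auto simp: c_def fun_eq_iff\<close>)
  also have "\<dots> = 0" using ij by (auto simp: c_def fun_eq_iff)
  finally show ?thesis by (rule that[rotated]) (use ij in \<open>auto simp: c_def\<close>)
next
  case True
  have "cfuns.dependent (f ` I)"
  proof (rule ccontr)
    assume "cfuns.independent (f ` I)"
    from cfuns.independent_span_bound[OF \<open>finite G\<close> this] assms(4) have "card (f ` I) \<le> card G"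
      by blast
    with True assms(3) show False by (simp add: card_image)
  qed
  then obtain u where u: "\<exists>v\<in>f ` I. u v \<noteq> 0" "(\<Sum>v\<in>f ` I. cfun (u v) * v) = 0"
    using cfuns.dependent_finite[of "f ` I"] assms(1) by (auto simp: scale_fun_def)
  show ?thesis
    by (rule that[of "u \<circ> f"]) (use u True in \<open>auto simp: sum.reindex\<close>)
qed

text \<open>Each exponent is bounded separately rather than the total degree: then there are at most
  \<open>(e + 1) ^ card X\<close> monomials, and the bounds add under multiplication.\<close>

definition bounded_monomials :: "('a \<Rightarrow> complex) set \<Rightarrow> nat \<Rightarrow> ('a \<Rightarrow> complex) set" where
  "bounded_monomials X e = (\<lambda>\<alpha>. \<Prod>x\<in>X. x ^ \<alpha> x) ` (X \<rightarrow>\<^sub>E {..e})"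

lemma finite_bounded_monomials: "finite X \<Longrightarrow> finite (bounded_monomials X e)"
  unfolding bounded_monomials_def by (intro finite_imageI finite_PiE) auto

lemma card_bounded_monomials:
  assumes "finite X" shows "card (bounded_monomials X e) \<le> (e + 1) ^ card X"
proof -
  have "card (bounded_monomials X e) \<le> card (X \<rightarrow>\<^sub>E {..e})"
    unfolding bounded_monomials_def by (intro card_image_le finite_PiE) (use assms in auto)
  also have "\<dots> = (e + 1) ^ card X" using assms by (simp add: card_PiE)
  finally show ?thesis .
qed

lemma bounded_monomials_eq:
  "bounded_monomials X e = {\<Prod>x\<in>X. x ^ \<alpha> x |\<alpha>. \<forall>x\<in>X. \<alpha> x \<le> e}"
proof (rule antisym; rule subsetI)
  fix f assume "f \<in> {\<Prod>x\<in>X. x ^ \<alpha> x |\<alpha>. \<forall>x\<in>X. \<alpha> x \<le> e}"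
  then obtain \<alpha> where \<alpha>: "f = (\<Prod>x\<in>X. x ^ \<alpha> x)" "\<forall>x\<in>X. \<alpha> x \<le> e" by blast
  then have "f = (\<Prod>x\<in>X. x ^ restrict \<alpha> X x)" by simp
  moreover have "restrict \<alpha> X \<in> X \<rightarrow>\<^sub>E {..e}" using \<alpha>(2) by auto
  ultimately show "f \<in> bounded_monomials X e" unfolding bounded_monomials_def by blast
qed (auto simp: bounded_monomials_def)

lemma bounded_monomials_mono: "e \<le> e' \<Longrightarrow> bounded_monomials X e \<subseteq> bounded_monomials X e'"
  unfolding bounded_monomials_eq by (auto intro: order_trans)

lemma bounded_monomials_mult:
  assumes "f \<in> bounded_monomials X e" "g \<in> bounded_monomials X e'"
  shows "f * g \<in> bounded_monomials X (e + e')"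
proof -
  obtain \<alpha> \<beta> where "f = (\<Prod>x\<in>X. x ^ \<alpha> x)" "\<forall>x\<in>X. \<alpha> x \<le> e" "g = (\<Prod>x\<in>X. x ^ \<beta> x)" "\<forall>x\<in>X. \<beta> x \<le> e'"
    using assms unfolding bounded_monomials_eq by blast
  then have "f * g = (\<Prod>x\<in>X. x ^ (\<alpha> x + \<beta> x))" "\<forall>x\<in>X. \<alpha> x + \<beta> x \<le> e + e'"
    by (auto simp: power_add prod.distrib add_mono)
  then show ?thesis unfolding bounded_monomials_eq
    by (intro CollectI exI[of _ "\<lambda>x. \<alpha> x + \<beta> x"]) simp
qed

lemma span_mult:
  assumes "f \<in> cfuns.span S" "g \<in> cfuns.span T" "\<And>a b. a \<in> S \<Longrightarrow> b \<in> T \<Longrightarrow> a * b \<in> cfuns.span U"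
  shows "f * g \<in> cfuns.span U"
proof -
  have 1: "f * b \<in> cfuns.span U" if "b \<in> T" for b
    using assms(1)
  proof (induction rule: cfuns.span_induct_alt)
    case base
    have "0 * b = 0" by simp
    then show ?case using cfuns.span_zero by metis
  next
    case (step c x y)
    have "(scale_fun c x + y) * b = scale_fun c (x * b) + y * b" by (simp add: algebra_simps scale_fun_def)
    with step assms(3)[OF step(1) that] show ?case
      by (metis cfuns.span_add cfuns.span_scale)
  qed
  show ?thesis
    using assms(2)
  proof (induction rule: cfuns.span_induct_alt)
    case base
    have "f * 0 = 0" by simp
    then show ?case using cfuns.span_zero by metis
  next
    case (step c x y)
    have "f * (scale_fun c x + y) = scale_fun c (f * x) + f * y" by (simp add: algebra_simps scale_fun_def)
    with step 1[OF step(1)] show ?case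
      by (metis cfuns.span_add cfuns.span_scale)
  qed
qed

lemma span_bounded_monomials_mult:
  assumes "f \<in> cfuns.span (bounded_monomials X e)" "g \<in> cfuns.span (bounded_monomials X e')"
  shows "f * g \<in> cfuns.span (bounded_monomials X (e + e'))"
  using assms by (rule span_mult) (blast intro: cfuns.span_base bounded_monomials_mult)

lemma one_in_bounded_monomials: "1 \<in> bounded_monomials X e"
  unfolding bounded_monomials_eq by (auto intro!: exI[of _ "\<lambda>_. 0"])

lemma poly_funs_in_span:
  assumes "finite X" "f \<in> poly_funs X"
  shows "\<exists>e. f \<in> cfuns.span (bounded_monomials X e)"
  using assms(2)
proof induction
  case (const c)
  have "cfun c = scale_fun c 1" by (simp add: fun_eq_iff scale_fun_def)
  also have "\<dots> \<in> cfuns.span (bounded_monomials X 0)"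
    by (intro cfuns.span_scale cfuns.span_base one_in_bounded_monomials)
  finally show ?case by blast
next
  case (coord x)
  define \<alpha> where "\<alpha> = (\<lambda>y. if y = x then 1 else 0 :: nat)"
  have "x = (\<Prod>y\<in>X. if y = x then x else 1)"
    using coord assms(1) by simp
  also have "\<dots> = (\<Prod>y\<in>X. y ^ \<alpha> y)"
    by (rule prod.cong) (auto simp: \<alpha>_def)
  finally have "x \<in> bounded_monomials X 1"
    unfolding bounded_monomials_eq by (auto intro!: exI[of _ \<alpha>] simp: \<alpha>_def)
  then show ?case by (blast intro: cfuns.span_base)
next
  case (add f g)
  then obtain a b where "f \<in> cfuns.span (bounded_monomials X a)" "g \<in> cfuns.span (bounded_monomials X b)"
    by blast
  moreover have "bounded_monomials X a \<subseteq> bounded_monomials X (max a b)"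
      "bounded_monomials X b \<subseteq> bounded_monomials X (max a b)"
    by (auto intro!: bounded_monomials_mono)
  ultimately have "f \<in> cfuns.span (bounded_monomials X (max a b))"
      "g \<in> cfuns.span (bounded_monomials X (max a b))"
    using cfuns.span_mono by blast+
  then show ?case using cfuns.span_add unfolding plus_fun_def by blast
next
  case (mult f g)
  then show ?case using span_bounded_monomials_mult unfolding times_fun_def by blast
qed

text \<open>The polynomials form a complex vector space of countable dimension.\<close>

lemma poly_funs_uncountable_relation:
  assumes X: "finite X" and U: "uncountable U" and f: "\<And>i. i \<in> U \<Longrightarrow> f i \<in> poly_funs X"
  obtains I c where "finite I" "I \<subseteq> U" "\<exists>i\<in>I. c i \<noteq> 0" "(\<Sum>i\<in>I. cfun (c i) * f i) = 0"
proof -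
  define W where "W = (\<lambda>e. {i\<in>U. f i \<in> cfuns.span (bounded_monomials X e)})"
  have "U = (\<Union>e. W e)" using poly_funs_in_span[OF X f] by (auto simp: W_def)
  with U have "\<exists>e. uncountable (W e)" by auto
  then obtain e where "infinite (W e)" using countable_finite by blast
  then obtain I where I: "finite I" "card I = Suc (card (bounded_monomials X e))" "I \<subseteq> W e"
    using infinite_arbitrarily_large by metis
  from linear_relation_of_card_less[of I "bounded_monomials X e" f] I finite_bounded_monomials[OF X]
  obtain c where "\<exists>i\<in>I. c i \<noteq> 0" "(\<Sum>i\<in>I. cfun (c i) * f i) = 0"
    by (auto simp: W_def)
  with I show ?thesis by (intro that[of I c]) (auto simp: W_def)
qed

section \<open>Algebraic independence and dimension\<close>

text \<open>This is independence in the ring of functions restricted to \<open>C\<close>. The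
  exponents are extensional so that distinct members of \<open>E\<close> are distinct monomials;
  otherwise two copies of one monomial would make every family dependent.\<close>

definition alg_indep_on :: "'a set \<Rightarrow> nat \<Rightarrow> (nat \<Rightarrow> 'a \<Rightarrow> complex) \<Rightarrow> bool" where
  "alg_indep_on C t g \<longleftrightarrow> (\<forall>E c. finite E \<and> E \<subseteq> ({..<t} \<rightarrow>\<^sub>E UNIV) \<and>
     (\<forall>x\<in>C. (\<Sum>\<alpha>\<in>E. c \<alpha> * (\<Prod>i<t. g i x ^ \<alpha> i)) = 0) \<longrightarrow> (\<forall>\<alpha>\<in>E. c \<alpha> = 0))"

text \<open>Counting instead of field theory: there are \<open>(M + 1) ^ t\<close> products of
  powers of the \<open>g i\<close> with exponents up to \<open>M\<close>, and all lie in the span of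
  a set of monomials whose size grows only like \<open>M ^ card X\<close>, so
  \<open>t > card X\<close> forces a relation.\<close>

lemma alg_indep_on_card:
  assumes X: "finite X" and g: "\<And>i. i < t \<Longrightarrow> g i \<in> poly_funs X" and indep: "alg_indep_on UNIV t g"
  shows "t \<le> card X"
proof (rule ccontr)
  assume t: "\<not> t \<le> card X"
  have "\<exists>e. \<forall>i<t. g i \<in> cfuns.span (bounded_monomials X e)"
  proof -
    obtain ee where ee: "\<And>i. i < t \<Longrightarrow> g i \<in> cfuns.span (bounded_monomials X (ee i))"
      using poly_funs_in_span[OF X g] by metis
    have "g i \<in> cfuns.span (bounded_monomials X (\<Sum>i<t. ee i))" if "i < t" for i
    proof -
      have "ee i \<le> (\<Sum>i<t. ee i)" using that by (intro member_le_sum) auto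
      from cfuns.span_mono[OF bounded_monomials_mono[OF this]] ee[OF that] show ?thesis by blast
    qed
    then show ?thesis by blast
  qed
  then obtain e where e: "\<And>i. i < t \<Longrightarrow> g i \<in> cfuns.span (bounded_monomials X e)" by blast
  \<comment> \<open>Chosen so that the bound \<open>(e * M * t + 1) ^ card X\<close> is at most
    \<open>M * (M + 1) ^ card X\<close>, which is less than
    \<open>(M + 1) ^ Suc (card X)\<close>.\<close>
  define M where "M = (e * t + 1) ^ card X"
  define G where "G = bounded_monomials X (e * M * t)"
  define I where "I = {..<t} \<rightarrow>\<^sub>E {..M}"
  have pow: "f ^ k \<in> cfuns.span (bounded_monomials X (e * k))"
    if "f \<in> cfuns.span (bounded_monomials X e)" for f k
  proof (induction k)
    case 0 show ?case
      by (simp only: power_0 lessThan_0 prod.empty) (intro cfuns.span_base one_in_bounded_monomials)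
  next
    case (Suc k)
    from span_bounded_monomials_mult[OF that Suc] show ?case
      by (simp only: power_Suc mult_Suc_right)
  qed
  have prd: "(\<Prod>i<s. g i ^ \<alpha> i) \<in> cfuns.span (bounded_monomials X (e * M * s))"
    if "\<alpha> \<in> I" "s \<le> t" for \<alpha> s
    using that(2)
  proof (induction s)
    case 0 show ?case
      by (simp only: power_0 lessThan_0 prod.empty) (intro cfuns.span_base one_in_bounded_monomials)
  next
    case (Suc s)
    have "\<alpha> s \<le> M" using that(1) Suc.prems by (auto simp: I_def PiE_iff)
    then have "bounded_monomials X (e * \<alpha> s) \<subseteq> bounded_monomials X (e * M)"
      by (intro bounded_monomials_mono) simp
    from cfuns.span_mono[OF this] pow[OF e, of s "\<alpha> s"] Suc.prems
    have "g s ^ \<alpha> s \<in> cfuns.span (bounded_monomials X (e * M))" by auto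
    moreover have "e * M * s + e * M = e * M * Suc s" by simp
    moreover have "s \<le> t" using Suc.prems by simp
    ultimately show ?case
      unfolding prod.lessThan_Suc using span_bounded_monomials_mult[OF Suc.IH] by metis
  qed
  have "card G \<le> (e * M * t + 1) ^ card X"
    unfolding G_def by (rule card_bounded_monomials[OF X])
  also have "\<dots> \<le> ((e * t + 1) * (M + 1)) ^ card X"
    by (intro power_mono) (auto simp: algebra_simps)
  also have "\<dots> = M * (M + 1) ^ card X" by (simp only: M_def power_mult_distrib)
  also have "\<dots> < (M + 1) ^ Suc (card X)" by simp
  also have "\<dots> \<le> (M + 1) ^ t" using t by (intro power_increasing) auto
  also have "\<dots> = card I" by (simp add: I_def card_PiE)
  finally have "card G < card I" .
  moreover have fin: "finite I" unfolding I_def by (intro finite_PiE) auto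
  ultimately obtain c where c: "\<exists>\<alpha>\<in>I. c \<alpha> \<noteq> 0" "(\<Sum>\<alpha>\<in>I. cfun (c \<alpha>) * (\<Prod>i<t. g i ^ \<alpha> i)) = 0"
    using linear_relation_of_card_less[of I G "\<lambda>\<alpha>. \<Prod>i<t. g i ^ \<alpha> i"] prd[of _ t]
      finite_bounded_monomials[OF X] by (auto simp: G_def)
  have "(\<Sum>\<alpha>\<in>I. c \<alpha> * (\<Prod>i<t. g i x ^ \<alpha> i)) = 0" for x
    using fun_cong[OF c(2), of x] by (simp add: fun_ring_apply)
  moreover have "I \<subseteq> {..<t} \<rightarrow>\<^sub>E UNIV" by (auto simp: I_def PiE_iff)
  ultimately have "\<forall>\<alpha>\<in>I. c \<alpha> = 0"
    using indep fin unfolding alg_indep_on_def by blast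
  with c(1) show False by blast
qed

text \<open>Divide a relation by the largest possible power of \<open>f\<close>, then restrict it to \<open>C\<close>.\<close>

lemma alg_indep_on_step:
  assumes dom: "\<And>f g. f \<in> poly_funs X \<Longrightarrow> g \<in> poly_funs X \<Longrightarrow> \<forall>x\<in>D. f x * g x = 0 \<Longrightarrow>
      (\<forall>x\<in>D. f x = 0) \<or> (\<forall>x\<in>D. g x = 0)"
    and CD: "C \<subseteq> D" and indep: "alg_indep_on C t g"
    and g: "\<And>i. i < t \<Longrightarrow> g i \<in> poly_funs X" and f: "f \<in> poly_funs X"
    and fC: "\<And>x. x \<in> C \<Longrightarrow> f x = 0" and fD: "\<exists>x\<in>D. f x \<noteq> 0"
  shows "alg_indep_on D (Suc t) (g(t := f))"
  unfolding alg_indep_on_def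
proof (intro allI impI)
  fix E and c :: "(nat \<Rightarrow> nat) \<Rightarrow> complex"
  assume "finite E \<and> E \<subseteq> {..<Suc t} \<rightarrow>\<^sub>E UNIV \<and>
     (\<forall>x\<in>D. (\<Sum>\<alpha>\<in>E. c \<alpha> * (\<Prod>i<Suc t. (g(t := f)) i x ^ \<alpha> i)) = 0)"
  then have E: "finite E" "E \<subseteq> {..<Suc t} \<rightarrow>\<^sub>E UNIV"
    and rel': "\<And>x. x \<in> D \<Longrightarrow> (\<Sum>\<alpha>\<in>E. c \<alpha> * (\<Prod>i<Suc t. (g(t := f)) i x ^ \<alpha> i)) = 0"
    by blast+
  have "(\<Prod>i<Suc t. (g(t := f)) i x ^ \<alpha> i) = (\<Prod>i<t. g i x ^ \<alpha> i) * f x ^ \<alpha> t" for \<alpha> x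
    unfolding prod.lessThan_Suc by (intro arg_cong2[of _ _ _ _ "(*)"] prod.cong) auto
  with rel' have rel: "\<And>x. x \<in> D \<Longrightarrow> (\<Sum>\<alpha>\<in>E. c \<alpha> * ((\<Prod>i<t. g i x ^ \<alpha> i) * f x ^ \<alpha> t)) = 0"
    by simp
  show "\<forall>\<alpha>\<in>E. c \<alpha> = 0"
  proof (rule ccontr)
    assume "\<not> (\<forall>\<alpha>\<in>E. c \<alpha> = 0)"
    define E1 where "E1 = {\<alpha>\<in>E. c \<alpha> \<noteq> 0}"
    have E1: "finite E1" "E1 \<noteq> {}" using \<open>\<not> _\<close> E(1) by (auto simp: E1_def)
    define r where "r = Min ((\<lambda>\<alpha>. \<alpha> t) ` E1)"
    have r: "r \<le> \<alpha> t" if "\<alpha> \<in> E1" for \<alpha> using E1 that by (auto simp: r_def)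
    have "r \<in> (\<lambda>\<alpha>. \<alpha> t) ` E1" unfolding r_def by (rule Min_in) (use E1 in auto)
    then obtain \<alpha>0 where \<alpha>0: "\<alpha>0 \<in> E1" "\<alpha>0 t = r" by blast
    define q where "q = (\<Sum>\<alpha>\<in>E1. cfun (c \<alpha>) * ((\<Prod>i<t. g i ^ \<alpha> i) * f ^ (\<alpha> t - r)))"
    have q: "q \<in> poly_funs X" unfolding q_def using g f by (intro poly_funs_closed) auto
    have "q x * (f ^ r) x = 0" if "x \<in> D" for x
    proof -
      have "q x * (f ^ r) x = (\<Sum>\<alpha>\<in>E1. c \<alpha> * ((\<Prod>i<t. g i x ^ \<alpha> i) * (f x ^ (\<alpha> t - r) * f x ^ r)))"
        unfolding q_def fun_ring_apply sum_distrib_right by (simp add: fun_ring_apply mult_ac)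
      also have "\<dots> = (\<Sum>\<alpha>\<in>E1. c \<alpha> * ((\<Prod>i<t. g i x ^ \<alpha> i) * f x ^ \<alpha> t))"
        by (rule sum.cong) (use r in \<open>auto simp flip: power_add\<close>)
      also have "\<dots> = (\<Sum>\<alpha>\<in>E. c \<alpha> * ((\<Prod>i<t. g i x ^ \<alpha> i) * f x ^ \<alpha> t))"
        by (rule sum.mono_neutral_left) (use E in \<open>auto simp: E1_def\<close>)
      finally show ?thesis using rel[OF that] by simp
    qed
    then have "(\<forall>x\<in>D. q x = 0) \<or> (\<forall>x\<in>D. (f ^ r) x = 0)"
      by (intro dom q poly_funs_power f) auto
    with fD have q0: "\<forall>x\<in>D. q x = 0" by (auto simp: power_fun_apply)
    define E2 where "E2 = {\<alpha>\<in>E1. \<alpha> t = r}"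
    \<comment> \<open>Dropping the last exponent loses nothing on \<open>E2\<close>: there it always
      equals \<open>r\<close>, and beyond it extensional functions agree.\<close>
    have inj: "inj_on (\<lambda>\<alpha>. restrict \<alpha> {..<t}) E2"
    proof (rule inj_onI)
      fix \<alpha> \<beta> assume ab: "\<alpha> \<in> E2" "\<beta> \<in> E2" "restrict \<alpha> {..<t} = restrict \<beta> {..<t}"
      have "\<alpha> i = \<beta> i" for i
      proof -
        consider "i < t" | "i = t" | "i > t" by linarith
        then show ?thesis
        proof cases
          case 1 then show ?thesis using fun_cong[OF ab(3), of i] by simp
        next
          case 2 then show ?thesis using ab by (auto simp: E2_def)
        next
          case 3
          have "\<alpha> \<in> {..<Suc t} \<rightarrow>\<^sub>E UNIV" "\<beta> \<in> {..<Suc t} \<rightarrow>\<^sub>E UNIV"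
            using ab E by (auto simp: E2_def E1_def)
          with 3 show ?thesis by (simp add: PiE_def extensional_def)
        qed
      qed
      then show "\<alpha> = \<beta>" by blast
    qed
    define h where "h = the_inv_into E2 (\<lambda>\<alpha>. restrict \<alpha> {..<t})"
    have h: "h (restrict \<alpha> {..<t}) = \<alpha>" if "\<alpha> \<in> E2" for \<alpha>
      unfolding h_def by (rule the_inv_into_f_f[OF inj that])
    have "(\<Sum>\<beta>\<in>(\<lambda>\<alpha>. restrict \<alpha> {..<t}) ` E2. c (h \<beta>) * (\<Prod>i<t. g i x ^ \<beta> i)) = 0" if "x \<in> C" for x
    proof -
      have "(\<Sum>\<beta>\<in>(\<lambda>\<alpha>. restrict \<alpha> {..<t}) ` E2. c (h \<beta>) * (\<Prod>i<t. g i x ^ \<beta> i))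
          = (\<Sum>\<alpha>\<in>E2. c \<alpha> * (\<Prod>i<t. g i x ^ \<alpha> i))"
        by (subst sum.reindex[OF inj]) (auto simp: h intro!: sum.cong)
      \<comment> \<open>On \<open>E2\<close> the inserted factor is a zeroth power, hence 1 even
        where \<open>f\<close> vanishes. The terms outside \<open>E2\<close>, added next, carry a
        positive power of \<open>f\<close> and vanish on \<open>C\<close>.\<close>
      also have "\<dots> = (\<Sum>\<alpha>\<in>E2. c \<alpha> * ((\<Prod>i<t. g i x ^ \<alpha> i) * f x ^ (\<alpha> t - r)))"
        by (rule sum.cong) (auto simp: E2_def)
      also have "\<dots> = (\<Sum>\<alpha>\<in>E1. c \<alpha> * ((\<Prod>i<t. g i x ^ \<alpha> i) * f x ^ (\<alpha> t - r)))"
      proof (rule sum.mono_neutral_left)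
        show "\<forall>\<alpha>\<in>E1 - E2. c \<alpha> * ((\<Prod>i<t. g i x ^ \<alpha> i) * f x ^ (\<alpha> t - r)) = 0"
        proof
          fix \<alpha> assume "\<alpha> \<in> E1 - E2"
          with r[of \<alpha>] have "\<alpha> t - r \<noteq> 0" by (auto simp: E2_def)
          with fC[OF that] show "c \<alpha> * ((\<Prod>i<t. g i x ^ \<alpha> i) * f x ^ (\<alpha> t - r)) = 0" by simp
        qed
      qed (use E1 in \<open>auto simp: E2_def\<close>)
      also have "\<dots> = q x" by (simp add: q_def fun_ring_apply)
      finally show ?thesis using q0 that CD by auto
    qed
    moreover have "finite ((\<lambda>\<alpha>. restrict \<alpha> {..<t}) ` E2)" using E1 by (simp add: E2_def)
    moreover have "(\<lambda>\<alpha>. restrict \<alpha> {..<t}) ` E2 \<subseteq> {..<t} \<rightarrow>\<^sub>E UNIV"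
      by (auto split: if_splits)
    ultimately have "\<forall>\<beta>\<in>(\<lambda>\<alpha>. restrict \<alpha> {..<t}) ` E2. c (h \<beta>) = 0"
      using indep[unfolded alg_indep_on_def, rule_format, of "(\<lambda>\<alpha>. restrict \<alpha> {..<t}) ` E2" "\<lambda>\<beta>. c (h \<beta>)"] by blast
    moreover have "\<alpha>0 \<in> E2" using \<alpha>0 by (simp add: E2_def)
    ultimately have "c \<alpha>0 = 0" using h by auto
    with \<alpha>0 show False by (simp add: E1_def)
  qed
qed

section \<open>Polynomials on affine space and the Zariski topology\<close>

lemma polys_line:
  fixes f :: "complex ^ 'n::finite \<Rightarrow> complex"
  assumes "f \<in> polys"
  shows "\<exists>p. \<forall>t. f (x + t *s y) = poly p t"
  using assms unfolding polys_def
proof induction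
  case (const c)
  show ?case by (rule exI[of _ "[:c:]"]) simp
next
  case (coord f)
  then obtain i where "f = (\<lambda>x. x $ i)" by blast
  then show ?case by (intro exI[of _ "[:x $ i, y $ i:]"]) (simp add: mult.commute)
next
  case (add f g)
  then obtain p q where "\<forall>t. f (x + t *s y) = poly p t" "\<forall>t. g (x + t *s y) = poly q t" by blast
  then show ?case by (intro exI[of _ "p + q"]) simp
next
  case (mult f g)
  then obtain p q where "\<forall>t. f (x + t *s y) = poly p t" "\<forall>t. g (x + t *s y) = poly q t" by blast
  then show ?case by (intro exI[of _ "p * q"]) simp
qed

text \<open>On the line through a point with \<open>f\<close> nonzero and a point with
  \<open>g\<close> nonzero, both restrictions are nonzero univariate polynomials, while their
  product vanishes everywhere.\<close>

lemma polys_no_zero_divisors: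
  fixes f g :: "complex ^ 'n::finite \<Rightarrow> complex"
  assumes "f \<in> polys" "g \<in> polys" "f * g = 0"
  shows "f = 0 \<or> g = 0"
proof (rule ccontr)
  assume "\<not> (f = 0 \<or> g = 0)"
  then obtain x y where xy: "f x \<noteq> 0" "g y \<noteq> 0" by (auto simp: fun_eq_iff)
  obtain p q where pq: "\<forall>t. f (x + t *s (y - x)) = poly p t" "\<forall>t. g (x + t *s (y - x)) = poly q t"
    using polys_line assms by metis
  have "poly (p * q) t = 0" for t
    using fun_cong[OF assms(3), of "x + t *s (y - x)"] pq by simp
  then have "p * q = 0" using poly_all_0_iff_0 by blast
  then have "p = 0 \<or> q = 0" by simp
  with pq(1)[rule_format, of 0] pq(2)[rule_format, of 1] xy show False by auto
qed

lemma polys_prod_nonzero: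
  fixes f :: "'i \<Rightarrow> complex ^ 'n::finite \<Rightarrow> complex"
  assumes "\<And>i. i \<in> I \<Longrightarrow> f i \<in> polys" "\<And>i. i \<in> I \<Longrightarrow> f i \<noteq> 0"
  shows "(\<Prod>i\<in>I. f i) \<noteq> 0"
  using assms
proof (induction I rule: infinite_finite_induct)
  case (insert i I)
  have "(\<Prod>i\<in>I. f i) \<in> polys" using insert.prems unfolding polys_def by (intro poly_funs_prod) auto
  with insert have "f i * (\<Prod>i\<in>I. f i) \<noteq> 0" using polys_no_zero_divisors by blast
  then show ?case by (metis insert.hyps prod.insert)
qed (auto simp: fun_eq_iff)

lemma openin_topology_generated_by_basis:
  assumes "openin (topology_generated_by \<B>) U" "p \<in> U"
    and inter: "\<And>A B. A \<in> \<B> \<Longrightarrow> B \<in> \<B> \<Longrightarrow> A \<inter> B \<in> \<B>"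
  shows "\<exists>B\<in>\<B>. p \<in> B \<and> B \<subseteq> U"
proof -
  from assms(1) have "generate_topology_on \<B> U" by (simp add: openin_topology_generated_by_iff)
  then have "\<forall>p\<in>U. \<exists>B\<in>\<B>. p \<in> B \<and> B \<subseteq> U"
  proof induction
    case (Int a b)
    show ?case
    proof
      fix p assume p: "p \<in> a \<inter> b"
      with Int.IH obtain A B where "A \<in> \<B>" "p \<in> A" "A \<subseteq> a" "B \<in> \<B>" "p \<in> B" "B \<subseteq> b" by blast
      then show "\<exists>B\<in>\<B>. p \<in> B \<and> B \<subseteq> a \<inter> b" using inter by (intro bexI[of _ "A \<inter> B"]) auto
    qed
  next
    case (UN K)
    show ?case
    proof
      fix p assume "p \<in> \<Union>K"
      then obtain k where "k \<in> K" "p \<in> k" by blast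
      with UN.IH[of k] obtain B where "B \<in> \<B>" "p \<in> B" "B \<subseteq> k" by blast
      with \<open>k \<in> K\<close> show "\<exists>B\<in>\<B>. p \<in> B \<and> B \<subseteq> \<Union>K" by blast
    qed
  next
    case (Basis s)
    then show ?case by blast
  qed simp
  with assms(2) show ?thesis by blast
qed

lemma closedin_affine_zariski_zero_set:
  fixes f :: "complex ^ 'n::finite \<Rightarrow> complex"
  assumes "f \<in> polys" shows "closedin affine_zariski {z. f z = 0}"
proof -
  have open_nz: "openin affine_zariski {z. g z \<noteq> 0}" if "g \<in> polys" for g :: "complex ^ 'n \<Rightarrow> complex"
    unfolding affine_zariski_def by (rule topology_generated_by_Basis) (use that in blast)
  have "{z. (1 :: complex ^ 'n \<Rightarrow> complex) z \<noteq> 0} = UNIV" by simp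
  with open_nz[of 1] have "openin affine_zariski (UNIV :: (complex ^ 'n) set)"
    by (metis poly_funs_1 polys_def)
  then have "topspace affine_zariski = (UNIV :: (complex ^ 'n) set)"
    using openin_subset by blast
  moreover have "UNIV - {z. f z = 0} = {z. f z \<noteq> 0}" by blast
  ultimately show ?thesis using open_nz[OF assms] unfolding closedin_def by auto
qed

text \<open>One polynomial is enough because the basic open sets are closed under
  intersection.\<close>

lemma affine_zariski_separate:
  fixes p :: "complex ^ 'n::finite"
  assumes "closedin affine_zariski T" "p \<notin> T"
  obtains f where "f \<in> polys" "f p \<noteq> 0" "\<And>x. x \<in> T \<Longrightarrow> f x = 0"
proof -
  have UNIV: "topspace affine_zariski = (UNIV :: (complex ^ 'n) set)"
    using closedin_affine_zariski_zero_set[of "0 :: complex ^ 'n \<Rightarrow> complex"] closedin_subset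
    by (fastforce simp: polys_def poly_funs_0)
  have "\<exists>B\<in>{{z. f z \<noteq> 0} |f. f \<in> polys}. p \<in> B \<and> B \<subseteq> UNIV - T"
  proof (rule openin_topology_generated_by_basis)
    show "openin (topology_generated_by {{z. f z \<noteq> 0} |f. f \<in> polys}) (UNIV - T)"
      using assms(1) by (simp add: closedin_def UNIV flip: affine_zariski_def)
    show "p \<in> UNIV - T" using assms(2) by simp
    show "A \<inter> B \<in> {{z. f z \<noteq> 0} |f. f \<in> polys}"
      if AB: "A \<in> {{z. f z \<noteq> 0} |f. f \<in> polys}" "B \<in> {{z. f z \<noteq> 0} |f. f \<in> polys}"
      for A B :: "(complex ^ 'n) set"
    proof -
      from AB obtain f g where "A = {z. f z \<noteq> 0}" "B = {z. g z \<noteq> 0}" "f \<in> polys" "g \<in> polys"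
        by blast
      then have "A \<inter> B = {z. (f * g) z \<noteq> 0}" "f * g \<in> polys"
        by (auto simp: polys_def intro: poly_funs_mult)
      then show ?thesis by blast
    qed
  qed
  then show ?thesis using that by blast
qed

text \<open>This is the cancellation that allows a relation on an irreducible set to be divided by a
  power of a polynomial.\<close>

lemma irreducible_closedin_domain:
  fixes S :: "(complex ^ 'n::finite) set"
  assumes C: "irreducible_closedin (subtopology affine_zariski S) C"
    and fg: "f \<in> polys" "g \<in> polys" and 0: "\<forall>x\<in>C. f x * g x = 0"
  shows "(\<forall>x\<in>C. f x = 0) \<or> (\<forall>x\<in>C. g x = 0)"
proof -
  let ?T = "subtopology affine_zariski S"
  have cl: "closedin ?T ({z. h z = 0} \<inter> S)" if "h \<in> polys" for h
    using closedin_affine_zariski_zero_set[OF that] by (auto simp: closedin_subtopology)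
  have "closedin ?T C" using C by (simp add: irreducible_closedin_def)
  then have "C \<subseteq> S" by (auto simp: closedin_subtopology)
  with 0 have "C \<subseteq> ({z. f z = 0} \<inter> S) \<union> ({z. g z = 0} \<inter> S)" by auto
  with C cl[OF fg(1)] cl[OF fg(2)]
  have "C \<subseteq> {z. f z = 0} \<inter> S \<or> C \<subseteq> {z. g z = 0} \<inter> S"
    unfolding irreducible_closedin_def by blast
  then show ?thesis by blast
qed

text \<open>Each strict inclusion supplies a polynomial that vanishes on the smaller set but not on
  the larger one, and such a polynomial is independent of those already found on the smaller
  set.\<close>

lemma irreducible_chain_alg_indep:
  fixes S :: "(complex ^ 'n::finite) set"
  assumes "\<forall>i\<le>k. irreducible_closedin (subtopology affine_zariski S) (C i)" "\<forall>i<k. C i \<subset> C (Suc i)"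
  shows "\<exists>g. (\<forall>i<k. g i \<in> polys) \<and> alg_indep_on (C k) k g"
  using assms
proof (induction k)
  case 0
  then obtain x where x: "x \<in> C 0" by (auto simp: irreducible_closedin_def)
  have "alg_indep_on (C 0) 0 (\<lambda>_. 0)"
    unfolding alg_indep_on_def
  proof (intro allI impI)
    fix E and c :: "(nat \<Rightarrow> nat) \<Rightarrow> complex"
    assume "finite E \<and> E \<subseteq> {..<0} \<rightarrow>\<^sub>E UNIV \<and>
      (\<forall>x\<in>C 0. (\<Sum>\<alpha>\<in>E. c \<alpha> * (\<Prod>i<0. (0 :: complex ^ 'n \<Rightarrow> complex) x ^ \<alpha> i)) = 0)"
    \<comment> \<open>For \<open>t = 0\<close> there is only one exponent function, so a relation
      has at most one term, and the point \<open>x\<close> forces its coefficient to be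
      zero.\<close>
    then have "E \<subseteq> {\<lambda>_. undefined}" "(\<Sum>\<alpha>\<in>E. c \<alpha>) = 0" using x by auto
    then show "\<forall>\<alpha>\<in>E. c \<alpha> = 0" by (cases "E = {}") (auto simp: subset_singleton_iff)
  qed
  then show ?case by auto
next
  case (Suc k)
  then obtain g where g: "\<forall>i<k. g i \<in> polys" "alg_indep_on (C k) k g" by auto
  have sub: "C k \<subset> C (Suc k)" using Suc.prems by auto
  then obtain p where p: "p \<in> C (Suc k)" "p \<notin> C k" by blast
  have "closedin (subtopology affine_zariski S) (C k)" "closedin (subtopology affine_zariski S) (C (Suc k))"
    using Suc.prems by (auto simp: irreducible_closedin_def)
  then obtain T where T: "closedin affine_zariski T" "C k = T \<inter> S" "C (Suc k) \<subseteq> S"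
    by (auto simp: closedin_subtopology)
  with p have "p \<notin> T" by blast
  from affine_zariski_separate[OF T(1) this] obtain f
    where f: "f \<in> polys" "f p \<noteq> 0" "\<And>x. x \<in> T \<Longrightarrow> f x = 0" by blast
  have irr: "irreducible_closedin (subtopology affine_zariski S) (C (Suc k))"
    using Suc.prems by auto
  have "alg_indep_on (C (Suc k)) (Suc k) (g(k := f))"
    by (rule alg_indep_on_step[where X = "range (\<lambda>i x. x $ i)" and C = "C k"])
       (use irreducible_closedin_domain[OF irr] sub g f T p in \<open>auto simp: polys_def\<close>)
  moreover have "\<forall>i<Suc k. (g(k := f)) i \<in> polys" using g f by auto
  ultimately show ?case by blast
qed

text \<open>A nonzero \<open>h\<close> would provide one further step, from the top of a longest
  chain to the whole space, and so more independent polynomials on the space than it has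
  coordinates.\<close>

lemma polys_vanishing_on_full_dim:
  fixes S :: "(complex ^ 'n::finite) set"
  assumes dim: "affine_dim S = enat CARD('n)" and h: "h \<in> polys" "\<And>z. z \<in> S \<Longrightarrow> h z = 0"
  shows "h = 0"
proof (rule ccontr)
  assume "h \<noteq> 0"
  \<comment> \<open>A bound just below the supremum already yields a chain with at least
    \<open>CARD('n)\<close> steps, so attainment of the supremum need not be discussed.\<close>
  have "enat (CARD('n) - 1) < affine_dim S" unfolding dim by simp
  then obtain k C where k: "enat (CARD('n) - 1) < enat k"
    and C: "\<forall>i\<le>k. irreducible_closedin (subtopology affine_zariski S) (C i)" "\<forall>i<k. C i \<subset> C (Suc i)"
    unfolding affine_dim_def krull_dim_def less_Sup_iff by blast
  obtain g where g: "\<forall>i<k. g i \<in> polys" "alg_indep_on (C k) k g"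
    using irreducible_chain_alg_indep[OF C] by blast
  have "closedin (subtopology affine_zariski S) (C k)"
    using C(1) by (simp add: irreducible_closedin_def)
  then have "C k \<subseteq> S" by (auto simp: closedin_subtopology)
  with h have h0: "h x = 0" if "x \<in> C k" for x using that by blast
  have "alg_indep_on UNIV (Suc k) (g(k := h))"
  proof (rule alg_indep_on_step[where X = "range (\<lambda>i x. x $ i)" and C = "C k"])
    fix f g :: "complex ^ 'n \<Rightarrow> complex"
    show "(\<forall>x\<in>UNIV. f x = 0) \<or> (\<forall>x\<in>UNIV. g x = 0)"
      if "f \<in> poly_funs (range (\<lambda>i x. x $ i))" "g \<in> poly_funs (range (\<lambda>i x. x $ i))"
        "\<forall>x\<in>UNIV. f x * g x = 0"
      using polys_no_zero_divisors[of f g] that by (auto simp: polys_def fun_eq_iff)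
  qed (use g h h0 \<open>h \<noteq> 0\<close> in \<open>auto simp: polys_def fun_eq_iff\<close>)
  then have "Suc k \<le> card (range (\<lambda>i (x :: complex ^ 'n). x $ i))"
    by (rule alg_indep_on_card[rotated 2]) (use g h in \<open>auto simp: polys_def\<close>)
  also have "\<dots> \<le> CARD('n)" by (rule card_image_le) simp
  finally show False using k by simp
qed

section \<open>Ideals of generically finite varieties\<close>

definition fun_ideal :: "('a \<Rightarrow> complex) set \<Rightarrow> ('a \<Rightarrow> complex) set \<Rightarrow> bool" where
  "fun_ideal R J \<longleftrightarrow> J \<subseteq> R \<and> 0 \<in> J \<and> (\<forall>f\<in>J. \<forall>g\<in>J. f + g \<in> J) \<and> (\<forall>f\<in>R. \<forall>g\<in>J. f * g \<in> J)"

text \<open>After inverting the nonzero elements of \<open>poly_funs Z\<close>, \<open>J\<close>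
  generates a maximal ideal, and the residue field is the function field of a variety generically
  finite over the base. The condition \<open>maximal\<close> says this without fractions:
  \<open>g / h\<close> is an inverse of \<open>u\<close> modulo \<open>J\<close>.\<close>

locale generic_ideal =
  fixes X Z J :: "('a \<Rightarrow> complex) set"
  assumes finite_X: "finite X" and Z_subset: "Z \<subseteq> X"
    and base_domain: "\<And>f g. f \<in> poly_funs Z \<Longrightarrow> g \<in> poly_funs Z \<Longrightarrow> f * g = 0 \<Longrightarrow> f = 0 \<or> g = 0"
    and ideal: "fun_ideal (poly_funs X) J"
    and inter_base: "\<And>f. f \<in> J \<Longrightarrow> f \<in> poly_funs Z \<Longrightarrow> f = 0"
    and maximal: "\<And>u. u \<in> poly_funs X \<Longrightarrow> u \<notin> J \<Longrightarrow>
      \<exists>g\<in>poly_funs X. \<exists>h\<in>poly_funs Z. h \<noteq> 0 \<and> g * u - h \<in> J"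

text \<open>Zorn's lemma. If the maximal \<open>J\<close> misses \<open>u\<close>, the ideal
  generated by \<open>J\<close> and \<open>u\<close> contains a nonzero \<open>h\<close> of the base
  ring, and \<open>h = j + g * u\<close> is the required congruence.\<close>

lemma generic_ideal_exists:
  assumes "finite X" "Z \<subseteq> X"
    and "\<And>f g. f \<in> poly_funs Z \<Longrightarrow> g \<in> poly_funs Z \<Longrightarrow> f * g = 0 \<Longrightarrow> f = 0 \<or> g = 0"
    and I: "fun_ideal (poly_funs X) I" "\<And>f. f \<in> I \<Longrightarrow> f \<in> poly_funs Z \<Longrightarrow> f = 0"
  obtains J where "I \<subseteq> J" "generic_ideal X Z J"
proof -
  let ?R = "poly_funs X" and ?K = "poly_funs Z"
  define \<A> where "\<A> = {J. I \<subseteq> J \<and> fun_ideal ?R J \<and> (\<forall>f\<in>J. f \<in> ?K \<longrightarrow> f = 0)}"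
  have "I \<in> \<A>" using I by (auto simp: \<A>_def)
  moreover have "\<Union>\<C> \<in> \<A>" if ne: "\<C> \<noteq> {}" and ch: "subset.chain \<A> \<C>" for \<C>
  proof -
    have mem: "C \<in> \<A>" if "C \<in> \<C>" for C using ch that by (auto simp: subset.chain_def)
    have cmp: "C \<subseteq> D \<or> D \<subseteq> C" if "C \<in> \<C>" "D \<in> \<C>" for C D
      using ch that by (auto simp: subset_chain_def)
    have "f + g \<in> \<Union>\<C>" if fg: "f \<in> \<Union>\<C>" "g \<in> \<Union>\<C>" for f g
    proof -
      from fg obtain C D where CD: "f \<in> C" "C \<in> \<C>" "g \<in> D" "D \<in> \<C>" by blast
      with cmp obtain E where "E \<in> \<C>" "f \<in> E" "g \<in> E" by blast
      with mem[of E] have "f + g \<in> E" by (simp add: \<A>_def fun_ideal_def)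
      with \<open>E \<in> \<C>\<close> show ?thesis by blast
    qed
    moreover have "f * g \<in> \<Union>\<C>" if "f \<in> ?R" "g \<in> \<Union>\<C>" for f g
      using that mem unfolding \<A>_def fun_ideal_def by blast
    moreover have "\<Union>\<C> \<subseteq> ?R"
      using mem unfolding \<A>_def fun_ideal_def by blast
    moreover have "\<forall>f\<in>\<Union>\<C>. f \<in> ?K \<longrightarrow> f = 0"
    proof (intro ballI impI)
      fix f assume "f \<in> \<Union>\<C>" "f \<in> ?K"
      then show "f = 0" using mem by (auto simp: \<A>_def)
    qed
    moreover obtain C where "C \<in> \<C>" using ne by blast
    moreover from mem[OF this] have "I \<subseteq> C" "0 \<in> C" by (simp_all add: \<A>_def fun_ideal_def)
    then have "I \<subseteq> \<Union>\<C>" "0 \<in> \<Union>\<C>" using \<open>C \<in> \<C>\<close> by blast+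
    ultimately show ?thesis unfolding \<A>_def fun_ideal_def by simp
  qed
  ultimately have "\<exists>M\<in>\<A>. \<forall>Y\<in>\<A>. M \<subseteq> Y \<longrightarrow> Y = M"
    by (intro subset_Zorn_nonempty) auto
  then obtain J where J: "J \<in> \<A>" and Jmax: "\<And>Y. Y \<in> \<A> \<Longrightarrow> J \<subseteq> Y \<Longrightarrow> Y = J" by blast
  have JI: "I \<subseteq> J" and Jid: "fun_ideal ?R J" and JK: "\<And>f. f \<in> J \<Longrightarrow> f \<in> ?K \<Longrightarrow> f = 0"
    using J by (auto simp: \<A>_def)
  have "\<exists>g\<in>?R. \<exists>h\<in>?K. h \<noteq> 0 \<and> g * u - h \<in> J" if u: "u \<in> ?R" "u \<notin> J" for u
  proof -
    define Y where "Y = {j + g * u |j g. j \<in> J \<and> g \<in> ?R}"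
    have uY: "u \<in> Y" unfolding Y_def
      using Jid poly_funs_1[of X] by (intro CollectI exI[of _ 0] exI[of _ 1]) (auto simp: fun_ideal_def)
    have JY: "J \<subseteq> Y"
    proof
      fix j assume "j \<in> J"
      then show "j \<in> Y" unfolding Y_def
        using poly_funs_0[of X] by (intro CollectI exI[of _ j] exI[of _ 0]) auto
    qed
    have "fun_ideal ?R Y" unfolding fun_ideal_def
    proof (intro conjI ballI)
      show "Y \<subseteq> ?R" using Jid u by (auto simp: Y_def fun_ideal_def intro!: poly_funs_closed)
      show "0 \<in> Y" using JY Jid by (auto simp: fun_ideal_def)
    next
      fix f g assume "f \<in> Y" "g \<in> Y"
      then obtain j1 g1 j2 g2 where jg: "f = j1 + g1 * u" "g = j2 + g2 * u" "j1 \<in> J" "j2 \<in> J" "g1 \<in> ?R" "g2 \<in> ?R"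
        unfolding Y_def by blast
      then have "f + g = (j1 + j2) + (g1 + g2) * u" by (simp add: algebra_simps)
      moreover have "j1 + j2 \<in> J" "g1 + g2 \<in> ?R"
        using jg Jid by (auto simp: fun_ideal_def intro: poly_funs_add)
      ultimately show "f + g \<in> Y" unfolding Y_def by blast
    next
      fix f g assume "f \<in> ?R" "g \<in> Y"
      then obtain j1 g1 where jg: "g = j1 + g1 * u" "j1 \<in> J" "g1 \<in> ?R"
        unfolding Y_def by blast
      then have "f * g = f * j1 + (f * g1) * u" by (simp add: algebra_simps)
      moreover have "f * j1 \<in> J" "f * g1 \<in> ?R"
        using jg Jid \<open>f \<in> ?R\<close> by (auto simp: fun_ideal_def intro: poly_funs_mult)
      ultimately show "f * g \<in> Y" unfolding Y_def by blast
    qed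
    moreover have "Y \<notin> \<A>" using Jmax[of Y] JY uY u by blast
    ultimately obtain h where h: "h \<in> Y" "h \<in> ?K" "h \<noteq> 0" using JI JY by (auto simp: \<A>_def)
    then obtain j g where jg: "h = j + g * u" "j \<in> J" "g \<in> ?R" unfolding Y_def by blast
    have "g * u - h = cfun (-1) * j" by (simp add: jg fun_eq_iff)
    then have "g * u - h \<in> J" using Jid jg(2) poly_funs.const[of "-1" X] by (metis fun_ideal_def)
    with h jg show ?thesis by blast
  qed
  then have "generic_ideal X Z J"
    using assms(1-3) Jid JK by unfold_locales
  with JI show ?thesis by (rule that)
qed

context generic_ideal
begin

lemma Z_X: "f \<in> poly_funs Z \<Longrightarrow> f \<in> poly_funs X"
  using poly_funs_mono[OF Z_subset] by blast

lemma J_in: "f \<in> J \<Longrightarrow> f \<in> poly_funs X" and J_0: "0 \<in> J"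
  and J_add: "f \<in> J \<Longrightarrow> g \<in> J \<Longrightarrow> f + g \<in> J"
  and J_mult: "f \<in> poly_funs X \<Longrightarrow> g \<in> J \<Longrightarrow> f * g \<in> J"
  using ideal by (auto simp: fun_ideal_def)

lemma J_uminus: assumes "f \<in> J" shows "- f \<in> J"
proof -
  have "- f = cfun (-1) * f" by (simp add: fun_eq_iff)
  with J_mult[OF poly_funs.const assms] show ?thesis by metis
qed

lemma J_diff: "f \<in> J \<Longrightarrow> g \<in> J \<Longrightarrow> f - g \<in> J"
  using J_add[of f "- g"] J_uminus[of g] by simp

lemma J_sum: "(\<And>i. i \<in> I \<Longrightarrow> f i \<in> J) \<Longrightarrow> (\<Sum>i\<in>I. f i) \<in> J"
  by (induction I rule: infinite_finite_induct) (auto intro: J_0 J_add)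

text \<open>Modulo \<open>J\<close>, \<open>(g1 * g2) * (u * v)\<close> equals
  \<open>h1 * h2\<close>, a nonzero element of the base ring and hence not in
  \<open>J\<close>.\<close>

lemma J_prime:
  assumes u: "u \<in> poly_funs X" and v: "v \<in> poly_funs X" and uv: "u * v \<in> J"
  shows "u \<in> J \<or> v \<in> J"
proof (rule ccontr)
  assume "\<not> (u \<in> J \<or> v \<in> J)"
  then obtain g1 h1 g2 h2 where
    1: "g1 \<in> poly_funs X" "h1 \<in> poly_funs Z" "h1 \<noteq> 0" "g1 * u - h1 \<in> J" and
    2: "g2 \<in> poly_funs X" "h2 \<in> poly_funs Z" "h2 \<noteq> 0" "g2 * v - h2 \<in> J"
    using maximal[OF u] maximal[OF v] by metis
  have "h1 * h2 = (g1 * g2) * (u * v) - (h2 * (g1 * u - h1) + (g1 * u) * (g2 * v - h2))"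
    by (simp add: algebra_simps)
  also have "\<dots> \<in> J"
  proof (intro J_diff J_add)
    show "(g1 * g2) * (u * v) \<in> J" using 1 2 by (intro J_mult[OF _ uv] poly_funs_mult)
    show "h2 * (g1 * u - h1) \<in> J" using 1 2 by (intro J_mult Z_X)
    show "(g1 * u) * (g2 * v - h2) \<in> J" using 1 2 u by (intro J_mult poly_funs_mult)
  qed
  finally have "h1 * h2 = 0" using 1 2 by (intro inter_base) (auto intro: poly_funs_mult)
  with base_domain 1 2 show False by blast
qed

lemma J_one: "1 \<notin> J"
  using inter_base[of 1] poly_funs_1[of Z] by (auto simp: fun_eq_iff)

lemma J_power: assumes "u \<in> poly_funs X" "u ^ k \<in> J" shows "u \<in> J"
  using assms(2)
proof (induction k)
  case 0 then show ?case using J_one by (metis power_0)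
next
  case (Suc k)
  then have "u * u ^ k \<in> J" by (metis power_Suc)
  with J_prime[OF assms(1) poly_funs_power[OF assms(1)]] Suc show ?case by blast
qed

text \<open>Zariski's lemma, by the uncountability of the field: were no \<open>u - c\<close> in \<open>J\<close>, maximality would
  give an inverse \<open>g c\<close> of \<open>u - c\<close> up to the base ring for each complex \<open>c\<close>; a linear relation
  between finitely many \<open>g c\<close> becomes, after clearing denominators, an algebraic equation for \<open>u\<close>.\<close>

lemma algebraic:
  assumes u: "u \<in> poly_funs X"
  obtains d a where "\<And>k. a k \<in> poly_funs Z" "\<exists>k\<le>d. a k \<noteq> 0" "(\<Sum>k\<le>d. a k * u ^ k) \<in> J"
proof (cases "\<exists>c. u - cfun c \<in> J")
  case True
  then obtain c where c: "u - cfun c \<in> J" by blast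
  show ?thesis
  proof (rule that[of "\<lambda>k. if k = 0 then cfun (- c) else 1" 1])
    have "(\<Sum>k\<le>1::nat. (if k = 0 then cfun (- c) else 1) * u ^ k) = u - cfun c"
      by (simp add: fun_eq_iff)
    with c show "(\<Sum>k\<le>1. (if k = 0 then cfun (- c) else 1) * u ^ k) \<in> J" by metis
    show "\<exists>k\<le>1::nat. (if k = 0 then cfun (- c) else 1 :: 'a \<Rightarrow> complex) \<noteq> 0"
      by (rule exI[of _ 1]) (simp add: fun_eq_iff)
    show "(if k = 0 then cfun (- c) else 1) \<in> poly_funs Z" for k :: nat
      using poly_funs_1[of Z] poly_funs.const[of "- c" Z] by (cases "k = 0") (simp_all only: if_True if_False simp_thms)
  qed
next
  case False
  have "\<exists>g h. g \<in> poly_funs X \<and> h \<in> poly_funs Z \<and> h \<noteq> 0 \<and> g * (u - cfun c) - h \<in> J" for c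
  proof -
    have "u - cfun c \<notin> J" using False by simp
    from maximal[OF poly_funs_diff[OF u poly_funs.const] this]
    obtain g h where "g \<in> poly_funs X" "h \<in> poly_funs Z" "h \<noteq> 0" "g * (u - cfun c) - h \<in> J" by blast
    then show ?thesis by (intro exI[of _ g] exI[of _ h] conjI)
  qed
  then obtain g h where gh: "\<And>c. g c \<in> poly_funs X" "\<And>c. h c \<in> poly_funs Z" "\<And>c. h c \<noteq> 0"
    "\<And>c. g c * (u - cfun c) - h c \<in> J" by metis
  obtain I b where I: "finite I" "I \<subseteq> UNIV" "\<exists>c\<in>I. b c \<noteq> 0" and b: "(\<Sum>c\<in>I. cfun (b c) * g c) = 0"
    by (rule poly_funs_uncountable_relation[OF finite_X uncountable_UNIV_complex gh(1)])
  \<comment> \<open>Multiplying the relation \<open>b\<close> by the product of all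
    \<open>u - k\<close> and replacing each \<open>g c * (u - c)\<close> by \<open>h c\<close>
    leaves the sum of the \<open>b c * h c * p c\<close>, evaluated at \<open>u\<close>;
    \<open>a\<close> lists the coefficients of that polynomial.\<close>
  define p where "p = (\<lambda>c. \<Prod>k\<in>I - {c}. [:- k, 1 :: complex:])"
  define a where "a = (\<lambda>l. \<Sum>c\<in>I. cfun (b c * coeff (p c) l) * h c)"
  define U where "U = (\<lambda>c. \<Prod>k\<in>I - {c}. (u - cfun k))"
  have deg: "degree (p c) \<le> card I" if "c \<in> I" for c
  proof -
    have "degree (p c) \<le> sum (degree \<circ> (\<lambda>k. [:- k, 1 :: complex:])) (I - {c})"
      unfolding p_def by (rule degree_prod_sum_le) (use I in auto)
    also have "\<dots> \<le> card I" by (simp add: I card_Diff1_le)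
    finally show ?thesis .
  qed
  have evp: "poly (p c) t = (\<Sum>l\<le>card I. coeff (p c) l * t ^ l)" if "c \<in> I" for c t
    unfolding poly_altdef by (rule sum.mono_neutral_left) (use deg[OF that] in \<open>auto simp: le_degree\<close>)
  have U: "U c v = poly (p c) (u v)" for c v
    by (simp add: U_def p_def poly_prod fun_ring_apply)
  have eva: "(\<Sum>l\<le>card I. a l v * t ^ l) = (\<Sum>c\<in>I. b c * h c v * poly (p c) t)" for v t
  proof -
    have "(\<Sum>l\<le>card I. a l v * t ^ l) = (\<Sum>l\<le>card I. \<Sum>c\<in>I. b c * h c v * (coeff (p c) l * t ^ l))"
      unfolding a_def fun_ring_apply times_fun_apply sum_distrib_right by (simp add: mult_ac)
    also have "\<dots> = (\<Sum>c\<in>I. \<Sum>l\<le>card I. b c * h c v * (coeff (p c) l * t ^ l))"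
      by (rule sum.swap)
    also have "\<dots> = (\<Sum>c\<in>I. b c * h c v * poly (p c) t)"
      by (rule sum.cong) (auto simp: evp sum_distrib_left)
    finally show ?thesis .
  qed
  show ?thesis
  proof (rule that[of a "card I"])
    show "a k \<in> poly_funs Z" for k unfolding a_def using gh by (intro poly_funs_closed) auto
    show "\<exists>k\<le>card I. a k \<noteq> 0"
    proof (rule ccontr)
      assume "\<not> (\<exists>k\<le>card I. a k \<noteq> 0)"
      then have 0: "(\<Sum>c\<in>I. b c * h c v * poly (p c) t) = 0" for v t
        unfolding eva[symmetric] by simp
      obtain c where c: "c \<in> I" "b c \<noteq> 0" using I by blast
      have "h c v = 0" for v
      proof -
        \<comment> \<open>At \<open>t = c\<close> every \<open>p k\<close> with \<open>k\<close>
          other than \<open>c\<close> vanishes, as in Lagrange interpolation, so a single term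
          survives.\<close>
        have "(\<Sum>k\<in>I. b k * h k v * poly (p k) c) = (\<Sum>k\<in>{c}. b k * h k v * poly (p k) c)"
          by (rule sum.mono_neutral_right) (use I c in \<open>auto simp: p_def poly_prod prod_zero_iff\<close>)
        with 0[of v c] have "b c * h c v * poly (p c) c = 0" by simp
        moreover have "poly (p c) c \<noteq> 0" using I by (auto simp: p_def poly_prod prod_zero_iff)
        ultimately show ?thesis using c by simp
      qed
      with gh(3)[of c] show False by (auto simp: fun_eq_iff)
    qed
    have "(\<Sum>l\<le>card I. a l * u ^ l) = - (\<Sum>c\<in>I. (cfun (b c) * U c) * (g c * (u - cfun c) - h c))"
    proof
      fix v
      have "(\<Sum>l\<le>card I. a l * u ^ l) v = (\<Sum>c\<in>I. b c * h c v * U c v)"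
        using eva[of v "u v"] by (simp add: fun_ring_apply U)
      also have "\<dots> = (\<Sum>c\<in>I. b c * g c v) * (\<Prod>k\<in>I. u v - k) -
          (\<Sum>c\<in>I. b c * U c v * (g c v * (u v - c) - h c v))"
      proof -
        have "(\<Prod>k\<in>I. u v - k) = (u v - c) * U c v" if "c \<in> I" for c
          using I that by (simp add: U_def fun_ring_apply prod.remove)
        then have "(\<Sum>c\<in>I. b c * g c v) * (\<Prod>k\<in>I. u v - k) = (\<Sum>c\<in>I. b c * g c v * ((u v - c) * U c v))"
          by (simp add: sum_distrib_right)
        then show ?thesis by (simp add: algebra_simps flip: sum_subtractf sum.distrib)
      qed
      also have "(\<Sum>c\<in>I. b c * g c v) = 0" using fun_cong[OF b, of v] by (simp add: fun_ring_apply)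
      finally show "(\<Sum>l\<le>card I. a l * u ^ l) v = (- (\<Sum>c\<in>I. (cfun (b c) * U c) * (g c * (u - cfun c) - h c))) v"
        by (simp add: fun_ring_apply)
    qed
    also have "\<dots> \<in> J"
    proof (intro J_uminus J_sum J_mult poly_funs_mult poly_funs.const gh)
      show "U c \<in> poly_funs X" for c unfolding U_def using u by (intro poly_funs_closed)
    qed
    finally show "(\<Sum>l\<le>card I. a l * u ^ l) \<in> J" .
  qed
qed

text \<open>The cofactor given by \<open>maximal\<close> lies somewhere in
  \<open>poly_funs X\<close>; this one stays in the subring \<open>poly_funs T\<close> that contains
  \<open>u\<close>. It is read off an algebraic equation of \<open>u\<close>: once a power of
  \<open>u\<close> is cancelled, which primality allows, the constant term is a multiple of
  \<open>u\<close> modulo \<open>J\<close>.\<close>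

lemma base_divides:
  assumes "Z \<subseteq> T" "T \<subseteq> X" and u: "u \<in> poly_funs T" "u \<notin> J"
  obtains v h where "v \<in> poly_funs T" "h \<in> poly_funs Z" "h \<noteq> 0" "u * v - h \<in> J"
proof -
  have uX: "u \<in> poly_funs X" using u poly_funs_mono[OF assms(2)] by blast
  have ZT: "poly_funs Z \<subseteq> poly_funs T" by (rule poly_funs_mono[OF assms(1)])
  obtain d a where a: "\<And>k. a k \<in> poly_funs Z" "\<exists>k\<le>d. a k \<noteq> 0" "(\<Sum>k\<le>d. a k * u ^ k) \<in> J"
    using algebraic[OF uX] by metis
  \<comment> \<open>The lowest nonzero coefficient becomes the constant term when
    \<open>u ^ r\<close> is cancelled.\<close>
  define r where "r = (LEAST k. k \<le> d \<and> a k \<noteq> 0)"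
  have r: "r \<le> d" "a r \<noteq> 0" using LeastI_ex[OF a(2)] by (auto simp: r_def)
  have less: "a k = 0" if "k < r" for k
    using not_less_Least[of k "\<lambda>k. k \<le> d \<and> a k \<noteq> 0"] that r(1) by (auto simp: r_def)
  define v where "v = (\<Sum>k\<in>{r<..d}. a k * u ^ (k - r - 1))"
  have "(\<Sum>k\<le>d. a k * u ^ k) = u ^ r * (a r + u * v)"
  proof
    fix x
    have "(\<Sum>k\<le>d. a k * u ^ k) x = (\<Sum>k\<in>insert r {r<..d}. a k x * u x ^ k)"
      unfolding fun_ring_apply times_fun_apply
      by (rule sum.mono_neutral_right) (use r less in \<open>auto simp: not_le not_less\<close>)
    also have "\<dots> = a r x * u x ^ r + (\<Sum>k\<in>{r<..d}. a k x * u x ^ k)" by simp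
    also have "(\<Sum>k\<in>{r<..d}. a k x * u x ^ k) = (\<Sum>k\<in>{r<..d}. u x ^ r * (u x * (a k x * u x ^ (k - r - 1))))"
    proof (rule sum.cong)
      fix k assume "k \<in> {r<..d}"
      then have "k = r + Suc (k - r - 1)" by auto
      then have "u x ^ k = u x ^ r * (u x * u x ^ (k - r - 1))" by (metis power_add power_Suc)
      then show "a k x * u x ^ k = u x ^ r * (u x * (a k x * u x ^ (k - r - 1)))" by simp
    qed simp
    finally show "(\<Sum>k\<le>d. a k * u ^ k) x = (u ^ r * (a r + u * v)) x"
      by (simp add: v_def fun_ring_apply sum_distrib_left algebra_simps)
  qed
  with a(3) have "u ^ r * (a r + u * v) \<in> J" by metis
  moreover have vT: "v \<in> poly_funs T" unfolding v_def using a(1) ZT u by (intro poly_funs_closed) auto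
  moreover have "a r + u * v \<in> poly_funs X"
    using vT poly_funs_mono[OF assms(2)] uX a(1) Z_X by (intro poly_funs_closed) auto
  ultimately have 1: "a r + u * v \<in> J"
    using J_prime[OF poly_funs_power[OF uX]] J_power[OF uX] u(2) by blast
  have "u * v - (- a r) = a r + u * v" by simp
  with 1 have "u * v - (- a r) \<in> J" by metis
  moreover have "- a r \<noteq> 0" using r(2) by (metis neg_equal_0_iff_equal)
  ultimately show ?thesis using that[OF vT poly_funs_uminus[OF a(1)]] by blast
qed

end

subsection \<open>Minimal polynomials of coordinates\<close>

text \<open>Specialising the coefficients at a point \<open>v\<close> allows a polynomial in one
  coordinate to be evaluated at numbers \<open>t\<close> other than the value of that coordinate at
  \<open>v\<close>.\<close>

definition ev_poly :: "'a \<Rightarrow> ('a \<Rightarrow> complex) poly \<Rightarrow> complex poly" where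
  "ev_poly v P = map_poly (\<lambda>c. c v) P"

lemma coeff_ev_poly: "coeff (ev_poly v P) k = coeff P k v"
  by (simp add: ev_poly_def coeff_map_poly)

lemma ev_poly_pCons: "ev_poly v (pCons c P) = pCons (c v) (ev_poly v P)"
  by (rule poly_eqI) (simp add: coeff_ev_poly coeff_pCons split: nat.split)

lemma poly_ev_poly: "poly P x v = poly (ev_poly v P) (x v)"
proof (induction P)
  case 0 show ?case by (simp add: ev_poly_def)
next
  case (pCons c P) then show ?case by (simp add: ev_poly_pCons)
qed

lemma ev_poly_diff: "ev_poly v (P - Q) = ev_poly v P - ev_poly v Q"
  by (rule poly_eqI) (simp add: coeff_ev_poly)

lemma ev_poly_smult: "ev_poly v (smult c P) = smult (c v) (ev_poly v P)"
  by (rule poly_eqI) (simp add: coeff_ev_poly)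

lemma ev_poly_mult: "ev_poly v (P * Q) = ev_poly v P * ev_poly v Q"
  by (rule poly_eqI) (simp add: coeff_ev_poly coeff_mult sum_fun_apply)

lemma ev_poly_monom: "ev_poly v (monom c n) = monom (c v) n"
  by (rule poly_eqI) (simp add: coeff_ev_poly)

definition polys_over :: "('a \<Rightarrow> complex) set \<Rightarrow> ('a \<Rightarrow> complex) poly set" where
  "polys_over T = {P. \<forall>k. coeff P k \<in> poly_funs T}"

lemma polys_over_intros:
  "P \<in> polys_over T \<Longrightarrow> Q \<in> polys_over T \<Longrightarrow> P + Q \<in> polys_over T"
  "P \<in> polys_over T \<Longrightarrow> Q \<in> polys_over T \<Longrightarrow> P - Q \<in> polys_over T"
  "P \<in> polys_over T \<Longrightarrow> Q \<in> polys_over T \<Longrightarrow> P * Q \<in> polys_over T"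
  "c \<in> poly_funs T \<Longrightarrow> P \<in> polys_over T \<Longrightarrow> smult c P \<in> polys_over T"
  "c \<in> poly_funs T \<Longrightarrow> monom c n \<in> polys_over T"
  unfolding polys_over_def
  by (simp_all only: mem_Collect_eq coeff_add coeff_diff coeff_mult coeff_smult coeff_monom)
     (auto intro!: poly_funs_closed split: if_splits)

lemma poly_funs_insert_poly:
  assumes "f \<in> poly_funs (insert x T)"
  shows "\<exists>P\<in>polys_over T. f = poly P x"
  using assms
proof induction
  case (const c)
  show ?case
    by (rule bexI[of _ "monom (cfun c) 0"]) (auto simp: poly_monom intro: polys_over_intros poly_funs.const)
next
  case (coord f)
  show ?case
  proof (cases "f = x")
    case True
    then show ?thesis
      by (intro bexI[of _ "monom 1 1"]) (auto simp: poly_monom intro!: polys_over_intros poly_funs_1)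
  next
    case False
    with coord show ?thesis
      by (intro bexI[of _ "monom f 0"]) (auto simp: poly_monom intro!: polys_over_intros poly_funs.coord)
  qed
next
  case (add f g)
  then obtain P Q where "P \<in> polys_over T" "Q \<in> polys_over T" "f = poly P x" "g = poly Q x" by blast
  then show ?case
    by (intro bexI[of _ "P + Q"] polys_over_intros) (auto simp: fun_eq_iff)
next
  case (mult f g)
  then obtain P Q where "P \<in> polys_over T" "Q \<in> polys_over T" "f = poly P x" "g = poly Q x" by blast
  then show ?case
    by (intro bexI[of _ "P * Q"] polys_over_intros) (auto simp: fun_eq_iff)
qed

lemma poly_in_poly_funs:
  assumes "P \<in> polys_over T" "x \<in> poly_funs S" "poly_funs T \<subseteq> poly_funs S"
  shows "poly P x \<in> poly_funs S"
  unfolding poly_altdef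
  using assms by (intro poly_funs_sum poly_funs_mult poly_funs_power) (auto simp: polys_over_def)

context generic_ideal
begin

text \<open>A minimal polynomial over \<open>poly_funs T\<close> modulo \<open>J\<close>, free of
  fractions: instead of being monic, it has a leading coefficient outside \<open>J\<close>, and
  \<open>D\<close> is a formal degree. By the last clause an annihilating polynomial of smaller
  formal degree is zero modulo \<open>J\<close>, as top coefficients in \<open>J\<close> can be
  stripped one after another.\<close>

definition min_poly :: "('a \<Rightarrow> complex) set \<Rightarrow> ('a \<Rightarrow> complex) \<Rightarrow> nat \<Rightarrow> ('a \<Rightarrow> complex) poly \<Rightarrow> bool" where
  "min_poly T x D P \<longleftrightarrow> P \<in> polys_over T \<and> D \<ge> 1 \<and> (\<forall>k>D. coeff P k = 0) \<and> coeff P D \<notin> J \<and> poly P x \<in> J \<and>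
     (\<forall>Q n. Q \<in> polys_over T \<and> (\<forall>k>n. coeff Q k = 0) \<and> poly Q x \<in> J \<and> n < D \<longrightarrow> coeff Q n \<in> J)"

lemma min_poly_exists:
  assumes T: "Z \<subseteq> T" and x: "x \<in> X"
  obtains D P where "min_poly T x D P"
proof -
  define cand where "cand = (\<lambda>D. \<exists>P. P \<in> polys_over T \<and> (\<forall>k>D. coeff P k = 0) \<and> coeff P D \<notin> J \<and> poly P x \<in> J)"
  obtain d a where a: "\<And>k. a k \<in> poly_funs Z" "\<exists>k\<le>d. a k \<noteq> 0" "(\<Sum>k\<le>d. a k * x ^ k) \<in> J"
    using algebraic[OF poly_funs.coord[OF x]] by metis
  \<comment> \<open>The highest nonzero coefficient of the equation; it lies in the base ring, so it
    is not in \<open>J\<close> and can lead a candidate.\<close>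
  define r where "r = Max {k. k \<le> d \<and> a k \<noteq> 0}"
  have fin: "finite {k. k \<le> d \<and> a k \<noteq> 0}" by simp
  have r: "r \<le> d" "a r \<noteq> 0" using Max_in[OF fin] a(2) by (auto simp: r_def)
  have r0: "a k = 0" if "k \<le> d" "k > r" for k
    using Max_ge[OF fin, of k] that unfolding r_def by (metis (mono_tags) mem_Collect_eq not_le)
  define P where "P = (\<Sum>k\<le>d. monom (a k) k)"
  have cP: "coeff P k = (if k \<le> d then a k else 0)" for k
    by (simp add: P_def coeff_sum)
  have "poly P x = (\<Sum>k\<le>d. a k * x ^ k)" by (simp add: P_def poly_sum poly_monom)
  with a(3) have "poly P x \<in> J" by metis
  moreover have "coeff P r \<notin> J" using inter_base[OF _ a(1), of r] r by (auto simp: cP)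
  moreover have "\<forall>k>r. coeff P k = 0" by (simp add: cP r0)
  moreover have "P \<in> polys_over T"
    unfolding polys_over_def
  proof (intro CollectI allI)
    show "coeff P k \<in> poly_funs T" for k
      using a(1)[of k] poly_funs_mono[OF T] poly_funs_0[of T] unfolding cP by (cases "k \<le> d") auto
  qed
  ultimately have "cand r" unfolding cand_def by blast
  define D where "D = (LEAST D. cand D)"
  have "cand D" using \<open>cand r\<close> unfolding D_def by (rule LeastI)
  then obtain P where P: "P \<in> polys_over T" "\<forall>k>D. coeff P k = 0" "coeff P D \<notin> J" "poly P x \<in> J"
    unfolding cand_def by blast
  have min: "coeff Q n \<in> J" if "Q \<in> polys_over T" "\<forall>k>n. coeff Q k = 0" "poly Q x \<in> J" "n < D" for Q n
  proof (rule ccontr)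
    assume "coeff Q n \<notin> J"
    with that have "cand n" unfolding cand_def by (intro exI[of _ Q] conjI)
    with not_less_Least[of n cand] \<open>n < D\<close> show False by (simp add: D_def)
  qed
  have "D \<noteq> 0"
  proof
    assume "D = 0"
    then have "P = monom (coeff P 0) 0" using P(2) by (intro poly_eqI) auto
    then have "poly P x = coeff P 0" by (metis poly_monom mult.right_neutral power_0)
    with P \<open>D = 0\<close> show False by metis
  qed
  with P min have "min_poly T x D P" unfolding min_poly_def by (metis One_nat_def Suc_leI neq0_conv)
  then show ?thesis by (rule that)
qed

text \<open>By pseudo-division of \<open>Q\<close> by the minimal polynomial.\<close>

lemma min_poly_root:
  assumes P: "min_poly T x D P"
    and v: "\<And>g. g \<in> J \<Longrightarrow> g \<in> poly_funs T \<Longrightarrow> g v = 0"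
    and lead: "coeff P D v \<noteq> 0" and root: "poly (ev_poly v P) t = 0"
    and TX: "T \<subseteq> X" "x \<in> X"
    and Q: "Q \<in> polys_over T" "poly Q x \<in> J"
  shows "poly (ev_poly v Q) t = 0"
proof -
  have P': "P \<in> polys_over T" "\<forall>k>D. coeff P k = 0" "poly P x \<in> J"
    and min: "\<And>Q n. Q \<in> polys_over T \<Longrightarrow> \<forall>k>n. coeff Q k = 0 \<Longrightarrow> poly Q x \<in> J \<Longrightarrow> n < D \<Longrightarrow> coeff Q n \<in> J"
    using P by (simp_all add: min_poly_def)
  have xX: "x \<in> poly_funs X" by (rule poly_funs.coord[OF TX(2)])
  have TX': "f \<in> poly_funs X" if "f \<in> poly_funs T" for f using that poly_funs_mono[OF TX(1)] by blast
  have "poly (ev_poly v Q) t = 0" if "\<forall>k\<ge>n. coeff Q k = 0" "Q \<in> polys_over T" "poly Q x \<in> J" for n Q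
    using that
  proof (induction n arbitrary: Q)
    case 0
    then have "Q = 0" by (intro poly_eqI) (metis coeff_0 le0)
    then show ?case by (simp add: ev_poly_def)
  next
    case (Suc n)
    define c where "c = coeff Q n"
    have c: "c \<in> poly_funs T" using Suc.prems by (simp add: c_def polys_over_def)
    show ?case
    proof (cases "n < D")
      case True
      have cJ: "c \<in> J" unfolding c_def using Suc.prems True by (intro min) auto
      define Q' where "Q' = Q - monom c n"
      have "poly Q' x = poly Q x - x ^ n * c" by (simp add: Q'_def poly_monom mult.commute)
      also have "\<dots> \<in> J" using Suc.prems by (intro J_diff J_mult poly_funs_power xX cJ)
      finally have "poly Q' x \<in> J" .
      moreover have "\<forall>k\<ge>n. coeff Q' k = 0"
      proof (intro allI impI)
        fix k assume "n \<le> k"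
        then consider "k = n" | "k \<ge> Suc n" by linarith
        then show "coeff Q' k = 0" using Suc.prems by cases (auto simp: Q'_def c_def)
      qed
      moreover have "Q' \<in> polys_over T" unfolding Q'_def using Suc.prems c by (intro polys_over_intros)
      ultimately have "poly (ev_poly v Q') t = 0" using Suc.IH by blast
      then show ?thesis using v[OF cJ c] by (simp add: Q'_def ev_poly_diff ev_poly_monom)
    next
      case False
      \<comment> \<open>One step of pseudo-division; the factor \<open>coeff P D\<close> takes the
        place of a division and is nonzero at \<open>v\<close>.\<close>
      define Q' where "Q' = smult (coeff P D) Q - monom c (n - D) * P"
      have PD: "coeff P D \<in> poly_funs T" using P' by (simp add: polys_over_def)
      have "poly Q' x = coeff P D * poly Q x - (c * x ^ (n - D)) * poly P x"
        by (simp add: Q'_def poly_monom)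
      also have "\<dots> \<in> J" using Suc.prems P' c PD
        by (intro J_diff J_mult poly_funs_mult poly_funs_power xX TX')
      finally have "poly Q' x \<in> J" .
      moreover have "\<forall>k\<ge>n. coeff Q' k = 0"
      proof (intro allI impI)
        fix k assume "n \<le> k"
        have Q'k: "coeff Q' k = coeff P D * coeff Q k - c * coeff P (k - (n - D))"
          using \<open>n \<le> k\<close> by (simp add: Q'_def coeff_monom_mult)
        from \<open>n \<le> k\<close> consider "k = n" | "k \<ge> Suc n" by linarith
        then show "coeff Q' k = 0"
        proof cases
          case 1
          then have "k - (n - D) = D" using False by simp
          then show ?thesis using Q'k 1 by (simp add: c_def mult.commute)
        next
          case 2
          then have "coeff Q k = 0" "coeff P (k - (n - D)) = 0" using Suc.prems P'(2) False by auto
          then show ?thesis unfolding Q'k by simp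
        qed
      qed
      moreover have "Q' \<in> polys_over T" unfolding Q'_def using Suc.prems P' PD c by (intro polys_over_intros)
      ultimately have "poly (ev_poly v Q') t = 0" using Suc.IH by blast
      then show ?thesis using lead root by (simp add: Q'_def ev_poly_diff ev_poly_smult ev_poly_mult)
    qed
  qed
  moreover have "\<forall>k\<ge>Suc (degree Q). coeff Q k = 0" by (simp add: coeff_eq_0)
  ultimately show ?thesis using Q by blast
qed

text \<open>Characteristic zero makes the minimal polynomial separable, and the derivative at the root
  divides a nonzero element of the base ring.\<close>

lemma min_poly_separable:
  assumes P: "min_poly T x D P" and T: "Z \<subseteq> T" "T \<subseteq> X" "x \<in> X"
  obtains h where "h \<in> poly_funs Z" "h \<noteq> 0"
    "\<forall>v. (\<forall>g\<in>J. g \<in> poly_funs T \<longrightarrow> g v = 0) \<longrightarrow> h v \<noteq> 0 \<longrightarrow> coeff P D v \<noteq> 0 \<and>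
       (\<forall>t. poly (ev_poly v P) t = 0 \<longrightarrow> poly (pderiv (ev_poly v P)) t \<noteq> 0)"
proof -
  have P': "P \<in> polys_over T" "D \<ge> 1" "\<forall>k>D. coeff P k = 0" "poly P x \<in> J" "coeff P D \<notin> J"
    and min: "\<And>Q n. Q \<in> polys_over T \<Longrightarrow> \<forall>k>n. coeff Q k = 0 \<Longrightarrow> poly Q x \<in> J \<Longrightarrow> n < D \<Longrightarrow> coeff Q n \<in> J"
    using P by (simp_all add: min_poly_def)
  have TI: "poly_funs T \<subseteq> poly_funs (insert x T)" by (intro poly_funs_mono) auto
  have TX: "poly_funs T \<subseteq> poly_funs X" by (intro poly_funs_mono T)
  have ZT: "poly_funs Z \<subseteq> poly_funs T" by (intro poly_funs_mono T)
  have xI: "x \<in> poly_funs (insert x T)" by (intro poly_funs.coord) auto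
  have PD: "coeff P D \<in> poly_funs T" using P' by (simp add: polys_over_def)
  \<comment> \<open>The leading coefficient divides \<open>h1\<close> modulo \<open>J\<close>, so it
    is nonzero wherever \<open>h1\<close> is.\<close>
  obtain w1 h1 where 1: "w1 \<in> poly_funs T" "h1 \<in> poly_funs Z" "h1 \<noteq> 0" "coeff P D * w1 - h1 \<in> J"
    using base_divides[OF T(1,2) PD P'(5)] by metis
  \<comment> \<open>The derivative of \<open>P\<close>, written out by coefficients.\<close>
  define P1 where "P1 = (\<Sum>k<D. monom (cfun (of_nat (Suc k)) * coeff P (Suc k)) k)"
  have cP1: "coeff P1 k = (if k < D then cfun (of_nat (Suc k)) * coeff P (Suc k) else 0)" for k
    by (simp add: P1_def coeff_sum)
  have P1T: "P1 \<in> polys_over T"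
    unfolding polys_over_def
  proof (intro CollectI allI)
    fix k
    have "cfun (of_nat (Suc k)) * coeff P (Suc k) \<in> poly_funs T"
      using P' by (intro poly_funs_mult poly_funs.const) (simp add: polys_over_def)
    then show "coeff P1 k \<in> poly_funs T" using poly_funs_0[of T] unfolding cP1 by presburger
  qed
  have evP1: "ev_poly v P1 = pderiv (ev_poly v P)" for v
    by (rule poly_eqI) (use P' in \<open>auto simp: coeff_ev_poly cP1 coeff_pderiv\<close>)
  \<comment> \<open>Otherwise its top coefficient, which is \<open>D\<close> times that of
    \<open>P\<close>, would lie in \<open>J\<close> by minimality, and \<open>D\<close> is
    invertible.\<close>
  have "poly P1 x \<notin> J"
  proof
    assume "poly P1 x \<in> J"
    then have "coeff P1 (D - 1) \<in> J" using P1T P' by (intro min) (auto simp: cP1)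
    moreover have "coeff P1 (D - 1) = cfun (of_nat D) * coeff P D" using P'(2) by (simp add: cP1)
    ultimately have "cfun (of_nat D) * coeff P D \<in> J" by metis
    then have "cfun (1 / of_nat D) * (cfun (of_nat D) * coeff P D) \<in> J" by (rule J_mult[OF poly_funs.const])
    moreover have "cfun (1 / of_nat D) * (cfun (of_nat D) * coeff P D) = coeff P D"
      using P'(2) by (simp add: fun_eq_iff)
    ultimately show False using P'(5) by metis
  qed
  moreover have P1x: "poly P1 x \<in> poly_funs (insert x T)" by (rule poly_in_poly_funs[OF P1T xI TI])
  ultimately obtain w2 h2 where 2: "w2 \<in> poly_funs (insert x T)" "h2 \<in> poly_funs Z" "h2 \<noteq> 0"
    "poly P1 x * w2 - h2 \<in> J"
    using base_divides[of "insert x T" "poly P1 x"] T by (metis insert_subset subset_insertI2)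
  obtain W where W: "W \<in> polys_over T" "w2 = poly W x" using poly_funs_insert_poly[OF 2(1)] by blast
  \<comment> \<open>The congruence between \<open>poly P1 x * w2\<close> and \<open>h2\<close> as a
    polynomial that annihilates \<open>x\<close>. It therefore holds at every root \<open>t\<close>
    of the specialised \<open>P\<close>, where it shows that the derivative divides
    \<open>h2 v\<close>.\<close>
  define Q where "Q = P1 * W - monom h2 0"
  have Q: "Q \<in> polys_over T"
    unfolding Q_def using P1T W 2 ZT by (intro polys_over_intros) auto
  have "poly Q x = poly P1 x * w2 - h2" by (simp add: Q_def W poly_monom)
  with 2 have QJ: "poly Q x \<in> J" by metis
  show ?thesis
  proof (rule that[of "h1 * h2"])
    show "h1 * h2 \<in> poly_funs Z" using 1 2 by (intro poly_funs_mult)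
    show "h1 * h2 \<noteq> 0" using base_domain 1 2 by blast
    show "\<forall>v. (\<forall>g\<in>J. g \<in> poly_funs T \<longrightarrow> g v = 0) \<longrightarrow> (h1 * h2) v \<noteq> 0 \<longrightarrow> coeff P D v \<noteq> 0 \<and>
       (\<forall>t. poly (ev_poly v P) t = 0 \<longrightarrow> poly (pderiv (ev_poly v P)) t \<noteq> 0)"
    proof (intro allI impI)
      fix v assume "\<forall>g\<in>J. g \<in> poly_funs T \<longrightarrow> g v = 0" and h: "(h1 * h2) v \<noteq> 0"
      then have v: "\<And>g. g \<in> J \<Longrightarrow> g \<in> poly_funs T \<Longrightarrow> g v = 0" by blast
      have "(coeff P D * w1 - h1) v = 0"
      proof (rule v[OF 1(4)])
        show "coeff P D * w1 - h1 \<in> poly_funs T"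
          using 1(1,2) PD ZT by (intro poly_funs_diff poly_funs_mult) auto
      qed
      with h have lead: "coeff P D v \<noteq> 0" by auto
      have "poly (pderiv (ev_poly v P)) t \<noteq> 0" if root: "poly (ev_poly v P) t = 0" for t
      proof -
        have "poly (ev_poly v Q) t = 0" by (rule min_poly_root[where v = v, OF P _ lead root T(2,3) Q QJ]) (rule v)
        then have "poly (pderiv (ev_poly v P)) t * poly (ev_poly v W) t = h2 v"
          by (simp add: Q_def ev_poly_diff ev_poly_mult ev_poly_monom evP1 poly_monom)
        with h show ?thesis by auto
      qed
      with lead show "coeff P D v \<noteq> 0 \<and> (\<forall>t. poly (ev_poly v P) t = 0 \<longrightarrow> poly (pderiv (ev_poly v P)) t \<noteq> 0)"
        by blast
    qed
  qed
qed

end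

section \<open>Continuous roots\<close>

lemma finite_separated:
  fixes F :: "'a::metric_space set"
  assumes "finite F"
  obtains d where "d > 0" "\<And>a b. a \<in> F \<Longrightarrow> b \<in> F \<Longrightarrow> a \<noteq> b \<Longrightarrow> d \<le> dist a b"
proof -
  let ?S = "insert 1 ((\<lambda>(a, b). dist a b) ` {(a, b). a \<in> F \<and> b \<in> F \<and> a \<noteq> b})"
  have "finite {(a, b). a \<in> F \<and> b \<in> F \<and> a \<noteq> b}"
    by (rule finite_subset[of _ "F \<times> F"]) (use assms in auto)
  then have fin: "finite ?S" by simp
  show ?thesis
  proof (rule that[of "Min ?S"])
    show "Min ?S > 0" using fin by (subst Min_gr_iff) auto
    show "Min ?S \<le> dist a b" if "a \<in> F" "b \<in> F" "a \<noteq> b" for a b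
      by (rule Min_le[OF fin]) (use that in auto)
  qed
qed

lemma simple_roots_factor:
  fixes p :: "complex poly"
  assumes "p \<noteq> 0" "\<And>t. poly p t = 0 \<Longrightarrow> poly (pderiv p) t \<noteq> 0"
  shows "finite {t. poly p t = 0}" "card {t. poly p t = 0} = degree p"
    "poly p x = lead_coeff p * (\<Prod>t | poly p t = 0. x - t)"
proof -
  have "rsquarefree p" using assms by (auto simp: rsquarefree_roots)
  from complex_poly_decompose_rsquarefree[OF this]
  have eq: "p = smult (lead_coeff p) (\<Prod>z | poly p z = 0. [:- z, 1:])" by simp
  show "finite {t. poly p t = 0}" by (rule poly_roots_finite[OF assms(1)])
  show "poly p x = lead_coeff p * (\<Prod>t | poly p t = 0. x - t)"
    by (subst eq) (simp add: poly_prod)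
  have "degree p = degree (\<Prod>z | poly p z = 0. [:- z, 1:])"
    by (subst eq) (simp add: assms(1))
  also have "\<dots> = card {t. poly p t = 0}"
    by (subst degree_prod_eq_sum_degree) auto
  finally show "card {t. poly p t = 0} = degree p" by simp
qed

text \<open>If no root of \<open>p z\<close> were within \<open>\<eta>\<close> of a root
  \<open>r\<close> of \<open>p z0\<close>, the factorisation would make the modulus of
  \<open>poly (p z) r\<close> at least \<open>\<eta> ^ D\<close> times that of the leading
  coefficient, which fails for \<open>z\<close> near \<open>z0\<close>. So each of \<open>D\<close>
  disjoint discs contains a root, and exactly one, as there are only \<open>D\<close> roots.\<close>

lemma roots_locally_constant_number:
  fixes p :: "'a::topological_space \<Rightarrow> complex poly"
  assumes cont: "\<And>k. continuous_on B (\<lambda>z. coeff (p z) k)"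
    and deg: "\<And>z. z \<in> B \<Longrightarrow> degree (p z) = D" "D \<ge> 1"
    and simple: "\<And>z t. z \<in> B \<Longrightarrow> poly (p z) t = 0 \<Longrightarrow> poly (pderiv (p z)) t \<noteq> 0"
    and z0: "z0 \<in> B"
  obtains T F \<eta> where "openin (top_of_set B) T" "z0 \<in> T" "\<eta> > 0"
    "\<And>r r'. r \<in> F \<Longrightarrow> r' \<in> F \<Longrightarrow> r \<noteq> r' \<Longrightarrow> ball r \<eta> \<inter> cball r' \<eta> = {}"
    "\<And>z r. z \<in> T \<Longrightarrow> r \<in> F \<Longrightarrow> \<exists>t. t \<in> ball r \<eta> \<and> poly (p z) t = 0 \<and> (\<forall>t'. t' \<in> cball r \<eta> \<and> poly (p z) t' = 0 \<longrightarrow> t' = t)"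
    "\<And>z t. z \<in> T \<Longrightarrow> poly (p z) t = 0 \<Longrightarrow> \<exists>r\<in>F. t \<in> ball r \<eta>"
proof -
  have nz: "p z \<noteq> 0" if "z \<in> B" for z using deg(1)[OF that] deg(2) by auto
  define F where "F = {t. poly (p z0) t = 0}"
  note F = simple_roots_factor[OF nz[OF z0] simple[OF z0], folded F_def, unfolded deg(1)[OF z0]]
  obtain d where d: "d > 0" "\<And>a b. a \<in> F \<Longrightarrow> b \<in> F \<Longrightarrow> a \<noteq> b \<Longrightarrow> d \<le> dist a b"
    using finite_separated[OF F(1)] by blast
  \<comment> \<open>A third of the separation keeps even the closed discs apart. Uniqueness on
    closed discs later makes the graph of a root closed.\<close>
  define \<eta> where "\<eta> = d / 3"
  have \<eta>: "\<eta> > 0" using d by (simp add: \<eta>_def)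
  have disj: "ball r \<eta> \<inter> cball r' \<eta> = {}" if "r \<in> F" "r' \<in> F" "r \<noteq> r'" for r r'
  proof (rule ccontr)
    assume "ball r \<eta> \<inter> cball r' \<eta> \<noteq> {}"
    then obtain t where "dist r t < \<eta>" "dist r' t \<le> \<eta>" by auto
    with dist_triangle[of r r' t] have "dist r r' < 2 * \<eta>" by (simp add: dist_commute)
    with d(2)[OF that] d(1) show False by (simp add: \<eta>_def)
  qed
  define \<phi> where "\<phi> = (\<lambda>r z. cmod (coeff (p z) D) * \<eta> ^ D - cmod (\<Sum>k\<le>D. coeff (p z) k * r ^ k))"
  define T where "T = B \<inter> (\<Inter>r\<in>F. {z\<in>B. \<phi> r z > 0})"
  have poly_eq: "poly (p z) r = (\<Sum>k\<le>D. coeff (p z) k * r ^ k)" if "z \<in> B" for z r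
    using deg(1)[OF that] by (simp add: poly_altdef)
  have "openin (top_of_set B) (B \<inter> \<phi> r -` {0<..})" for r
    unfolding \<phi>_def by (intro continuous_openin_preimage_gen continuous_intros cont)
  moreover have "B \<inter> \<phi> r -` {0<..} = {z\<in>B. \<phi> r z > 0}" for r by auto
  ultimately have op: "openin (top_of_set B) {z\<in>B. \<phi> r z > 0}" for r by metis
  have opT: "openin (top_of_set B) T"
    unfolding T_def
  proof (cases "F = {}")
    case True
    then show "openin (top_of_set B) (B \<inter> (\<Inter>r\<in>F. {z\<in>B. \<phi> r z > 0}))" by simp
  next
    case False
    then show "openin (top_of_set B) (B \<inter> (\<Inter>r\<in>F. {z\<in>B. \<phi> r z > 0}))"
      using F(1) op by (intro openin_Int openin_INT) auto
  qed
  have z0T: "z0 \<in> T"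
  proof -
    have "coeff (p z0) D \<noteq> 0" using nz[OF z0] deg(1)[OF z0] by (metis leading_coeff_neq_0)
    then have "\<phi> r z0 > 0" if "r \<in> F" for r
      using that \<eta> poly_eq[OF z0, of r] by (simp add: \<phi>_def F_def)
    then show ?thesis by (simp add: T_def z0)
  qed
  have near: "\<exists>t\<in>ball r \<eta>. poly (p z) t = 0" if "z \<in> T" "r \<in> F" for z r
  proof (rule ccontr)
    assume far: "\<not> (\<exists>t\<in>ball r \<eta>. poly (p z) t = 0)"
    have zB: "z \<in> B" and pos: "\<phi> r z > 0" using that by (auto simp: T_def)
    note fac = simple_roots_factor[OF nz[OF zB] simple[OF zB], unfolded deg(1)[OF zB]]
    have "\<eta> ^ D = (\<Prod>t | poly (p z) t = 0. \<eta>)" using fac(2) by simp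
    also have "\<dots> \<le> (\<Prod>t | poly (p z) t = 0. cmod (r - t))"
      by (rule prod_mono) (use far \<eta> in \<open>auto simp: dist_norm not_less\<close>)
    finally have "\<eta> ^ D \<le> cmod (\<Prod>t | poly (p z) t = 0. r - t)" by (simp add: prod_norm)
    then have "cmod (coeff (p z) D) * \<eta> ^ D \<le> cmod (coeff (p z) D * (\<Prod>t | poly (p z) t = 0. r - t))"
      by (simp add: norm_mult mult_left_mono)
    also have "\<dots> = cmod (poly (p z) r)" using fac(3)[of r] by simp
    finally have "cmod (coeff (p z) D) * \<eta> ^ D \<le> cmod (poly (p z) r)" .
    with pos poly_eq[OF zB] show False by (simp add: \<phi>_def)
  qed
  then obtain s where s: "\<And>z r. z \<in> T \<Longrightarrow> r \<in> F \<Longrightarrow> s z r \<in> ball r \<eta> \<and> poly (p z) (s z r) = 0"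
    by metis
  have all: "\<exists>r\<in>F. t = s z r" if "z \<in> T" "poly (p z) t = 0" for z t
  proof -
    have zB: "z \<in> B" using that by (auto simp: T_def)
    note fac = simple_roots_factor[OF nz[OF zB] simple[OF zB], unfolded deg(1)[OF zB]]
    have "inj_on (s z) F"
    proof (rule inj_onI, rule ccontr)
      fix a b assume "a \<in> F" "b \<in> F" "s z a = s z b" "a \<noteq> b"
      then have "s z a \<in> ball a \<eta> \<inter> cball b \<eta>" using s[OF that(1), of a] s[OF that(1), of b] by auto
      with disj \<open>a \<in> F\<close> \<open>b \<in> F\<close> \<open>a \<noteq> b\<close> show False by blast
    qed
    then have "card (s z ` F) = card {t. poly (p z) t = 0}"
      using F(2) fac(2) by (simp add: card_image)
    moreover have "s z ` F \<subseteq> {t. poly (p z) t = 0}" using s that(1) by auto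
    ultimately have "s z ` F = {t. poly (p z) t = 0}" by (intro card_subset_eq fac(1))
    with that(2) show ?thesis by blast
  qed
  show ?thesis
  proof (rule that[OF opT z0T \<eta> disj])
    fix z r assume zr: "z \<in> T" "r \<in> F"
    have "t' = s z r" if t': "t' \<in> cball r \<eta>" "poly (p z) t' = 0" for t'
    proof -
      obtain r' where r': "r' \<in> F" "t' = s z r'" using all[OF zr(1) t'(2)] by blast
      with s[OF zr(1) r'(1)] t'(1) have "t' \<in> ball r' \<eta> \<inter> cball r \<eta>" by auto
      with disj[OF r'(1) zr(2)] have "r' = r" by blast
      with r' show ?thesis by simp
    qed
    with s[OF zr] show "\<exists>t. t \<in> ball r \<eta> \<and> poly (p z) t = 0 \<and> (\<forall>t'. t' \<in> cball r \<eta> \<and> poly (p z) t' = 0 \<longrightarrow> t' = t)"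
      by (intro exI[of _ "s z r"]) blast
  next
    fix z t assume "z \<in> T" "poly (p z) t = 0"
    then show "\<exists>r\<in>F. t \<in> ball r \<eta>" using all s by blast
  qed
qed

text \<open>The roots form a finite covering of \<open>B\<close>, which is simply connected because
  it is convex; so the identity of \<open>B\<close> lifts to the covering, and the second component
  of the lift is the root.\<close>

lemma continuous_simple_root:
  fixes p :: "'a::euclidean_space \<Rightarrow> complex poly"
  assumes conv: "convex B"
    and cont: "\<And>k. continuous_on B (\<lambda>z. coeff (p z) k)"
    and deg: "\<And>z. z \<in> B \<Longrightarrow> degree (p z) = D" "D \<ge> 1"
    and simple: "\<And>z t. z \<in> B \<Longrightarrow> poly (p z) t = 0 \<Longrightarrow> poly (pderiv (p z)) t \<noteq> 0"
  obtains \<theta> where "continuous_on B \<theta>" "\<And>z. z \<in> B \<Longrightarrow> poly (p z) (\<theta> z) = 0"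
proof -
  define E where "E = {(z, t). z \<in> B \<and> poly (p z) t = 0}"
  have contp: "continuous_on (S \<times> UNIV) (\<lambda>(z, t). poly (p z) t)" if "S \<subseteq> B" for S
  proof -
    have "continuous_on (S \<times> UNIV) (\<lambda>x. \<Sum>k\<le>D. coeff (p (fst x)) k * snd x ^ k)"
      by (intro continuous_intros continuous_on_compose2[OF cont]) (use that in auto)
    then show ?thesis
      by (rule continuous_on_eq) (use deg that in \<open>auto simp: poly_altdef\<close>)
  qed
  have "covering_space E fst B"
    unfolding covering_space_def
  proof (intro conjI ballI)
    show "continuous_on E fst" by (intro continuous_intros)
    show "fst ` E = B"
    proof (intro equalityI subsetI)
      fix z assume z: "z \<in> B"
      with deg have "degree (p z) \<noteq> 0" by simp
      then have "\<exists>t. poly (p z) t = 0"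
        by (intro fundamental_theorem_of_algebra) (simp add: constant_degree)
      with z show "z \<in> fst ` E" by (force simp: E_def)
    qed (auto simp: E_def)
    fix z0 assume "z0 \<in> B"
    obtain T F \<eta> where T: "openin (top_of_set B) T" "z0 \<in> T" "\<eta> > 0"
      and disj: "\<And>r r'. r \<in> F \<Longrightarrow> r' \<in> F \<Longrightarrow> r \<noteq> r' \<Longrightarrow> ball r \<eta> \<inter> cball r' \<eta> = {}"
      and uniq: "\<And>z r. z \<in> T \<Longrightarrow> r \<in> F \<Longrightarrow> \<exists>t. t \<in> ball r \<eta> \<and> poly (p z) t = 0 \<and> (\<forall>t'. t' \<in> cball r \<eta> \<and> poly (p z) t' = 0 \<longrightarrow> t' = t)"
      and cover: "\<And>z t. z \<in> T \<Longrightarrow> poly (p z) t = 0 \<Longrightarrow> \<exists>r\<in>F. t \<in> ball r \<eta>"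
      by (rule roots_locally_constant_number[OF cont deg simple \<open>z0 \<in> B\<close>]) (assumption+, rule that)
    define s where "s = (\<lambda>r z. SOME t. t \<in> ball r \<eta> \<and> poly (p z) t = 0 \<and>
      (\<forall>t'. t' \<in> cball r \<eta> \<and> poly (p z) t' = 0 \<longrightarrow> t' = t))"
    have s: "s r z \<in> ball r \<eta> \<and> poly (p z) (s r z) = 0"
        "t \<in> cball r \<eta> \<Longrightarrow> poly (p z) t = 0 \<Longrightarrow> t = s r z" if "z \<in> T" "r \<in> F" for z r t
      using someI_ex[OF uniq[OF that]] unfolding s_def by blast+
    obtain W where W: "open W" "T = B \<inter> W" using T(1) by (auto simp: openin_open)
    have TB: "T \<subseteq> B" using W by blast
    define sheet where "sheet = (\<lambda>r. E \<inter> (W \<times> ball r \<eta>))"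
    show "\<exists>T. z0 \<in> T \<and> openin (top_of_set B) T \<and>
           (\<exists>v. \<Union>v = E \<inter> fst -` T \<and> (\<forall>u\<in>v. openin (top_of_set E) u) \<and>
                pairwise disjnt v \<and> (\<forall>u\<in>v. \<exists>q. homeomorphism u T fst q))"
    proof (intro exI[of _ T] conjI T exI[of _ "sheet ` F"])
      show "\<Union> (sheet ` F) = E \<inter> fst -` T"
        using cover W by (auto simp: sheet_def E_def)
      show "\<forall>u\<in>sheet ` F. openin (top_of_set E) u"
        using W by (auto simp: sheet_def intro!: openin_open_Int open_Times)
      show "pairwise disjnt (sheet ` F)"
      proof (rule pairwiseI)
        fix u u' assume u: "u \<in> sheet ` F" "u' \<in> sheet ` F" "u \<noteq> u'"
        then obtain r r' where "u = sheet r" "u' = sheet r'" "r \<in> F" "r' \<in> F" "r \<noteq> r'" by blast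
        with disj[of r r'] ball_subset_cball[of r' \<eta>] show "disjnt u u'"
          by (auto simp: sheet_def disjnt_def)
      qed
      show "\<forall>u\<in>sheet ` F. \<exists>q. homeomorphism u T fst q"
      proof
        fix u assume "u \<in> sheet ` F"
        then obtain r where r: "u = sheet r" "r \<in> F" by blast
        \<comment> \<open>The graph is the zero set of the polynomial in a closed cylinder, hence
          closed, and the values lie in a compact disc.\<close>
        have "continuous_on T (s r)"
        proof (subst continuous_closed_graph_eq)
          show "compact (cball r \<eta>)" by simp
          show "s r \<in> T \<rightarrow> cball r \<eta>" using s(1)[OF _ r(2)] ball_subset_cball by blast
          have "(\<lambda>z. (z, s r z)) ` T = {x \<in> T \<times> cball r \<eta>. (case x of (z, t) \<Rightarrow> poly (p z) t) = 0}"
            using s[OF _ r(2)] by (auto simp: less_imp_le)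
          moreover have "continuous_on (T \<times> cball r \<eta>) (\<lambda>(z, t). poly (p z) t)"
            by (rule continuous_on_subset[OF contp[OF TB]]) auto
          ultimately show "closedin (top_of_set (T \<times> cball r \<eta>)) ((\<lambda>z. (z, s r z)) ` T)"
            using continuous_closedin_preimage_constant[of "T \<times> cball r \<eta>" "\<lambda>(z, t). poly (p z) t" 0]
            by presburger
        qed
        then have "homeomorphism u T fst (\<lambda>z. (z, s r z))"
        proof (intro homeomorphismI)
          show "fst ` u \<subseteq> T" using W by (auto simp: r sheet_def E_def)
          show "(\<lambda>z. (z, s r z)) ` T \<subseteq> u" using s(1)[OF _ r(2)] W by (auto simp: r sheet_def E_def)
          fix x assume "x \<in> u"
          then show "(fst x, s r (fst x)) = x"
            using s(2)[OF _ r(2)] W by (force simp: r sheet_def E_def)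
        qed (auto intro!: continuous_intros)
        then show "\<exists>q. homeomorphism u T fst q" by blast
      qed
    qed
  qed
  then obtain g where g: "continuous_on B g" "g \<in> B \<rightarrow> E" "\<And>y. y \<in> B \<Longrightarrow> fst (g y) = y"
    by (rule covering_space_lift[of E fst B B "\<lambda>x. x"])
       (use conv in \<open>auto simp: convex_imp_simply_connected convex_imp_locally_path_connected\<close>)
  show ?thesis
  proof (rule that[of "snd \<circ> g"])
    show "continuous_on B (snd \<circ> g)" using g(1) by (auto simp: o_def intro!: continuous_intros)
    fix z assume z: "z \<in> B"
    then have "g z \<in> E" using g(2) by blast
    then show "poly (p z) ((snd \<circ> g) z) = 0" using g(3)[OF z] by (auto simp: E_def)
  qed
qed

section \<open>Continuous sections\<close>

abbreviation fst_coords :: "((complex ^ 'n::finite) \<times> (complex ^ 'm::finite) \<Rightarrow> complex) set" where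
  "fst_coords \<equiv> range (\<lambda>i v. fst v $ i)"

abbreviation snd_coord :: "'m::finite \<Rightarrow> (complex ^ 'n::finite) \<times> (complex ^ 'm) \<Rightarrow> complex" where
  "snd_coord \<equiv> (\<lambda>j v. snd v $ j)"

lemma poly_funs_fst_restrict:
  assumes "f \<in> poly_funs fst_coords" shows "(\<lambda>z. f (z, 0)) \<in> polys"
proof -
  have "f \<circ> (\<lambda>z. (z, 0)) \<in> polys"
    using assms unfolding polys_def by (rule poly_funs_comp) (auto intro!: poly_funs.coord simp: o_def)
  then show ?thesis by (simp add: o_def)
qed

lemma poly_funs_agree:
  assumes "f \<in> poly_funs (fst_coords \<union> snd_coord ` T)" "fst v = fst w" "\<And>j. j \<in> T \<Longrightarrow> snd v $ j = snd w $ j"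
  shows "f v = f w"
  using assms(1) by induction (use assms(2,3) in auto)

lemma poly_funs_fst_agree: "f \<in> poly_funs fst_coords \<Longrightarrow> f v = f (fst v, 0)"
  using poly_funs_agree[of f "{}" v "(fst v, 0)"] by simp

lemma continuous_poly_funs:
  assumes "f \<in> poly_funs X" "\<And>x. x \<in> X \<Longrightarrow> continuous_on UNIV x"
  shows "continuous_on UNIV f"
  using assms(1) by induction (use assms(2) in \<open>auto intro!: continuous_intros\<close>)

lemma continuous_polys: "f \<in> polys \<Longrightarrow> continuous_on UNIV f"
  unfolding polys_def by (erule continuous_poly_funs) (auto intro!: continuous_intros)

lemma continuous_polys2: "f \<in> poly_funs (fst_coords \<union> snd_coord ` T) \<Longrightarrow> continuous_on UNIV f"
  by (erule continuous_poly_funs) (auto intro!: continuous_intros)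

lemma fst_coords_domain:
  fixes f g :: "(complex ^ 'n::finite) \<times> (complex ^ 'm::finite) \<Rightarrow> complex"
  assumes "f \<in> poly_funs fst_coords" "g \<in> poly_funs fst_coords" "f * g = 0"
  shows "f = 0 \<or> g = 0"
proof -
  have "(\<lambda>z. f (z, 0)) * (\<lambda>z. g (z, 0)) = 0"
    using fun_cong[OF assms(3)] by (auto simp: fun_eq_iff)
  then have "(\<lambda>z. f (z, 0)) = 0 \<or> (\<lambda>z. g (z, 0)) = 0"
    using polys_no_zero_divisors[OF poly_funs_fst_restrict[OF assms(1)] poly_funs_fst_restrict[OF assms(2)]]
    by blast
  then show ?thesis
    using poly_funs_fst_agree[OF assms(1)] poly_funs_fst_agree[OF assms(2)]
    by (auto simp: fun_eq_iff)
qed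

text \<open>Induction on the set \<open>T\<close> of coordinates whose equations are already
  satisfied: the next coordinate is a continuous root of its minimal polynomial along the section
  found so far, and coordinates outside \<open>T\<close> are placeholders. \<open>\<Delta>\<close>
  precedes \<open>B\<close> because one hypersurface must serve all balls.\<close>

lemma generic_ideal_section:
  fixes J :: "((complex ^ 'n::finite) \<times> (complex ^ 'm::finite) \<Rightarrow> complex) set" and T :: "'m set"
  assumes J: "generic_ideal (fst_coords \<union> range snd_coord) fst_coords J"
  shows "\<exists>\<Delta>\<in>polys. \<Delta> \<noteq> 0 \<and> (\<forall>B. convex B \<and> (\<forall>z\<in>B. \<Delta> z \<noteq> 0) \<longrightarrow>
    (\<exists>\<xi>. continuous_on B \<xi> \<and>
      (\<forall>z\<in>B. \<forall>g\<in>J. g \<in> poly_funs (fst_coords \<union> snd_coord ` T) \<longrightarrow> g (z, \<xi> z) = 0)))"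
proof -
  interpret generic_ideal "fst_coords \<union> range snd_coord" fst_coords J by (rule J)
  show ?thesis
  proof (rule finite_induct[OF finite[of T]])
    show "\<exists>\<Delta>\<in>polys. \<Delta> \<noteq> 0 \<and> (\<forall>B. convex B \<and> (\<forall>z\<in>B. \<Delta> z \<noteq> 0) \<longrightarrow>
      (\<exists>\<xi> :: _ \<Rightarrow> complex ^ 'm. continuous_on B \<xi> \<and>
        (\<forall>z\<in>B. \<forall>g\<in>J. g \<in> poly_funs (fst_coords \<union> snd_coord ` {}) \<longrightarrow> g (z, \<xi> z) = 0)))"
    proof (intro bexI[of _ 1] conjI allI impI exI[of _ "\<lambda>_. 0"])
      show "\<forall>z\<in>B. \<forall>g\<in>J. g \<in> poly_funs (fst_coords \<union> snd_coord ` {}) \<longrightarrow> g (z, 0) = 0"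
        for B :: "(complex ^ 'n) set"
      proof (intro ballI impI)
        fix z :: "complex ^ 'n" and g :: "_ \<Rightarrow> complex"
        assume "g \<in> J" "g \<in> poly_funs (fst_coords \<union> snd_coord ` {})"
        then have "g = 0" using inter_base[of g] by (metis Un_empty_right image_empty)
        then show "g (z, 0) = 0" by simp
      qed
    qed (auto simp: polys_def fun_eq_iff intro: poly_funs_1)
  next
    fix i :: 'm and T :: "'m set"
    assume i: "i \<notin> T"
    assume "\<exists>\<Delta>\<in>polys. \<Delta> \<noteq> 0 \<and> (\<forall>B. convex B \<and> (\<forall>z\<in>B. \<Delta> z \<noteq> 0) \<longrightarrow>
      (\<exists>\<xi> :: _ \<Rightarrow> complex ^ 'm. continuous_on B \<xi> \<and>
        (\<forall>z\<in>B. \<forall>g\<in>J. g \<in> poly_funs (fst_coords \<union> snd_coord ` T) \<longrightarrow> g (z, \<xi> z) = 0)))"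
    then obtain \<Delta> where \<Delta>: "\<Delta> \<in> polys" "\<Delta> \<noteq> 0" and
      IH: "\<And>B. convex B \<Longrightarrow> \<forall>z\<in>B. \<Delta> z \<noteq> 0 \<Longrightarrow> \<exists>\<xi> :: _ \<Rightarrow> complex ^ 'm. continuous_on B \<xi> \<and>
        (\<forall>z\<in>B. \<forall>g\<in>J. g \<in> poly_funs (fst_coords \<union> snd_coord ` T) \<longrightarrow> g (z, \<xi> z) = 0)"
      by blast
    let ?T = "fst_coords \<union> snd_coord ` T :: ((complex ^ 'n) \<times> (complex ^ 'm) \<Rightarrow> complex) set"
    let ?x = "snd_coord i :: (complex ^ 'n) \<times> (complex ^ 'm) \<Rightarrow> complex"
    have sub: "fst_coords \<subseteq> ?T" "?T \<subseteq> fst_coords \<union> range snd_coord" "?x \<in> fst_coords \<union> range snd_coord"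
      by auto
    obtain D P where P: "min_poly ?T ?x D P" by (rule min_poly_exists[OF sub(1,3)])
    obtain h where h: "h \<in> poly_funs fst_coords" "h \<noteq> 0"
      and sep: "\<forall>v. (\<forall>g\<in>J. g \<in> poly_funs ?T \<longrightarrow> g v = 0) \<longrightarrow> h v \<noteq> 0 \<longrightarrow> coeff P D v \<noteq> 0 \<and>
       (\<forall>t. poly (ev_poly v P) t = 0 \<longrightarrow> poly (pderiv (ev_poly v P)) t \<noteq> 0)"
      by (rule min_poly_separable[OF P sub])
    have P': "P \<in> polys_over ?T" "D \<ge> 1" "\<forall>k>D. coeff P k = 0" using P by (simp_all add: min_poly_def)
    \<comment> \<open>Its zero set contains all points where the minimal polynomial of the new
      coordinate drops its degree or acquires a multiple root.\<close>
    define h0 where "h0 = (\<lambda>z. h (z, 0))"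
    have h0: "h0 \<in> polys" "h0 \<noteq> 0"
    proof -
      show "h0 \<in> polys" unfolding h0_def by (rule poly_funs_fst_restrict[OF h(1)])
      obtain v where "h v \<noteq> 0" using h(2) by (auto simp: fun_eq_iff)
      then have "h0 (fst v) \<noteq> 0" unfolding h0_def using poly_funs_fst_agree[OF h(1), of v] by metis
      then show "h0 \<noteq> 0" by (metis zero_fun_apply)
    qed
    show "\<exists>\<Delta>\<in>polys. \<Delta> \<noteq> 0 \<and> (\<forall>B. convex B \<and> (\<forall>z\<in>B. \<Delta> z \<noteq> 0) \<longrightarrow>
      (\<exists>\<xi> :: _ \<Rightarrow> complex ^ 'm. continuous_on B \<xi> \<and>
        (\<forall>z\<in>B. \<forall>g\<in>J. g \<in> poly_funs (fst_coords \<union> snd_coord ` insert i T) \<longrightarrow> g (z, \<xi> z) = 0)))"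
    proof (intro bexI[of _ "\<Delta> * h0"] conjI allI impI)
      show "\<Delta> * h0 \<in> polys" using \<Delta> h0 unfolding polys_def by (intro poly_funs_mult)
      show "\<Delta> * h0 \<noteq> 0" using \<Delta> h0 polys_no_zero_divisors by blast
      fix B :: "(complex ^ 'n) set" assume "convex B \<and> (\<forall>z\<in>B. (\<Delta> * h0) z \<noteq> 0)"
      then have B: "convex B" "\<forall>z\<in>B. \<Delta> z \<noteq> 0" "\<forall>z\<in>B. h0 z \<noteq> 0" by auto
      obtain \<xi> :: "_ \<Rightarrow> complex ^ 'm" where \<xi>: "continuous_on B \<xi>"
        and van: "\<And>z g. z \<in> B \<Longrightarrow> g \<in> J \<Longrightarrow> g \<in> poly_funs ?T \<Longrightarrow> g (z, \<xi> z) = 0"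
        using IH[OF B(1,2)] by blast
      define p where "p = (\<lambda>z. ev_poly (z, \<xi> z) P)"
      have hz: "h (z, \<xi> z) \<noteq> 0" if "z \<in> B" for z
        using B(3) that poly_funs_fst_agree[OF h(1), of "(z, \<xi> z)"] by (simp add: h0_def)
      have lead: "coeff P D (z, \<xi> z) \<noteq> 0" if "z \<in> B" for z
        using sep[rule_format, of "(z, \<xi> z)"] van hz that by blast
      obtain \<theta> where \<theta>: "continuous_on B \<theta>" "\<And>z. z \<in> B \<Longrightarrow> poly (p z) (\<theta> z) = 0"
      proof (rule continuous_simple_root[of B p D])
        show "continuous_on B (\<lambda>z. coeff (p z) k)" for k
        proof -
          have "coeff P k \<in> poly_funs ?T" using P'(1) by (simp add: polys_over_def)
          then have "continuous_on UNIV (coeff P k)" by (rule continuous_polys2)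
          then show ?thesis unfolding p_def coeff_ev_poly
            by (rule continuous_on_compose2) (auto intro!: continuous_intros \<xi>)
        qed
        show "degree (p z) = D" if "z \<in> B" for z
        proof (rule antisym)
          show "degree (p z) \<le> D" by (rule degree_le) (use P'(3) in \<open>simp add: p_def coeff_ev_poly\<close>)
          show "D \<le> degree (p z)" by (rule le_degree) (use lead[OF that] in \<open>simp add: p_def coeff_ev_poly\<close>)
        qed
        show "poly (pderiv (p z)) t \<noteq> 0" if "z \<in> B" "poly (p z) t = 0" for z t
          using sep[rule_format, of "(z, \<xi> z)"] van hz that unfolding p_def by blast
      qed (use B P' in auto)
      define \<xi>' where "\<xi>' = (\<lambda>z. \<chi> l. if l = i then \<theta> z else \<xi> z $ l)"
      show "\<exists>\<xi> :: _ \<Rightarrow> complex ^ 'm. continuous_on B \<xi> \<and>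
        (\<forall>z\<in>B. \<forall>g\<in>J. g \<in> poly_funs (fst_coords \<union> snd_coord ` insert i T) \<longrightarrow> g (z, \<xi> z) = 0)"
      proof (intro exI[of _ \<xi>'] conjI ballI impI)
        show "continuous_on B \<xi>'"
          unfolding \<xi>'_def
        proof (rule continuous_on_vec_lambda)
          show "continuous_on B (\<lambda>z. if l = i then \<theta> z else \<xi> z $ l)" for l
            by (cases "l = i") (auto intro!: continuous_intros \<theta> \<xi>)
        qed
        fix z g assume z: "z \<in> B" and gJ: "g \<in> J"
          and "g \<in> poly_funs (fst_coords \<union> snd_coord ` insert i T)"
        then have "g \<in> poly_funs (insert ?x ?T)" by simp
        from bexE[OF poly_funs_insert_poly[OF this]] obtain Q where
          Q: "Q \<in> polys_over ?T" "g = poly Q ?x" .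
        have "poly (ev_poly (z, \<xi> z) Q) (\<theta> z) = 0"
        proof (rule min_poly_root[OF P _ lead[OF z] _ sub(2,3) Q(1)])
          show "poly (ev_poly (z, \<xi> z) P) (\<theta> z) = 0" using \<theta>(2)[OF z] by (simp add: p_def)
          show "poly Q ?x \<in> J" using gJ Q(2) by metis
        qed (rule van[OF z])
        \<comment> \<open>The coefficients involve only coordinates in \<open>T\<close>, and
          \<open>i\<close> is not one of them.\<close>
        moreover have "ev_poly (z, \<xi> z) Q = ev_poly (z, \<xi>' z) Q"
        proof (rule poly_eqI)
          fix k
          have "coeff Q k \<in> poly_funs ?T" using Q(1) by (simp add: polys_over_def)
          then show "coeff (ev_poly (z, \<xi> z) Q) k = coeff (ev_poly (z, \<xi>' z) Q) k"
            unfolding coeff_ev_poly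
            by (rule poly_funs_agree) (use i in \<open>auto simp: \<xi>'_def\<close>)
        qed
        ultimately show "g (z, \<xi>' z) = 0"
          unfolding Q(2) poly_ev_poly by (simp add: \<xi>'_def)
      qed
    qed
  qed
qed

section \<open>From the ideal back to the projective variety\<close>

lemma proj_class_cases:
  obtains x where "x \<noteq> 0" "p = proj_class x"
proof -
  have "proj_rel (proj_rep p) (proj_rep p)" "proj_class (proj_rep p) = p"
    using Quotient3_rep_reflp[OF Quotient3_proj] Quotient3_abs_rep[OF Quotient3_proj] by blast+
  then show ?thesis using that[of "proj_rep p"] by (simp add: proj_rel_def)
qed

text \<open>Homogeneity in the second group makes nonvanishing independent of the representative, so
  membership in a basic open set can be tested on any of them.\<close>

lemma affine_proj_zariski_separate:
  fixes x :: "complex ^ 'm::finite" and z :: "complex ^ 'n::finite"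
  assumes V: "closedin affine_proj_zariski V" and x: "x \<noteq> 0" and nV: "(z, proj_class x) \<notin> V"
  obtains f where "f \<in> polys2" "f (z, x) \<noteq> 0"
    "\<And>z' x'. x' \<noteq> 0 \<Longrightarrow> (z', proj_class x') \<in> V \<Longrightarrow> f (z', x') = 0"
proof -
  define bas :: "((complex ^ 'n) \<times> (complex ^ 'm) \<Rightarrow> complex) \<Rightarrow> ((complex ^ 'n) \<times> 'm proj) set"
    where "bas = (\<lambda>f. {(z, proj_class x) |z x. x \<noteq> 0 \<and> f (z, x) \<noteq> 0})"
  let ?B = "{bas f |f d. f \<in> snd_hom_polys d}"
  have mem: "(z, proj_class x) \<in> bas f \<longleftrightarrow> f (z, x) \<noteq> 0" if f: "f \<in> snd_hom_polys d" and x: "x \<noteq> 0" for f d z x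
  proof
    assume "(z, proj_class x) \<in> bas f"
    then obtain y where y: "y \<noteq> 0" "proj_class x = proj_class y" "f (z, y) \<noteq> 0" by (auto simp: bas_def)
    then obtain c where "y = c *s x" using x proj_class_eq_iff by blast
    with y f show "f (z, x) \<noteq> 0" by (auto simp: snd_hom_polys_def)
  qed (use x in \<open>auto simp: bas_def\<close>)
  have apz: "affine_proj_zariski = topology_generated_by ?B"
    unfolding affine_proj_zariski_def bas_def by simp
  have one: "1 \<in> snd_hom_polys 0" by (simp add: snd_hom_polys_def polys2_def poly_funs_1)
  have "bas 1 = UNIV"
  proof -
    have "(z, p) \<in> bas 1" for z p
    proof -
      obtain y where "y \<noteq> 0" "p = proj_class y" by (rule proj_class_cases)
      then show ?thesis by (auto simp: bas_def)
    qed
    then show ?thesis by auto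
  qed
  then have "openin affine_proj_zariski (UNIV :: ((complex ^ 'n) \<times> 'm proj) set)"
    unfolding apz using one by (intro topology_generated_by_Basis) blast
  then have UN: "topspace affine_proj_zariski = (UNIV :: ((complex ^ 'n) \<times> 'm proj) set)"
    using openin_subset by blast
  have "\<exists>B\<in>?B. (z, proj_class x) \<in> B \<and> B \<subseteq> UNIV - V"
  proof (rule openin_topology_generated_by_basis)
    show "openin (topology_generated_by ?B) (UNIV - V)"
    proof -
      have "openin affine_proj_zariski (UNIV - V)" using V by (simp add: closedin_def UN)
      then show ?thesis unfolding apz .
    qed
    show "(z, proj_class x) \<in> UNIV - V" using nV by simp
    fix A B assume "A \<in> ?B" "B \<in> ?B"
    then obtain f d g e where fg: "A = bas f" "f \<in> snd_hom_polys d" "B = bas g" "g \<in> snd_hom_polys e"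
      by blast
    then have fgh: "f * g \<in> snd_hom_polys (d + e)"
      unfolding snd_hom_polys_def polys2_def
      by (auto intro: poly_funs_mult simp: power_add)
    have "A \<inter> B = bas (f * g)"
    proof (intro equalityI subsetI)
      fix q assume q: "q \<in> A \<inter> B"
      obtain y where "y \<noteq> 0" "snd q = proj_class y" by (rule proj_class_cases)
      with q show "q \<in> bas (f * g)"
        using mem[OF fg(2), of y "fst q"] mem[OF fg(4), of y "fst q"] mem[OF fgh, of y "fst q"] fg
        by (cases q) auto
    next
      fix q assume q: "q \<in> bas (f * g)"
      obtain y where "y \<noteq> 0" "snd q = proj_class y" by (rule proj_class_cases)
      with q show "q \<in> A \<inter> B"
        using mem[OF fg(2), of y "fst q"] mem[OF fg(4), of y "fst q"] mem[OF fgh, of y "fst q"] fg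
        by (cases q) auto
    qed
    with fgh show "A \<inter> B \<in> ?B" by blast
  qed
  then obtain f d where f: "f \<in> snd_hom_polys d" "(z, proj_class x) \<in> bas f" "bas f \<subseteq> UNIV - V" by blast
  show ?thesis
  proof (rule that[of f])
    show "f \<in> polys2" using f by (simp add: snd_hom_polys_def)
    show "f (z, x) \<noteq> 0" using mem[OF f(1) x] f by blast
    show "f (z', x') = 0" if "x' \<noteq> 0" "(z', proj_class x') \<in> V" for z' x'
      using mem[OF f(1) that(1), of z'] f that by blast
  qed
qed

text \<open>\<open>K\<close> is the set of homogeneous coordinates that do not vanish along the
  section. Equations for the quotients are supplied for every \<open>k\<close> in \<open>K\<close>,
  because the denominator will be the coordinate that is largest at the centre of a ball still to be
  chosen.\<close>

lemma variety_section:
  fixes V :: "((complex ^ 'n::finite) \<times> 'm::finite proj) set"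
  assumes V: "closedin affine_proj_zariski V" and dim: "affine_dim (fst ` V) = enat CARD('n)"
  obtains \<Delta> K d a where "\<Delta> \<in> polys" "\<Delta> \<noteq> 0"
    "\<And>i k l. k \<in> K \<Longrightarrow> a i k l \<in> polys" "\<And>i k. k \<in> K \<Longrightarrow> \<exists>l\<le>d i k. a i k l \<noteq> 0"
    "\<And>B. convex B \<Longrightarrow> \<forall>z\<in>B. \<Delta> z \<noteq> 0 \<Longrightarrow> \<exists>\<xi> :: complex ^ 'n \<Rightarrow> complex ^ 'm. continuous_on B \<xi> \<and>
      (\<forall>z\<in>B. \<xi> z \<noteq> 0 \<and> (z, proj_class (\<xi> z)) \<in> V \<and> (\<forall>k. \<xi> z $ k \<noteq> 0 \<longleftrightarrow> k \<in> K) \<and>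
        (\<forall>i. \<forall>k\<in>K. (\<Sum>l\<le>d i k. a i k l z * (\<xi> z $ i / \<xi> z $ k) ^ l) = 0))"
proof -
  define W where "W = (\<lambda>j. {(z, x). x $ j = 1 \<and> (z, proj_class x) \<in> V})"
  have nzj: "x \<noteq> 0" if "x $ j = 1" for x :: "complex ^ 'm" and j using that by auto
  \<comment> \<open>Some affine chart must dominate the space: otherwise a product of nonzero
    polynomials, one vanishing on the projection of each chart, would vanish on the whole projection
    of \<open>V\<close>.\<close>
  have "\<exists>j. \<forall>h\<in>polys. (\<forall>v\<in>W j. h (fst v) = 0) \<longrightarrow> h = 0"
  proof (rule ccontr)
    assume "\<not> (\<exists>j. \<forall>h\<in>polys. (\<forall>v\<in>W j. h (fst v) = 0) \<longrightarrow> h = 0)"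
    then have "\<forall>j. \<exists>h. h \<in> polys \<and> h \<noteq> 0 \<and> (\<forall>v\<in>W j. h (fst v) = 0)" by blast
    then obtain h where h: "\<And>j. h j \<in> polys" "\<And>j. h j \<noteq> 0" "\<And>j v. v \<in> W j \<Longrightarrow> h j (fst v) = 0"
      by metis
    have "(\<Prod>j\<in>UNIV. h j) z = 0" if zV: "z \<in> fst ` V" for z
    proof -
      obtain p where "(z, p) \<in> V" using zV by force
      moreover obtain x where x: "x \<noteq> 0" "p = proj_class x" by (rule proj_class_cases)
      moreover obtain j where j: "x $ j \<noteq> 0" using x by (auto simp: vec_eq_iff)
      moreover define y where "y = (1 / x $ j) *s x"
      ultimately have yj: "y $ j = 1" and "proj_class x = proj_class y"
        using proj_class_eq_iff[of x y] nzj[of y j] by (auto simp: y_def)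
      with \<open>(z, p) \<in> V\<close> x have "(z, y) \<in> W j" by (simp add: W_def)
      from h(3)[OF this] have "h j z = 0" by simp
      then show ?thesis by (auto simp: prod_fun_apply)
    qed
    moreover have "(\<Prod>j\<in>UNIV. h j) \<in> polys" using h unfolding polys_def by (intro poly_funs_prod)
    ultimately have "(\<Prod>j\<in>UNIV. h j) = 0" using polys_vanishing_on_full_dim[OF dim] by blast
    with polys_prod_nonzero[of UNIV h] h show False by blast
  qed
  then obtain j where j: "\<And>h. h \<in> polys \<Longrightarrow> (\<forall>v\<in>W j. h (fst v) = 0) \<Longrightarrow> h = 0" by blast
  define Z :: "((complex ^ 'n) \<times> (complex ^ 'm) \<Rightarrow> complex) set" where "Z = fst_coords"
  define X :: "((complex ^ 'n) \<times> (complex ^ 'm) \<Rightarrow> complex) set" where "X = fst_coords \<union> range snd_coord"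
  have X2: "polys2 = poly_funs X" by (simp add: polys2_def X_def)
  have ZX: "Z \<subseteq> X" by (auto simp: Z_def X_def)
  define I where "I = {f \<in> poly_funs X. \<forall>v\<in>W j. f v = 0}"
  have I_ideal: "fun_ideal (poly_funs X) I"
    unfolding fun_ideal_def I_def by (auto intro: poly_funs_closed)
  have I_inter: "f = 0" if "f \<in> I" "f \<in> poly_funs Z" for f
  proof -
    have fv: "f v = f (fst v, 0)" for v using that(2) poly_funs_fst_agree unfolding Z_def by blast
    have "(\<lambda>z. f (z, 0)) = 0"
    proof (rule j)
      show "(\<lambda>z. f (z, 0)) \<in> polys" using that(2) unfolding Z_def by (rule poly_funs_fst_restrict)
      show "\<forall>v\<in>W j. f (fst v, 0) = 0" using that(1) by (auto simp: I_def simp flip: fv)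
    qed
    then show ?thesis using fv by (auto simp: fun_eq_iff)
  qed
  have Z_dom: "f = 0 \<or> g = 0" if "f \<in> poly_funs Z" "g \<in> poly_funs Z" "f * g = 0" for f g
    using that unfolding Z_def by (rule fst_coords_domain)
  have "finite X" by (simp add: X_def)
  then obtain J where IJ: "I \<subseteq> J" and J: "generic_ideal X Z J"
    by (rule generic_ideal_exists[OF _ ZX Z_dom I_ideal I_inter])
  interpret generic_ideal X Z J by (rule J)
  obtain \<Delta>0 where \<Delta>0: "\<Delta>0 \<in> polys" "\<Delta>0 \<noteq> 0"
    and sec: "\<And>B. convex B \<Longrightarrow> \<forall>z\<in>B. \<Delta>0 z \<noteq> 0 \<Longrightarrow> \<exists>\<xi> :: complex ^ 'n \<Rightarrow> complex ^ 'm. continuous_on B \<xi> \<and>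
      (\<forall>z\<in>B. \<forall>g\<in>J. g \<in> poly_funs (fst_coords \<union> snd_coord ` UNIV) \<longrightarrow> g (z, \<xi> z) = 0)"
    using generic_ideal_section[OF J[unfolded X_def Z_def], of UNIV] by blast
  \<comment> \<open>Coordinates in \<open>J\<close> vanish along the section; every other one
    divides a base element \<open>h k\<close> modulo \<open>J\<close>, so it is nonzero wherever
    \<open>h k\<close> is.\<close>
  define K where "K = {k. snd_coord k \<notin> J}"
  have sX: "snd_coord k \<in> poly_funs X" for k by (rule poly_funs.coord) (auto simp: X_def)
  have "\<exists>w h. w \<in> poly_funs X \<and> h \<in> poly_funs Z \<and> h \<noteq> 0 \<and> snd_coord k * w - h \<in> J" if "k \<in> K" for k
  proof -
    have "snd_coord k \<notin> J" using that by (simp add: K_def)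
    from base_divides[OF ZX order_refl sX this] show ?thesis by metis
  qed
  then obtain w h where wh: "\<And>k. k \<in> K \<Longrightarrow> w k \<in> poly_funs X" "\<And>k. k \<in> K \<Longrightarrow> h k \<in> poly_funs Z"
      "\<And>k. k \<in> K \<Longrightarrow> h k \<noteq> 0" "\<And>k. k \<in> K \<Longrightarrow> snd_coord k * w k - h k \<in> J"
    by metis
  \<comment> \<open>On the section \<open>snd_coord i * w k\<close> is \<open>h k\<close> times the
    quotient of the coordinates \<open>i\<close> and \<open>k\<close>; this is the origin of the
    factors \<open>h0 k ^ l\<close> in the final coefficients.\<close>
  define rel where "rel = (\<lambda>i k d b. (\<forall>l. b l \<in> poly_funs Z) \<and> (\<exists>l\<le>d. b l \<noteq> 0) \<and>
    (\<Sum>l\<le>d. b l * (snd_coord i * w k) ^ l) \<in> J)"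
  have ex_rel: "\<exists>d b. rel i k d b" if k: "k \<in> K" for i k
  proof -
    have "snd_coord i * w k \<in> poly_funs X" by (intro poly_funs_mult sX wh k)
    then obtain d b where "\<And>l. b l \<in> poly_funs Z" "\<exists>l\<le>d. b l \<noteq> 0"
        "(\<Sum>l\<le>d. b l * (snd_coord i * w k) ^ l) \<in> J" by (rule algebraic) (rule that)
    then have "rel i k d b" unfolding rel_def by simp
    then show ?thesis by blast
  qed
  define d where "d = (\<lambda>i k. SOME d. \<exists>b. rel i k d b)"
  define b where "b = (\<lambda>i k. SOME b. rel i k (d i k) b)"
  have "rel i k (d i k) (b i k)" if "k \<in> K" for i k
    unfolding b_def using someI_ex[OF ex_rel[OF that, of i]] unfolding d_def by (rule someI_ex)
  then have b: "\<And>i k l. k \<in> K \<Longrightarrow> b i k l \<in> poly_funs Z" "\<And>i k. k \<in> K \<Longrightarrow> \<exists>l\<le>d i k. b i k l \<noteq> 0"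
      "\<And>i k. k \<in> K \<Longrightarrow> (\<Sum>l\<le>d i k. b i k l * (snd_coord i * w k) ^ l) \<in> J"
    by (simp_all add: rel_def)
  define h0 where "h0 = (\<lambda>k z. h k (z, 0))"
  define b0 where "b0 = (\<lambda>i k l z. b i k l (z, 0))"
  have h0: "h0 k \<in> polys" "h k v = h0 k (fst v)" "h0 k \<noteq> 0" if "k \<in> K" for k v
  proof -
    show "h0 k \<in> polys" using wh(2)[OF that] unfolding h0_def Z_def by (rule poly_funs_fst_restrict)
    show hv: "h k v = h0 k (fst v)" for v
      using wh(2)[OF that] poly_funs_fst_agree unfolding h0_def Z_def by blast
    show "h0 k \<noteq> 0" using wh(3)[OF that] hv by (auto simp: fun_eq_iff)
  qed
  have b0: "b0 i k l \<in> polys" "b i k l v = b0 i k l (fst v)" if "k \<in> K" for i k l v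
  proof -
    show "b0 i k l \<in> polys" using b(1)[OF that] unfolding b0_def Z_def by (rule poly_funs_fst_restrict)
    show "b i k l v = b0 i k l (fst v)"
      using b(1)[OF that] poly_funs_fst_agree unfolding b0_def Z_def by blast
  qed
  define \<Delta> where "\<Delta> = \<Delta>0 * (\<Prod>k\<in>K. h0 k)"
  have Ph: "(\<Prod>k\<in>K. h0 k) \<in> polys" "(\<Prod>k\<in>K. h0 k) \<noteq> 0"
    using polys_prod_nonzero[of K h0] h0 unfolding polys_def by (auto intro!: poly_funs_prod)
  show ?thesis
  proof (rule that[of \<Delta> K "\<lambda>i k l. b0 i k l * h0 k ^ l" d])
    show "\<Delta> \<in> polys" using \<Delta>0 Ph unfolding \<Delta>_def polys_def by (intro poly_funs_mult)
    show "\<Delta> \<noteq> 0" using \<Delta>0 Ph polys_no_zero_divisors unfolding \<Delta>_def by blast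
    have pw: "h0 k ^ l \<in> polys" if "k \<in> K" for k l
      using h0(1)[OF that] unfolding polys_def by (rule poly_funs_power)
    show "b0 i k l * h0 k ^ l \<in> polys" if "k \<in> K" for i k l
      using b0(1)[OF that] pw[OF that] unfolding polys_def by (intro poly_funs_mult)
    show "\<exists>l\<le>d i k. b0 i k l * h0 k ^ l \<noteq> 0" if k: "k \<in> K" for i k
    proof -
      obtain l where l: "l \<le> d i k" "b i k l \<noteq> 0" using b(2)[OF k] by blast
      have "b0 i k l \<noteq> 0" using l(2) b0(2)[OF k] by (auto simp: fun_eq_iff)
      moreover have "h0 k ^ l \<noteq> 0"
        using polys_prod_nonzero[of "{..<l}" "\<lambda>_. h0 k"] h0[OF k] by simp
      ultimately show ?thesis using polys_no_zero_divisors[OF b0(1)[OF k] pw[OF k]] l(1) by blast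
    qed
    fix B :: "(complex ^ 'n) set" assume B: "convex B" "\<forall>z\<in>B. \<Delta> z \<noteq> 0"
    then have B0: "\<forall>z\<in>B. \<Delta>0 z \<noteq> 0" by (auto simp: \<Delta>_def)
    have Bh: "h0 k z \<noteq> 0" if "z \<in> B" "k \<in> K" for z k
      using B(2) that by (auto simp: \<Delta>_def prod_fun_apply)
    obtain \<xi> :: "complex ^ 'n \<Rightarrow> complex ^ 'm" where \<xi>: "continuous_on B \<xi>"
      and van0: "\<forall>z\<in>B. \<forall>g\<in>J. g \<in> poly_funs (fst_coords \<union> snd_coord ` UNIV) \<longrightarrow> g (z, \<xi> z) = 0"
      using sec[OF B(1) B0] by blast
    have van: "g (z, \<xi> z) = 0" if "z \<in> B" "g \<in> J" for z g
      using van0 that J_in[OF that(2)] by (simp add: X_def)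
    show "\<exists>\<xi> :: complex ^ 'n \<Rightarrow> complex ^ 'm. continuous_on B \<xi> \<and>
      (\<forall>z\<in>B. \<xi> z \<noteq> 0 \<and> (z, proj_class (\<xi> z)) \<in> V \<and> (\<forall>k. \<xi> z $ k \<noteq> 0 \<longleftrightarrow> k \<in> K) \<and>
        (\<forall>i. \<forall>k\<in>K. (\<Sum>l\<le>d i k. (b0 i k l * h0 k ^ l) z * (\<xi> z $ i / \<xi> z $ k) ^ l) = 0))"
    proof (intro exI[of _ \<xi>] conjI ballI allI \<xi>)
      fix z assume z: "z \<in> B"
      \<comment> \<open>The section stays in the chart where coordinate \<open>j\<close> is 1, hence
        is nowhere zero.\<close>
      have "snd_coord j - 1 \<in> I"
        unfolding I_def using poly_funs_diff[OF sX poly_funs_1] by (auto simp: W_def)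
      with IJ have "(snd_coord j - 1) (z, \<xi> z) = 0" using van[OF z] by blast
      then show nz: "\<xi> z \<noteq> 0" using nzj[of "\<xi> z" j] by simp
      \<comment> \<open>A polynomial that separates the point from \<open>V\<close> vanishes on the
        chart \<open>W j\<close>, so it lies in \<open>I\<close> and must vanish on the
        section.\<close>
      show "(z, proj_class (\<xi> z)) \<in> V"
      proof (rule ccontr)
        assume "(z, proj_class (\<xi> z)) \<notin> V"
        from affine_proj_zariski_separate[OF V nz this] obtain f where
          f: "f \<in> polys2" "f (z, \<xi> z) \<noteq> 0" "\<And>z' x'. x' \<noteq> 0 \<Longrightarrow> (z', proj_class x') \<in> V \<Longrightarrow> f (z', x') = 0"
          by blast
        have "f \<in> I" unfolding I_def using f(1,3) nzj by (auto simp: X2 W_def)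
        with IJ van[OF z] f(2) show False by blast
      qed
      have kw: "\<xi> z $ k * w k (z, \<xi> z) = h0 k z" if "k \<in> K" for k
        using van[OF z wh(4)[OF that]] h0(2)[OF that] by simp
      have xk: "\<xi> z $ k \<noteq> 0" if "k \<in> K" for k using kw[OF that] Bh[OF z that] by auto
      show "\<xi> z $ k \<noteq> 0 \<longleftrightarrow> k \<in> K" for k
        using xk van[OF z, of "snd_coord k"] by (auto simp: K_def)
      fix i k assume k: "k \<in> K"
      have iw: "\<xi> z $ i * w k (z, \<xi> z) = h0 k z * (\<xi> z $ i / \<xi> z $ k)"
        using kw[OF k] xk[OF k] by (simp add: field_simps)
      have "(\<Sum>l\<le>d i k. (b0 i k l * h0 k ^ l) z * (\<xi> z $ i / \<xi> z $ k) ^ l)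
          = (\<Sum>l\<le>d i k. b i k l * (snd_coord i * w k) ^ l) (z, \<xi> z)"
        unfolding fun_ring_apply times_fun_apply b0(2)[OF k] by (simp add: iw power_mult_distrib power_divide mult.assoc fun_ring_apply)
      also have "\<dots> = 0" by (rule van[OF z b(3)[OF k]])
      finally show "(\<Sum>l\<le>d i k. (b0 i k l * h0 k ^ l) z * (\<xi> z $ i / \<xi> z $ k) ^ l) = 0" .
    qed
  qed
qed

section \<open>Behaviour of polynomials at infinity\<close>

text \<open>The coefficient of degree \<open>k\<close> of \<open>p z\<close> is the homogeneous part
  of \<open>f\<close> of degree \<open>k\<close>, taken at \<open>z\<close>.\<close>

lemma polys_ray:
  fixes f :: "complex ^ 'n::finite \<Rightarrow> complex"
  assumes "f \<in> polys"
  shows "\<exists>p N. (\<forall>z. degree (p z) \<le> N) \<and> (\<forall>z t. f (t *s z) = poly (p z) t) \<and> (\<forall>k. (\<lambda>z. coeff (p z) k) \<in> polys)"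
  using assms unfolding polys_def
proof induction
  case (const c)
  show ?case
    by (intro exI[of _ "\<lambda>_. [:c:]"] exI[of _ 0]) (auto simp: coeff_pCons intro: poly_funs.const)
next
  case (coord f)
  then obtain i where i: "f = (\<lambda>x. x $ i)" by blast
  have "(\<lambda>z. coeff [:0, z $ i:] k) \<in> poly_funs (range (\<lambda>i x. x $ i))" for k
  proof -
    have "(\<lambda>z. coeff [:0, z $ i:] k) = (if k = 1 then \<lambda>z. z $ i else cfun 0)"
      by (auto simp: fun_eq_iff coeff_pCons split: nat.split)
    then show ?thesis by (auto intro: poly_funs.const poly_funs.coord)
  qed
  then show ?case
    by (intro exI[of _ "\<lambda>z. [:0, z $ i:]"] exI[of _ 1]) (auto simp: i)
next
  case (add f g)
  then obtain p N q M where pq: "\<forall>z. degree (p z) \<le> N" "\<forall>z t. f (t *s z) = poly (p z) t"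
      "\<forall>k. (\<lambda>z. coeff (p z) k) \<in> poly_funs (range (\<lambda>i x. x $ i))"
      "\<forall>z. degree (q z) \<le> M" "\<forall>z t. g (t *s z) = poly (q z) t"
      "\<forall>k. (\<lambda>z. coeff (q z) k) \<in> poly_funs (range (\<lambda>i x. x $ i))" by blast
  have "degree (p z + q z) \<le> max N M" for z
    using pq(1,4) by (intro degree_add_le) (auto intro: max.coboundedI1 max.coboundedI2)
  with pq show ?case
    by (intro exI[of _ "\<lambda>z. p z + q z"] exI[of _ "max N M"]) (auto intro: poly_funs.add)
next
  case (mult f g)
  then obtain p N q M where pq: "\<forall>z. degree (p z) \<le> N" "\<forall>z t. f (t *s z) = poly (p z) t"
      "\<forall>k. (\<lambda>z. coeff (p z) k) \<in> poly_funs (range (\<lambda>i x. x $ i))"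
      "\<forall>z. degree (q z) \<le> M" "\<forall>z t. g (t *s z) = poly (q z) t"
      "\<forall>k. (\<lambda>z. coeff (q z) k) \<in> poly_funs (range (\<lambda>i x. x $ i))" by blast
  have "(\<lambda>z. coeff (p z * q z) k) \<in> poly_funs (range (\<lambda>i x. x $ i))" for k
  proof -
    have "(\<lambda>z. coeff (p z * q z) k) = (\<Sum>i\<le>k. (\<lambda>z. coeff (p z) i) * (\<lambda>z. coeff (q z) (k - i)))"
      by (simp add: fun_eq_iff coeff_mult sum_fun_apply)
    also have "\<dots> \<in> poly_funs (range (\<lambda>i x. x $ i))"
      using pq by (intro poly_funs_sum poly_funs_mult) auto
    finally show ?thesis .
  qed
  moreover have "degree (p z * q z) \<le> N + M" for z
    using degree_mult_le[of "p z" "q z"] pq(1,4) by (meson add_mono order_trans)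
  ultimately show ?case
    using pq(2,5) by (intro exI[of _ "\<lambda>z. p z * q z"] exI[of _ "N + M"]) auto
qed

text \<open>The exponent \<open>e\<close> is the largest degree that occurs, and \<open>top l\<close> is the homogeneous part of \<open>a l\<close>
  of degree \<open>e\<close>.\<close>

lemma polys_asymptotic:
  fixes a :: "nat \<Rightarrow> complex ^ 'n::finite \<Rightarrow> complex"
  assumes a: "\<And>l. a l \<in> polys" and nz: "\<exists>l\<le>d. a l \<noteq> 0"
  obtains e top where "\<And>l. top l \<in> polys" "\<exists>l\<le>d. top l \<noteq> 0"
    "\<And>u R \<epsilon>. \<epsilon> > 0 \<Longrightarrow> \<forall>\<^sub>F t in at_top. \<forall>z\<in>cball (t *\<^sub>R u) R. \<forall>l\<le>d.
       cmod (a l z / of_real t ^ e - top l u) < \<epsilon>"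
proof -
  obtain p N where p: "\<And>l z. degree (p l z) \<le> N l" "\<And>l z t. a l (t *s z) = poly (p l z) t"
      "\<And>l k. (\<lambda>z. coeff (p l z) k) \<in> polys"
    using polys_ray[OF a] by metis
  define S where "S = {k. \<exists>l\<le>d. \<exists>z. coeff (p l z) k \<noteq> 0}"
  have "S \<subseteq> (\<Union>l\<le>d. {..N l})"
    using p(1) by (fastforce simp: S_def intro: order_trans[OF le_degree])
  then have fin: "finite S" by (rule finite_subset) auto
  have "S \<noteq> {}"
  proof
    assume "S = {}"
    then have "a l z = 0" if "l \<le> d" for l z
      using that p(2)[of l 1 z] by (auto simp: S_def poly_altdef)
    with nz show False by (auto simp: fun_eq_iff)
  qed
  define e where "e = Max S"
  have e: "e \<in> S" unfolding e_def by (rule Max_in[OF fin \<open>S \<noteq> {}\<close>])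
  have above: "coeff (p l z) k = 0" if "l \<le> d" "k > e" for l z k
    using Max_ge[OF fin, of k] that by (auto simp: S_def e_def)
  define top where "top = (\<lambda>l z. coeff (p l z) e)"
  show ?thesis
  proof (rule that[of top e])
    show "top l \<in> polys" for l unfolding top_def by (rule p(3))
    show "\<exists>l\<le>d. top l \<noteq> 0" using e by (auto simp: S_def top_def fun_eq_iff)
    fix u :: "complex ^ 'n" and R \<epsilon> :: real assume \<epsilon>: "\<epsilon> > 0"
    have "\<forall>\<^sub>F t in at_top. \<forall>z\<in>cball (t *\<^sub>R u) R. cmod (a l z / of_real t ^ e - top l u) < \<epsilon>"
      if l: "l \<le> d" for l
    proof -
      \<comment> \<open>With \<open>s = 1 / t\<close> this is the value of \<open>a l\<close> at
        \<open>t\<close> times \<open>u + \<eta>\<close>, divided by \<open>t ^ e\<close>. In this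
        form it extends continuously to \<open>s = 0\<close>, where only the leading part is
        left.\<close>
      define G where "G = (\<lambda>(s :: real, \<eta>). \<Sum>k\<le>e. coeff (p l (u + \<eta>)) k * of_real s ^ (e - k))"
      have "continuous_on UNIV G"
        unfolding G_def case_prod_beta
        by (intro continuous_intros continuous_on_compose2[OF continuous_polys[OF p(3)]]) auto
      then have "isCont G (0, 0)" by (simp add: continuous_on_eq_continuous_at)
      then obtain \<delta> where \<delta>: "\<delta> > 0" "\<And>x. dist x (0, 0) < \<delta> \<Longrightarrow> dist (G x) (G (0, 0)) < \<epsilon>"
        using \<epsilon> by (auto simp: continuous_at_eps_delta)
      have "G (0, 0) = (\<Sum>k\<in>{e}. coeff (p l u) k * of_real 0 ^ (e - k))"
        unfolding G_def prod.case add_0_right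
        by (rule sum.mono_neutral_right) auto
      then have G0: "G (0, 0) = top l u" by (simp add: top_def)
      \<comment> \<open>The pair of \<open>1 / t\<close> and \<open>\<eta>\<close> has norm at most
        \<open>(1 + \<bar>R\<bar>) / t\<close>, as \<open>\<eta>\<close> is a vector of length at
        most \<open>\<bar>R\<bar>\<close> divided by \<open>t\<close>.\<close>
      have "\<forall>\<^sub>F t in at_top. t > max 0 ((1 + \<bar>R\<bar>) / \<delta>)" by (rule eventually_gt_at_top)
      then show ?thesis
      proof eventually_elim
        case (elim t)
        then have "t > 0" by simp
        with elim \<delta>(1) have t: "t > 0" "(1 + \<bar>R\<bar>) / t < \<delta>"
          by (simp_all add: pos_divide_less_eq mult.commute)
        show ?case
        proof
          fix z assume z: "z \<in> cball (t *\<^sub>R u) R"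
          define \<eta> where "\<eta> = (1 / t) *\<^sub>R (z - t *\<^sub>R u)"
          have zt: "z = of_real t *s (u + \<eta>)"
          proof -
            have "of_real t *s v = t *\<^sub>R v" for v :: "complex ^ 'n"
              unfolding vec_eq_iff vector_scaleR_component vector_smult_component
              by (simp add: scaleR_conv_of_real)
            then show ?thesis using t by (simp add: \<eta>_def scaleR_right_distrib)
          qed
          have "norm \<eta> = norm (z - t *\<^sub>R u) / t" using t by (simp add: \<eta>_def)
          also have "\<dots> \<le> \<bar>R\<bar> / t"
            using z t by (intro divide_right_mono) (auto simp: dist_norm norm_minus_commute)
          finally have "norm (1 / t, \<eta>) \<le> 1 / t + \<bar>R\<bar> / t"
            using norm_Pair_le[of "1 / t" \<eta>] t by simp
          also have "\<dots> < \<delta>" using t by (simp add: add_divide_distrib)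
          finally have "dist (G (1 / t, \<eta>)) (top l u) < \<epsilon>"
            using \<delta>(2)[of "(1 / t, \<eta>)"] G0 by (simp add: dist_norm zero_prod_def[symmetric])
          moreover have "a l z / of_real t ^ e = G (1 / t, \<eta>)"
          proof -
            have "a l z = (\<Sum>k\<le>degree (p l (u + \<eta>)). coeff (p l (u + \<eta>)) k * of_real t ^ k)"
              unfolding zt p(2) poly_altdef ..
            also have "\<dots> = (\<Sum>k\<le>e. coeff (p l (u + \<eta>)) k * of_real t ^ k)"
            proof (rule sum.mono_neutral_left)
              have "degree (p l (u + \<eta>)) \<le> e" by (rule degree_le) (use above[OF l] in blast)
              then show "{..degree (p l (u + \<eta>))} \<subseteq> {..e}" by simp
            qed (auto simp: coeff_eq_0)
            finally have "a l z / of_real t ^ e = (\<Sum>k\<le>e. coeff (p l (u + \<eta>)) k * (of_real t ^ k / of_real t ^ e))"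
              by (simp add: sum_divide_distrib)
            also have "\<dots> = G (1 / t, \<eta>)"
              unfolding G_def prod.case
            proof (rule sum.cong)
              fix k assume "k \<in> {..e}"
              then have "(of_real t :: complex) ^ e = of_real t ^ k * of_real t ^ (e - k)"
                by (simp flip: power_add)
              then show "coeff (p l (u + \<eta>)) k * (of_real t ^ k / of_real t ^ e) = coeff (p l (u + \<eta>)) k * of_real (1 / t) ^ (e - k)"
                using t by (simp add: power_divide)
            qed simp
            finally show ?thesis .
          qed
          ultimately show "cmod (a l z / of_real t ^ e - top l u) < \<epsilon>" by (simp add: dist_norm)
        qed
      qed
    qed
    then have "\<forall>\<^sub>F t in at_top. \<forall>l\<in>{..d}. \<forall>z\<in>cball (t *\<^sub>R u) R. cmod (a l z / of_real t ^ e - top l u) < \<epsilon>"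
      by (intro eventually_ball_finite) auto
    then show "\<forall>\<^sub>F t in at_top. \<forall>z\<in>cball (t *\<^sub>R u) R. \<forall>l\<le>d. cmod (a l z / of_real t ^ e - top l u) < \<epsilon>"
      by eventually_elim blast
  qed
qed

text \<open>Removing open discs about the roots from the disc of radius \<open>M\<close> leaves a
  compact set, on which the modulus of \<open>Q\<close> has a positive minimum unless the set is
  empty.\<close>

lemma near_root:
  fixes Q :: "complex poly"
  assumes "\<delta> > 0"
  obtains \<epsilon> where "\<epsilon> > 0" "\<And>y. cmod y \<le> M \<Longrightarrow> cmod (poly Q y) < \<epsilon> \<Longrightarrow> \<exists>r. poly Q r = 0 \<and> dist y r < \<delta>"
proof -
  define S where "S = cball 0 M - (\<Union>r\<in>{r. poly Q r = 0}. ball r \<delta>)"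
  have "compact S" unfolding S_def by (intro compact_diff) auto
  show ?thesis
  proof (cases "S = {}")
    case True
    show ?thesis
    proof (rule that[of 1])
      fix y assume "cmod y \<le> M"
      then have "y \<in> cball 0 M" by simp
      with True have "y \<in> (\<Union>r\<in>{r. poly Q r = 0}. ball r \<delta>)" unfolding S_def by blast
      then show "\<exists>r. poly Q r = 0 \<and> dist y r < \<delta>" by (auto simp: dist_commute)
    qed simp
  next
    case False
    have "continuous_on S (\<lambda>y. cmod (poly Q y))" by (intro continuous_intros)
    from continuous_attains_inf[OF \<open>compact S\<close> False this]
    obtain s where s: "s \<in> S" "\<And>y. y \<in> S \<Longrightarrow> cmod (poly Q s) \<le> cmod (poly Q y)" by blast
    show ?thesis
    proof (rule that[of "cmod (poly Q s)"])
      show "cmod (poly Q s) > 0" using s(1) assms by (auto simp: S_def)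
      fix y assume "cmod y \<le> M" "cmod (poly Q y) < cmod (poly Q s)"
      with s(2)[of y] have "y \<notin> S" "y \<in> cball 0 M" by auto
      then show "\<exists>r. poly Q r = 0 \<and> dist y r < \<delta>" by (auto simp: S_def dist_commute)
    qed
  qed
qed

text \<open>The value cannot cross the circle of radius \<open>\<delta>\<close> about the point
  \<open>r\<close> near which it starts: there its modulus is at most
  \<open>1 + 2 * \<delta>\<close>, so \<open>near\<close> applies and yields another point of
  \<open>F\<close> closer than \<open>2 * \<delta>\<close> to \<open>r\<close>. A bound at
  \<open>z0\<close> alone thus propagates to all of \<open>B\<close>.\<close>

lemma connected_near_finite:
  fixes y :: "'a::topological_space \<Rightarrow> complex"
  assumes B: "connected B" "z0 \<in> B" and y: "continuous_on B y" "cmod (y z0) \<le> 1"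
    and \<delta>: "\<delta> > 0" "\<delta> \<le> 1 / 2"
    and sep: "\<And>r r'. r \<in> F \<Longrightarrow> r' \<in> F \<Longrightarrow> r \<noteq> r' \<Longrightarrow> 2 * \<delta> \<le> dist r r'"
    and near: "\<And>z. z \<in> B \<Longrightarrow> cmod (y z) \<le> 2 \<Longrightarrow> \<exists>r\<in>F. dist (y z) r < \<delta>"
  obtains r where "r \<in> F" "\<And>z. z \<in> B \<Longrightarrow> dist (y z) r < \<delta>"
proof -
  obtain r where r: "r \<in> F" "dist (y z0) r < \<delta>" using near[OF B(2)] y(2) by force
  have no: "dist (y z) r \<noteq> \<delta>" if z: "z \<in> B" for z
  proof
    assume eq: "dist (y z) r = \<delta>"
    have "cmod (y z) \<le> dist (y z) r + dist (y z0) r + cmod (y z0)"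
      using norm_triangle_ineq[of "y z - r" "r - y z0"] norm_triangle_ineq[of "y z - y z0" "y z0"]
      by (simp add: dist_norm norm_minus_commute)
    with eq r(2) y(2) \<delta> have "cmod (y z) \<le> 2" by simp
    from near[OF z this] obtain r' where r': "r' \<in> F" "dist (y z) r' < \<delta>" by blast
    with eq have "r \<noteq> r'" by auto
    have "dist r r' \<le> dist (y z) r + dist (y z) r'" by (rule dist_triangle3)
    with sep[OF r(1) r'(1) \<open>r \<noteq> r'\<close>] eq r' show False by simp
  qed
  have "dist (y z) r < \<delta>" if z: "z \<in> B" for z
  proof (rule ccontr)
    assume "\<not> dist (y z) r < \<delta>"
    moreover have "connected ((\<lambda>z. dist (y z) r) ` B)"
      by (intro connected_continuous_image continuous_intros y B)
    ultimately have "\<delta> \<in> (\<lambda>z. dist (y z) r) ` B"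
      using connectedD_interval[of "(\<lambda>z. dist (y z) r) ` B" "dist (y z0) r" "dist (y z) r" \<delta>] B(2) z r(2)
      by auto
    with no show False by auto
  qed
  with r(1) show ?thesis by (rule that)
qed

text \<open>\<open>F\<close> is fixed before \<open>R\<close> and \<open>\<delta>\<close>, the
  centre \<open>c\<close> after them. The vectors in \<open>F\<close> are the possible limits along
  a ray: coordinate \<open>k\<close> is 1 and the others are roots of the equations formed by the
  leading forms.\<close>

lemma sections_near_finite_set:
  fixes V :: "((complex ^ 'n::finite) \<times> 'm::finite proj) set"
  assumes V: "closedin affine_proj_zariski V" and dim: "affine_dim (fst ` V) = enat CARD('n)"
  obtains F :: "('m \<times> (complex ^ 'm)) set" where "finite F" "\<And>k f. (k, f) \<in> F \<Longrightarrow> f $ k = 1"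
    "\<And>R \<delta>. R > 0 \<Longrightarrow> \<delta> > 0 \<Longrightarrow> \<exists>c \<xi> k f. (k, f) \<in> F \<and> continuous_on (cball c R) \<xi> \<and>
       (\<forall>z\<in>cball c R. \<xi> z \<noteq> 0 \<and> (z, proj_class (\<xi> z)) \<in> V \<and> \<xi> z $ k = 1 \<and>
          (\<forall>i. dist (\<xi> z $ i) (f $ i) < \<delta>))"
proof -
  obtain \<Delta> K d a where \<Delta>: "\<Delta> \<in> polys" "\<Delta> \<noteq> 0"
    and a: "\<And>i k l. k \<in> K \<Longrightarrow> a i k l \<in> polys" "\<And>i k. k \<in> K \<Longrightarrow> \<exists>l\<le>d i k. a i k l \<noteq> 0"
    and sec: "\<And>B. convex B \<Longrightarrow> \<forall>z\<in>B. \<Delta> z \<noteq> 0 \<Longrightarrow> \<exists>\<xi> :: complex ^ 'n \<Rightarrow> complex ^ 'm. continuous_on B \<xi> \<and>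
      (\<forall>z\<in>B. \<xi> z \<noteq> 0 \<and> (z, proj_class (\<xi> z)) \<in> V \<and> (\<forall>k. \<xi> z $ k \<noteq> 0 \<longleftrightarrow> k \<in> K) \<and>
        (\<forall>i. \<forall>k\<in>K. (\<Sum>l\<le>d i k. a i k l z * (\<xi> z $ i / \<xi> z $ k) ^ l) = 0))"
    by (rule variety_section[OF V dim]) (rule that; assumption)
  define asy where "asy = (\<lambda>(a :: nat \<Rightarrow> complex ^ 'n \<Rightarrow> complex) d e top. (\<forall>l. top l \<in> polys) \<and> (\<exists>l\<le>d. top l \<noteq> 0) \<and>
    (\<forall>u R \<epsilon>. \<epsilon> > 0 \<longrightarrow> (\<forall>\<^sub>F t in at_top. \<forall>z\<in>cball (t *\<^sub>R u) R. \<forall>l\<le>d.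
       cmod (a l z / of_real t ^ e - top l u) < \<epsilon>)))"
  have asy_ex: "\<exists>e top. asy a d e top" if al: "\<And>l. a l \<in> polys" "\<exists>l\<le>d. a l \<noteq> 0" for a d
  proof -
    obtain e top where "\<And>l. top l \<in> polys" "\<exists>l\<le>d. top l \<noteq> 0"
      "\<And>u R \<epsilon>. \<epsilon> > 0 \<Longrightarrow> \<forall>\<^sub>F t in at_top. \<forall>z\<in>cball (t *\<^sub>R u) R. \<forall>l\<le>d.
         cmod (a l z / of_real t ^ e - top l u) < \<epsilon>"
      by (rule polys_asymptotic[OF al]) (rule that)
    then have "asy a d e top" unfolding asy_def by simp
    then show ?thesis by blast
  qed
  \<comment> \<open>A single polynomial as a family with the only index 0, hence
    \<open>d = 0\<close>.\<close>
  obtain e0 top0 where asy0: "asy (\<lambda>_. \<Delta>) 0 e0 top0" using asy_ex[of "\<lambda>_. \<Delta>" 0] \<Delta> by blast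
  define e where "e = (\<lambda>i k. SOME e. \<exists>top. asy (a i k) (d i k) e top)"
  define top where "top = (\<lambda>i k. SOME top. asy (a i k) (d i k) (e i k) top)"
  have asy: "asy (a i k) (d i k) (e i k) (top i k)" if "k \<in> K" for i k
    unfolding top_def using someI_ex[OF asy_ex[OF a[OF that], of i]] unfolding e_def by (rule someI_ex)
  define l0 where "l0 = (\<lambda>i k. SOME l. l \<le> d i k \<and> top i k l \<noteq> 0)"
  have l0: "l0 i k \<le> d i k" "top i k (l0 i k) \<noteq> 0" "top i k l \<in> polys" if "k \<in> K" for i k l
  proof -
    have "\<exists>l. l \<le> d i k \<and> top i k l \<noteq> 0" using asy[OF that, of i] by (auto simp: asy_def)
    from someI_ex[OF this] show "l0 i k \<le> d i k" "top i k (l0 i k) \<noteq> 0" by (auto simp: l0_def)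
    show "top i k l \<in> polys" using asy[OF that, of i] by (auto simp: asy_def)
  qed
  \<comment> \<open>Where \<open>H\<close> is nonzero, the leading form of \<open>\<Delta>\<close>
    does not vanish and no limit equation degenerates to the zero polynomial.\<close>
  define H where "H = top0 0 * (\<Prod>(i, k)\<in>UNIV \<times> K. top i k (l0 i k))"
  have t0: "top0 0 \<in> polys" "top0 0 \<noteq> 0" using asy0 by (auto simp: asy_def)
  have prd: "(\<Prod>(i, k)\<in>UNIV \<times> K. top i k (l0 i k)) \<noteq> 0" "(\<Prod>(i, k)\<in>UNIV \<times> K. top i k (l0 i k)) \<in> polys"
  proof -
    show "(\<Prod>(i, k)\<in>UNIV \<times> K. top i k (l0 i k)) \<noteq> 0"
      by (rule polys_prod_nonzero) (use l0 in \<open>auto split: prod.splits\<close>)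
    show "(\<Prod>(i, k)\<in>UNIV \<times> K. top i k (l0 i k)) \<in> polys"
      unfolding polys_def by (rule poly_funs_prod) (use l0 in \<open>auto simp: polys_def split: prod.splits\<close>)
  qed
  have "H \<noteq> 0" unfolding H_def using polys_no_zero_divisors[OF t0(1) prd(2)] t0 prd by blast
  then obtain u where u: "H u \<noteq> 0" by (auto simp: fun_eq_iff)
  then have u0: "top0 0 u \<noteq> 0" by (auto simp: H_def)
  have u1: "top i k (l0 i k) u \<noteq> 0" if "k \<in> K" for i k
    using u that by (auto simp: H_def prod_fun_apply)
  define Q where "Q = (\<lambda>i k. \<Sum>l\<le>d i k. monom (top i k l u) l)"
  have Qc: "coeff (Q i k) l = (if l \<le> d i k then top i k l u else 0)" for i k l
    by (simp add: Q_def coeff_sum)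
  have Qp: "poly (Q i k) y = (\<Sum>l\<le>d i k. top i k l u * y ^ l)" for i k y
    by (simp add: Q_def poly_sum poly_monom)
  have Q0: "Q i k \<noteq> 0" if "k \<in> K" for i k
    using Qc[of i k "l0 i k"] l0[OF that] u1[OF that, of i] by auto
  define roots where "roots = (\<lambda>i k. {r. poly (Q i k) r = 0})"
  have fr: "finite (roots i k)" if "k \<in> K" for i k
    unfolding roots_def by (rule poly_roots_finite[OF Q0[OF that]])
  define F where "F = (\<Union>k\<in>K. (\<lambda>g. (k, \<chi> i. g i)) ` (\<Pi>\<^sub>E i\<in>UNIV. if i = k then {1} else roots i k))"
  have finF: "finite F" unfolding F_def by (intro finite_UN_I finite_imageI finite_PiE) (auto simp: fr)
  show ?thesis
  proof (rule that[OF finF])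
    show "f $ k = 1" if "(k, f) \<in> F" for k f
      using that by (auto simp: F_def PiE_iff split: if_splits)
    fix R \<delta> :: real assume R: "R > 0" and \<delta>: "\<delta> > 0"
    have "finite (\<Union>i. \<Union>k\<in>K. roots i k)" using fr by auto
    then obtain s where s: "s > 0" "\<And>r r'. r \<in> (\<Union>i. \<Union>k\<in>K. roots i k) \<Longrightarrow> r' \<in> (\<Union>i. \<Union>k\<in>K. roots i k) \<Longrightarrow>
        r \<noteq> r' \<Longrightarrow> s \<le> dist r r'" by (rule finite_separated) blast
    \<comment> \<open>The bounds \<open>1 / 2\<close> and \<open>s / 2\<close> are those that
      \<open>connected_near_finite\<close> asks for; \<open>s\<close> separates the roots for all
      pairs at once, since \<open>k\<close> is chosen later.\<close>
    define \<delta>' where "\<delta>' = min (min \<delta> (1 / 2)) (s / 2)"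
    have \<delta>': "\<delta>' > 0" "\<delta>' \<le> 1 / 2" "\<delta>' \<le> \<delta>" "2 * \<delta>' \<le> s" using \<delta> s(1) by (auto simp: \<delta>'_def)
    have "\<exists>\<epsilon>>0. \<forall>y. cmod y \<le> 2 \<longrightarrow> cmod (poly (Q i k) y) < \<epsilon> \<longrightarrow> (\<exists>r\<in>roots i k. dist y r < \<delta>')" for i k
    proof -
      obtain \<epsilon> where "\<epsilon> > 0" "\<And>y. cmod y \<le> 2 \<Longrightarrow> cmod (poly (Q i k) y) < \<epsilon> \<Longrightarrow>
          \<exists>r. poly (Q i k) r = 0 \<and> dist y r < \<delta>'"
        using near_root[OF \<delta>'(1), where Q = "Q i k" and M = 2] by blast
      then show ?thesis unfolding roots_def by (intro exI[of _ \<epsilon>]) auto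
    qed
    then obtain \<epsilon> where \<epsilon>: "\<And>i k. \<epsilon> i k > 0"
        "\<And>i k y. cmod y \<le> 2 \<Longrightarrow> cmod (poly (Q i k) y) < \<epsilon> i k \<Longrightarrow> \<exists>r\<in>roots i k. dist y r < \<delta>'" by metis
    \<comment> \<open>A quotient of modulus at most 2 multiplies the error of coefficient
      \<open>l\<close> by at most \<open>2 ^ l\<close>, so these shares add up to
      \<open>\<epsilon> i k\<close>.\<close>
    define \<epsilon>' where "\<epsilon>' = (\<lambda>i k. \<epsilon> i k / (\<Sum>l\<le>d i k. 2 ^ l))"
    have sum_pos: "(\<Sum>l\<le>d i k. 2 ^ l :: real) > 0" for i k by (intro sum_pos) auto
    have \<epsilon>': "\<epsilon>' i k > 0" for i k using \<epsilon>(1) sum_pos by (simp add: \<epsilon>'_def)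
    have "\<forall>\<^sub>F t in at_top. \<forall>z\<in>cball (t *\<^sub>R u) R. \<forall>l\<le>0. cmod (\<Delta> z / of_real t ^ e0 - top0 l u) < cmod (top0 0 u)"
      using asy0 u0 unfolding asy_def by simp
    moreover have "\<forall>\<^sub>F t in at_top. \<forall>(i, k)\<in>UNIV \<times> K. \<forall>z\<in>cball (t *\<^sub>R u) R. \<forall>l\<le>d i k.
       cmod (a i k l z / of_real t ^ e i k - top i k l u) < \<epsilon>' i k"
    proof (rule eventually_ball_finite)
      show "\<forall>p\<in>UNIV \<times> K. \<forall>\<^sub>F t in at_top. case p of (i, k) \<Rightarrow> \<forall>z\<in>cball (t *\<^sub>R u) R. \<forall>l\<le>d i k.
         cmod (a i k l z / of_real t ^ e i k - top i k l u) < \<epsilon>' i k"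
        using asy \<epsilon>' unfolding asy_def by auto
    qed auto
    moreover have "\<forall>\<^sub>F t :: real in at_top. t > 0" by (rule eventually_gt_at_top)
    ultimately have "\<forall>\<^sub>F t in at_top. t > 0 \<and>
        (\<forall>z\<in>cball (t *\<^sub>R u) R. \<forall>l\<le>0. cmod (\<Delta> z / of_real t ^ e0 - top0 l u) < cmod (top0 0 u)) \<and>
        (\<forall>(i, k)\<in>UNIV \<times> K. \<forall>z\<in>cball (t *\<^sub>R u) R. \<forall>l\<le>d i k.
          cmod (a i k l z / of_real t ^ e i k - top i k l u) < \<epsilon>' i k)"
      by eventually_elim simp
    from eventually_happens'[OF trivial_limit_at_top_linorder this] obtain t :: real where tt: "t > 0"
        "\<forall>z\<in>cball (t *\<^sub>R u) R. \<forall>l\<le>0. cmod (\<Delta> z / of_real t ^ e0 - top0 l u) < cmod (top0 0 u)"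
        "\<forall>(i, k)\<in>UNIV \<times> K. \<forall>z\<in>cball (t *\<^sub>R u) R. \<forall>l\<le>d i k.
          cmod (a i k l z / of_real t ^ e i k - top i k l u) < \<epsilon>' i k" by blast
    have t: "cmod (\<Delta> z / of_real t ^ e0 - top0 0 u) < cmod (top0 0 u)"
        "k \<in> K \<Longrightarrow> l \<le> d i k \<Longrightarrow> cmod (a i k l z / of_real t ^ e i k - top i k l u) < \<epsilon>' i k"
      if "z \<in> cball (t *\<^sub>R u) R" for z i k l
      using tt(2,3) that by auto
    define c where "c = t *\<^sub>R u"
    let ?B = "cball c R"
    \<comment> \<open>A number closer to \<open>top0 0 u\<close> than the modulus of
      \<open>top0 0 u\<close> is not zero.\<close>
    have "\<Delta> z \<noteq> 0" if "z \<in> ?B" for z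
      using t(1)[of z] that by (auto simp: c_def)
    then obtain \<xi> :: "complex ^ 'n \<Rightarrow> complex ^ 'm" where \<xi>: "continuous_on ?B \<xi>"
      and x: "\<And>z. z \<in> ?B \<Longrightarrow> \<xi> z \<noteq> 0" "\<And>z. z \<in> ?B \<Longrightarrow> (z, proj_class (\<xi> z)) \<in> V"
        "\<And>z k. z \<in> ?B \<Longrightarrow> \<xi> z $ k \<noteq> 0 \<longleftrightarrow> k \<in> K"
        "\<And>z i k. z \<in> ?B \<Longrightarrow> k \<in> K \<Longrightarrow> (\<Sum>l\<le>d i k. a i k l z * (\<xi> z $ i / \<xi> z $ k) ^ l) = 0"
      using sec[of ?B] by auto
    have cB: "c \<in> ?B" using R by simp
    \<comment> \<open>Division by the largest coordinate at the centre puts all quotients there into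
      the unit disc, the starting condition of the connectedness argument.\<close>
    obtain k where k: "\<And>i. cmod (\<xi> c $ i) \<le> cmod (\<xi> c $ k)"
    proof -
      have "Max (range (\<lambda>i. cmod (\<xi> c $ i))) \<in> range (\<lambda>i. cmod (\<xi> c $ i))" by (rule Max_in) auto
      then obtain k where "Max (range (\<lambda>i. cmod (\<xi> c $ i))) = cmod (\<xi> c $ k)" by (rule rangeE)
      then have "cmod (\<xi> c $ i) \<le> cmod (\<xi> c $ k)" for i
        by (metis Max_ge finite finite_imageI rangeI)
      then show ?thesis by (rule that)
    qed
    have "\<xi> c $ k \<noteq> 0"
    proof
      assume "\<xi> c $ k = 0"
      then have "\<xi> c = 0" using k by (auto simp: vec_eq_iff)
      with x(1)[OF cB] show False by simp
    qed
    then have kK: "k \<in> K" using x(3)[OF cB] by blast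
    define y where "y = (\<lambda>z. \<chi> i. \<xi> z $ i / \<xi> z $ k)"
    have xk: "\<xi> z $ k \<noteq> 0" if "z \<in> ?B" for z using x(3)[OF that] kK by blast
    have cy: "continuous_on ?B (\<lambda>z. y z $ i)" for i
      unfolding y_def using xk by (auto intro!: continuous_intros \<xi>)
    have "\<exists>r. r \<in> roots i k \<and> (\<forall>z\<in>?B. dist (y z $ i) r < \<delta>')" for i
    proof -
      have near: "\<exists>r\<in>roots i k. dist (y z $ i) r < \<delta>'" if z: "z \<in> ?B" and y2: "cmod (y z $ i) \<le> 2" for z
      proof (rule \<epsilon>(2)[OF y2])
        let ?y = "y z $ i" and ?t = "of_real t ^ e i k :: complex"
        \<comment> \<open>The exact equation, whose value is zero, is subtracted so that only errors
          of coefficients remain.\<close>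
        have "poly (Q i k) ?y = (\<Sum>l\<le>d i k. top i k l u * ?y ^ l) - (\<Sum>l\<le>d i k. a i k l z * ?y ^ l) / ?t"
          using x(4)[OF z kK, of i] by (simp add: Qp y_def)
        also have "\<dots> = (\<Sum>l\<le>d i k. (top i k l u - a i k l z / ?t) * ?y ^ l)"
          by (simp add: sum_divide_distrib left_diff_distrib sum_subtractf)
        finally have "cmod (poly (Q i k) ?y) \<le> (\<Sum>l\<le>d i k. cmod ((top i k l u - a i k l z / ?t) * ?y ^ l))"
          by (simp add: norm_sum)
        also have "\<dots> < (\<Sum>l\<le>d i k. \<epsilon>' i k * 2 ^ l)"
        proof (rule sum_strict_mono)
          fix l assume l: "l \<in> {..d i k}"
          have 1: "cmod (top i k l u - a i k l z / ?t) < \<epsilon>' i k"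
            using t(2)[of z k l i] z l kK by (simp add: c_def norm_minus_commute)
          have 2: "cmod (?y ^ l) \<le> 2 ^ l" using y2 by (simp add: norm_power power_mono)
          have "cmod (top i k l u - a i k l z / ?t) * cmod (?y ^ l) \<le> cmod (top i k l u - a i k l z / ?t) * 2 ^ l"
            by (intro mult_left_mono 2) auto
          also have "\<dots> < \<epsilon>' i k * 2 ^ l" using 1 by simp
          finally show "cmod ((top i k l u - a i k l z / ?t) * ?y ^ l) < \<epsilon>' i k * 2 ^ l"
            by (simp add: norm_mult)
        qed auto
        also have "\<dots> = \<epsilon> i k"
          unfolding \<epsilon>'_def sum_distrib_left[symmetric] using sum_pos[of i k] by simp
        finally show "cmod (poly (Q i k) ?y) < \<epsilon> i k" .
      qed
      have y1: "cmod (y c $ i) \<le> 1"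
        using k[of i] xk[OF cB] by (simp add: y_def norm_divide divide_le_eq_1)
      obtain r where "r \<in> roots i k" "\<And>z. z \<in> ?B \<Longrightarrow> dist (y z $ i) r < \<delta>'"
      proof (rule connected_near_finite[OF _ cB cy y1 \<delta>'(1,2), of "roots i k"])
        show "2 * \<delta>' \<le> dist r r'" if "r \<in> roots i k" "r' \<in> roots i k" "r \<noteq> r'" for r r'
          using s(2)[of r r'] that kK \<delta>'(4) by fastforce
      qed (use near in auto)
      then show ?thesis by blast
    qed
    then obtain g where g: "\<And>i. g i \<in> roots i k" "\<And>i z. z \<in> ?B \<Longrightarrow> dist (y z $ i) (g i) < \<delta>'" by metis
    define f where "f = (\<chi> i. if i = k then 1 else g i)"
    have "(\<lambda>i. if i = k then 1 else g i) \<in> (\<Pi>\<^sub>E i\<in>UNIV. if i = k then {1} else roots i k)"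
      using g(1) by auto
    then have "(k, f) \<in> F" unfolding F_def f_def using kK by blast
    moreover have "continuous_on ?B y"
      unfolding y_def by (rule continuous_on_vec_lambda) (use cy in \<open>simp add: y_def\<close>)
    moreover have "y z \<noteq> 0 \<and> (z, proj_class (y z)) \<in> V \<and> y z $ k = 1 \<and> (\<forall>i. dist (y z $ i) (f $ i) < \<delta>)"
      if z: "z \<in> ?B" for z
    proof (intro conjI allI)
      show yk: "y z $ k = 1" using xk[OF z] by (simp add: y_def)
      then show y0: "y z \<noteq> 0" by auto
      have "y z = (1 / \<xi> z $ k) *s \<xi> z" by (simp add: y_def vec_eq_iff)
      then have "proj_class (\<xi> z) = proj_class (y z)"
        using proj_class_eq_iff[OF x(1)[OF z] y0] by blast
      with x(2)[OF z] show "(z, proj_class (y z)) \<in> V" by simp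
      show "dist (y z $ i) (f $ i) < \<delta>" for i
        using yk \<delta> g(2)[OF z, of i] \<delta>'(3) by (cases "i = k") (auto simp: f_def)
    qed
    ultimately show "\<exists>c \<xi> k f. (k, f) \<in> F \<and> continuous_on (cball c R) \<xi> \<and>
       (\<forall>z\<in>cball c R. \<xi> z \<noteq> 0 \<and> (z, proj_class (\<xi> z)) \<in> V \<and> \<xi> z $ k = 1 \<and>
          (\<forall>i. dist (\<xi> z $ i) (f $ i) < \<delta>))" by blast
  qed
qed

section \<open>Lattices and the exponential map\<close>

text \<open>The functionals \<open>g b\<close> dual to the basis are bounded and integer valued on
  the lattice, and at a nonzero lattice vector one of them has modulus at least 1.\<close>

lemma lattice_separated:
  fixes L :: "'a::euclidean_space set"
  assumes "lattice_of_rank r L"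
  obtains s where "s > 0" "\<And>v. v \<in> L \<Longrightarrow> v \<noteq> 0 \<Longrightarrow> s \<le> norm v"
proof -
  obtain B where B: "finite B" "independent B" and L: "L = {\<Sum>b\<in>B. of_int (k b) *\<^sub>R b |k. True}"
    using assms unfolding lattice_of_rank_def by blast
  have "\<exists>g K. linear g \<and> (\<forall>x\<in>B. g x = (if x = b then 1 else 0 :: real)) \<and> K > 0 \<and> (\<forall>x. norm (g x) \<le> K * norm x)" for b
  proof -
    obtain g where g: "linear g" "\<forall>x\<in>B. g x = (if x = b then 1 else 0 :: real)"
      using linear_independent_extend[OF B(2), of "\<lambda>x. if x = b then 1 else 0"] by blast
    obtain K where "K > 0" "\<And>x. norm (g x) \<le> K * norm x" using linear_bounded_pos[OF g(1)] by blast
    with g show ?thesis by (intro exI[of _ g] exI[of _ K] conjI allI)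
  qed
  then obtain g K where g: "\<And>b. linear (g b)" "\<And>b x. x \<in> B \<Longrightarrow> g b x = (if x = b then 1 else 0 :: real)"
      "\<And>b. K b > 0" "\<And>b x. norm (g b x) \<le> K b * norm x" by metis
  \<comment> \<open>The summand 1 keeps \<open>M\<close> positive even if \<open>B\<close> is
    empty.\<close>
  define M where "M = 1 + (\<Sum>b\<in>B. K b)"
  have M: "M > 0" unfolding M_def using g(3) by (simp add: add_pos_nonneg sum_nonneg less_imp_le)
  show ?thesis
  proof (rule that[of "1 / M"])
    show "1 / M > 0" using M by simp
    fix v assume "v \<in> L" "v \<noteq> 0"
    then obtain k where v: "v = (\<Sum>b\<in>B. of_int (k b) *\<^sub>R b)" using L by blast
    with \<open>v \<noteq> 0\<close> obtain b where b: "b \<in> B" "k b \<noteq> 0" by (metis (no_types, lifting) of_int_0 scaleR_zero_left sum.neutral)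
    have "g b v = (\<Sum>x\<in>B. of_int (k x) * g b x)"
      unfolding v by (simp add: linear_sum[OF g(1)] linear_scale[OF g(1)])
    also have "\<dots> = (\<Sum>x\<in>B. if x = b then of_int (k b) else 0)"
      by (rule sum.cong) (auto simp: g(2))
    also have "\<dots> = of_int (k b)" using B(1) b(1) by simp
    finally have "1 \<le> norm (g b v)" using b(2) by simp
    also have "\<dots> \<le> K b * norm v" by (rule g(4))
    also have "K b \<le> M" unfolding M_def
      using member_le_sum[of b B K] b(1) B(1) g(3) by (simp add: less_imp_le)
    finally have "1 \<le> M * norm v" by (simp add: mult_right_mono)
    then show "1 / M \<le> norm v" using M by (simp add: field_simps)
  qed
qed

text \<open>Full rank gives every vector coordinates in the basis; rounding them down leaves
  fractional parts, so the remainder is bounded by the sum of the norms of the basis.\<close>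

lemma lattice_covering_radius:
  fixes L :: "'a::euclidean_space set"
  assumes "lattice_of_rank DIM('a) L"
  obtains \<rho> where "\<rho> \<ge> 0" "\<And>v. \<exists>l\<in>L. norm (v - l) \<le> \<rho>"
proof -
  obtain B where B: "finite B" "independent B" "card B = DIM('a)"
    and L: "L = {\<Sum>b\<in>B. of_int (k b) *\<^sub>R b |k. True}"
    using assms unfolding lattice_of_rank_def by blast
  have "UNIV \<subseteq> span B" by (rule card_ge_dim_independent) (use B in auto)
  then have span: "v \<in> range (\<lambda>u. \<Sum>b\<in>B. u b *\<^sub>R b)" for v using span_finite[OF B(1)] by auto
  show ?thesis
  proof (rule that[of "\<Sum>b\<in>B. norm b"])
    fix v
    obtain u where u: "v = (\<Sum>b\<in>B. u b *\<^sub>R b)" using span[of v] by blast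
    define l where "l = (\<Sum>b\<in>B. of_int \<lfloor>u b\<rfloor> *\<^sub>R b)"
    have "v - l = (\<Sum>b\<in>B. frac (u b) *\<^sub>R b)"
      by (simp add: u l_def frac_def scaleR_left_diff_distrib sum_subtractf)
    also have "norm \<dots> \<le> (\<Sum>b\<in>B. norm b)"
      by (rule sum_norm_le) (auto simp: frac_ge_0 intro!: mult_left_le_one_le less_imp_le[OF frac_lt_1])
    finally show "\<exists>l\<in>L. norm (v - l) \<le> (\<Sum>b\<in>B. norm b)" using L by (auto simp: l_def)
  qed (auto intro: sum_nonneg)
qed

text \<open>The graph of \<open>e\<close> is closed. Convergence in projective space is expressed by
  representatives with coordinate \<open>k\<close> equal to 1, and that coordinate also determines
  the scalar between lift and representative.\<close>

lemma holomorphic_to_proj_limit: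
  fixes e :: "complex ^ 'n::finite \<Rightarrow> 'm::finite proj"
  assumes e: "holomorphic_to_proj e"
    and y: "y \<longlonglongrightarrow> f" "\<And>j. y j $ k = 1" and w: "w \<longlonglongrightarrow> a"
    and eq: "\<And>j. e (w j) = proj_class (y j)"
  shows "e a = proj_class f"
proof -
  obtain U h where U: "a \<in> U" "holomorphic_lift e U h"
    using e unfolding holomorphic_to_proj_def by blast
  then have h: "open U" "\<And>z. z \<in> U \<Longrightarrow> h z \<noteq> 0" "\<And>z. z \<in> U \<Longrightarrow> e z = proj_class (h z)"
    and "\<exists>D. (h has_derivative D) (at a)"
    unfolding holomorphic_lift_def by blast+
  then have "isCont h a" using has_derivative_continuous by blast
  then have hw: "(\<lambda>j. h (w j)) \<longlonglongrightarrow> h a" using w by (rule isCont_tendsto_compose)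
  have y0: "y j \<noteq> 0" for j using y(2)[of j] by auto
  have "\<forall>\<^sub>F j in sequentially. w j \<in> U" using topological_tendstoD[OF w h(1) U(1)] .
  then have ev: "\<forall>\<^sub>F j in sequentially. h (w j) = (h (w j) $ k) *s y j"
  proof eventually_elim
    case (elim j)
    then have "proj_class (y j) = proj_class (h (w j))" using h(3) eq by metis
    then obtain c where c: "h (w j) = c *s y j" using proj_class_eq_iff[OF y0 h(2)[OF elim]] by blast
    then have "h (w j) $ k = c" using y(2) by simp
    with c show ?case by simp
  qed
  have "(\<lambda>j. (h (w j) $ k) *s y j) \<longlonglongrightarrow> (h a $ k) *s f"
    by (rule vec_tendstoI) (auto intro!: tendsto_intros y hw)
  moreover have "(\<lambda>j. (h (w j) $ k) *s y j) \<longlonglongrightarrow> h a"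
    using hw tendsto_cong[OF ev] by blast
  ultimately have "h a = (h a $ k) *s f" using LIMSEQ_unique by blast
  moreover have "f $ k = 1"
    using LIMSEQ_unique[OF tendsto_vec_nth[OF y(1), of k]] y(2) by simp
  then have "f \<noteq> 0" by auto
  ultimately have "proj_class f = proj_class (h a)"
    using proj_class_eq_iff[OF _ h(2)[OF U(1)]] by blast
  with h(3)[OF U(1)] show ?thesis by simp
qed

section \<open>Uniform inversion of the exponential map, and the fixed point\<close>

locale exp_covering =
  fixes A :: "'m::finite proj monoid" and e :: "complex ^ 'n::finite \<Rightarrow> 'm proj"
  assumes grp: "group A" and e_in: "\<And>z. e z \<in> carrier A" and e_add: "\<And>z w. e (z + w) = e z \<otimes>\<^bsub>A\<^esub> e w"
    and hol: "holomorphic_to_proj e" and surj: "range e = carrier A"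
    and lat: "lattice_of_rank (2 * CARD('n)) {z. e z = \<one>\<^bsub>A\<^esub>}"
begin

definition "kern = {z. e z = \<one>\<^bsub>A\<^esub>}"

lemma e_add_kern: "l \<in> kern \<Longrightarrow> e (z + l) = e z"
  using grp e_in by (simp add: kern_def e_add group.is_monoid monoid.r_one)

lemma e_eqD: assumes "e z = e w" shows "z - w \<in> kern"
proof -
  have "e w \<otimes>\<^bsub>A\<^esub> e (z - w) = e w" using e_add[of w "z - w"] assms by simp
  then show ?thesis
    using group.l_cancel_one[OF grp e_in e_in] by (simp add: kern_def)
qed

lemma kern_uminus: assumes "l \<in> kern" shows "- l \<in> kern"
proof -
  have "e (- l + l) = e (- l)" by (rule e_add_kern[OF assms])
  moreover have "e 0 = \<one>\<^bsub>A\<^esub>" using e_eqD[of 0 0] by (simp add: kern_def)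
  ultimately show ?thesis by (simp add: kern_def)
qed

lemma kern_lattice: "lattice_of_rank DIM(complex ^ 'n) kern"
  using lat by (simp add: kern_def mult.commute)

text \<open>Kernel translations bring preimages into the closed ball of radius
  \<open>\<rho>\<close>, so a subsequence converges; this stands in for the compactness of
  \<open>A\<close>.\<close>

lemma chart_limit:
  assumes y: "y \<longlonglongrightarrow> f" "\<And>j. y j $ k = 1" "\<And>j. proj_class (y j) \<in> carrier A"
  obtains r w a where "strict_mono r" "\<And>j. e (w j) = proj_class (y j)" "(w \<circ> r) \<longlonglongrightarrow> a" "e a = proj_class f"
proof -
  obtain \<rho> where \<rho>: "\<And>v. \<exists>l\<in>kern. norm (v - l) \<le> \<rho>"
    using lattice_covering_radius[OF kern_lattice] by blast
  have "\<exists>v\<in>cball 0 \<rho>. e v = proj_class (y j)" for j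
  proof -
    obtain v where v: "e v = proj_class (y j)" using y(3)[of j] surj by (metis rangeE)
    obtain l where l: "l \<in> kern" "norm (v - l) \<le> \<rho>" using \<rho> by blast
    from e_add_kern[OF kern_uminus[OF l(1)], of v] v l(2) show ?thesis
      by (intro bexI[of _ "v - l"]) auto
  qed
  then obtain w where w: "\<And>j. w j \<in> cball 0 \<rho>" "\<And>j. e (w j) = proj_class (y j)" by metis
  obtain a r where r: "strict_mono r" "(w \<circ> r) \<longlonglongrightarrow> a"
    using compact_cball[of "0 :: complex ^ 'n" \<rho>] w(1) unfolding compact_def by blast
  have "e a = proj_class f"
  proof (rule holomorphic_to_proj_limit[OF hol _ _ r(2)])
    show "(y \<circ> r) \<longlonglongrightarrow> f" using y(1) r(1) by (rule LIMSEQ_subseq_LIMSEQ)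
  qed (use y w in auto)
  with r w show ?thesis by (intro that[of r w a])
qed

text \<open>Openness of \<open>e\<close>, obtained from compactness modulo the kernel and the closed
  graph rather than from the differential. If the class of \<open>f\<close> lies outside the
  carrier, the same argument shows that no point of \<open>A\<close> is close to \<open>f\<close> in
  this chart.\<close>

lemma exp_open_chart:
  assumes "\<epsilon> > 0"
  shows "\<exists>\<delta>>0. \<exists>a. \<forall>y. y $ k = 1 \<and> (\<forall>i. dist (y $ i) (f $ i) < \<delta>) \<and> proj_class y \<in> carrier A \<longrightarrow>
    (\<exists>v\<in>ball a \<epsilon>. e v = proj_class y)"
proof (rule ccontr)
  assume "\<not> ?thesis"
  then have "\<exists>y. y $ k = 1 \<and> (\<forall>i. dist (y $ i) (f $ i) < \<delta>) \<and> proj_class y \<in> carrier A \<and>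
      (\<forall>v\<in>ball a \<epsilon>. e v \<noteq> proj_class y)" if "\<delta> > 0" for \<delta> a using that by blast
  then have ex: "\<exists>y. y $ k = 1 \<and> (\<forall>i. dist (y $ i) (f $ i) < 1 / real (Suc j)) \<and> proj_class y \<in> carrier A \<and>
      (\<forall>v\<in>ball a \<epsilon>. e v \<noteq> proj_class y)" for j a by simp
  define y where "y = (\<lambda>a j. SOME y. y $ k = 1 \<and> (\<forall>i. dist (y $ i) (f $ i) < 1 / real (Suc j)) \<and>
      proj_class y \<in> carrier A \<and> (\<forall>v\<in>ball a \<epsilon>. e v \<noteq> proj_class y))"
  have y: "y a j $ k = 1" "dist (y a j $ i) (f $ i) < 1 / real (Suc j)"
      "proj_class (y a j) \<in> carrier A" "v \<in> ball a \<epsilon> \<Longrightarrow> e v \<noteq> proj_class (y a j)" for j a i v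
    using someI_ex[OF ex[of j a]] unfolding y_def by blast+
  have lim: "y a \<longlonglongrightarrow> f" for a
  proof (rule vec_tendstoI)
    fix i
    have "(\<lambda>j. dist (y a j $ i) (f $ i)) \<longlonglongrightarrow> 0"
      by (rule real_tendsto_sandwich[OF _ _ tendsto_const LIMSEQ_inverse_real_of_nat])
         (auto intro!: always_eventually less_imp_le simp: y(2) inverse_eq_divide simp del: of_nat_Suc)
    then show "(\<lambda>j. y a j $ i) \<longlonglongrightarrow> f $ i" by (rule tendsto_dist_iff[THEN iffD2])
  qed
  \<comment> \<open>Counterexamples exist for every centre. Those for any one centre serve to find a
    preimage of \<open>f\<close>, which then becomes the centre.\<close>
  obtain a where a: "e a = proj_class f" using chart_limit[OF lim y(1,3)] by metis
  obtain r w b where b: "strict_mono r" "\<And>j. e (w j) = proj_class (y a j)" "(w \<circ> r) \<longlonglongrightarrow> b" "e b = proj_class f"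
    using chart_limit[OF lim[of a] y(1,3)] by metis
  have l: "b - a \<in> kern" using a b(4) by (intro e_eqD) simp
  obtain j where j: "dist (w (r j)) b < \<epsilon>"
    using b(3) assms unfolding lim_sequentially by (metis comp_apply order_refl)
  \<comment> \<open>Subtracting the kernel vector \<open>b - a\<close> turns preimages that approach
    \<open>b\<close> into preimages that approach \<open>a\<close>.\<close>
  have "w (r j) - (b - a) \<in> ball a \<epsilon>"
    using j by (simp add: dist_norm norm_minus_commute algebra_simps)
  moreover have "e (w (r j) - (b - a)) = proj_class (y a (r j))"
    using e_add_kern[OF kern_uminus[OF l], of "w (r j)"] b(2) by (metis diff_conv_add_uminus)
  ultimately show False using y(4) by blast
qed

lemma section_meets_graph:
  assumes V: "closedin affine_proj_zariski V" "affine_dim (fst ` V) = enat CARD('n)"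
    and sub: "V \<subseteq> UNIV \<times> carrier A"
  shows "\<exists>z. (z, e z) \<in> V"
proof -
  obtain s where s: "s > 0" "\<And>v. v \<in> kern \<Longrightarrow> v \<noteq> 0 \<Longrightarrow> s \<le> norm v"
    using lattice_separated[OF kern_lattice] by blast
  obtain \<rho> where \<rho>: "\<rho> \<ge> 0" "\<And>v. \<exists>l\<in>kern. norm (v - l) \<le> \<rho>"
    using lattice_covering_radius[OF kern_lattice] by blast
  \<comment> \<open>Two points of a closed ball of radius \<open>\<epsilon>\<close> are at most
    \<open>2 * \<epsilon>\<close> apart, which is less than \<open>s\<close>, so \<open>e\<close> is
    injective on the ball.\<close>
  define \<epsilon> where "\<epsilon> = s / 3"
  have \<epsilon>: "\<epsilon> > 0" using s by (simp add: \<epsilon>_def)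
  \<comment> \<open>\<open>\<rho>\<close> pays for the translation by a lattice point, and
    \<open>\<epsilon>\<close> is the radius of the ball that contains the values of
    \<open>L\<close>.\<close>
  define R where "R = \<rho> + \<epsilon>"
  have R: "R > 0" using \<rho> \<epsilon> by (simp add: R_def)
  obtain F :: "('m \<times> (complex ^ 'm)) set" where F: "finite F"
    and near: "\<And>R \<delta>. R > 0 \<Longrightarrow> \<delta> > 0 \<Longrightarrow> \<exists>c \<xi> k f. (k, f) \<in> F \<and> continuous_on (cball c R) \<xi> \<and>
       (\<forall>z\<in>cball c R. \<xi> z \<noteq> 0 \<and> (z, proj_class (\<xi> z)) \<in> V \<and> \<xi> z $ k = 1 \<and>
          (\<forall>i. dist (\<xi> z $ i) (f $ i) < \<delta>))"
    using sections_near_finite_set[OF V] by metis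
  obtain \<delta> where \<delta>: "\<And>k f. \<delta> (k, f) > 0" and ch: "\<And>k f. \<exists>a. \<forall>y. y $ k = 1 \<and>
      (\<forall>i. dist (y $ i) (f $ i) < \<delta> (k, f)) \<and> proj_class y \<in> carrier A \<longrightarrow> (\<exists>v\<in>ball a \<epsilon>. e v = proj_class y)"
  proof -
    define \<delta> where "\<delta> = (\<lambda>(k, f). SOME \<delta>. \<delta> > 0 \<and> (\<exists>a. \<forall>y. y $ k = 1 \<and>
      (\<forall>i. dist (y $ i) (f $ i) < \<delta>) \<and> proj_class y \<in> carrier A \<longrightarrow> (\<exists>v\<in>ball a \<epsilon>. e v = proj_class y)))"
    have "\<delta> (k, f) > 0 \<and> (\<exists>a. \<forall>y. y $ k = 1 \<and>
      (\<forall>i. dist (y $ i) (f $ i) < \<delta> (k, f)) \<and> proj_class y \<in> carrier A \<longrightarrow> (\<exists>v\<in>ball a \<epsilon>. e v = proj_class y))" for k f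
      unfolding \<delta>_def prod.case by (rule someI_ex) (rule exp_open_chart[OF \<epsilon>])
    then show ?thesis by (intro that[of \<delta>]) auto
  qed
  \<comment> \<open>One tolerance for all points of \<open>F\<close>; the 1 covers an empty
    \<open>F\<close>.\<close>
  define \<delta>0 where "\<delta>0 = Min (insert 1 (\<delta> ` F))"
  have \<delta>0: "\<delta>0 > 0" "\<And>k f. (k, f) \<in> F \<Longrightarrow> \<delta>0 \<le> \<delta> (k, f)"
    using F \<delta> by (auto simp: \<delta>0_def)
  obtain c \<xi> k f where kf: "(k, f) \<in> F" and \<xi>: "continuous_on (cball c R) \<xi>"
    and x: "\<And>z. z \<in> cball c R \<Longrightarrow> (z, proj_class (\<xi> z)) \<in> V"
      "\<And>z. z \<in> cball c R \<Longrightarrow> \<xi> z $ k = 1" "\<And>z i. z \<in> cball c R \<Longrightarrow> dist (\<xi> z $ i) (f $ i) < \<delta>0"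
    using near[OF R \<delta>0(1)] by blast
  obtain a where a: "\<And>y. y $ k = 1 \<Longrightarrow> \<forall>i. dist (y $ i) (f $ i) < \<delta> (k, f) \<Longrightarrow> proj_class y \<in> carrier A \<Longrightarrow>
      \<exists>v\<in>ball a \<epsilon>. e v = proj_class y" using ch[of k f] by blast
  have "\<exists>v\<in>cball a \<epsilon>. e v = proj_class (\<xi> z)" if z: "z \<in> cball c R" for z
  proof -
    have "proj_class (\<xi> z) \<in> carrier A" using x(1)[OF z] sub by blast
    moreover have "\<forall>i. dist (\<xi> z $ i) (f $ i) < \<delta> (k, f)"
      using x(3)[OF z] \<delta>0(2)[OF kf] less_le_trans by blast
    ultimately show ?thesis using a[OF x(2)[OF z]] ball_subset_cball by blast
  qed
  then obtain L where L: "\<And>z. z \<in> cball c R \<Longrightarrow> L z \<in> cball a \<epsilon>"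
      "\<And>z. z \<in> cball c R \<Longrightarrow> e (L z) = proj_class (\<xi> z)" by metis
  have uniq: "v = v'" if "v \<in> cball a \<epsilon>" "v' \<in> cball a \<epsilon>" "e v = e v'" for v v'
  proof (rule ccontr)
    assume "v \<noteq> v'"
    then have "s \<le> norm (v - v')" using s(2)[OF e_eqD[OF that(3)]] by simp
    moreover have "norm (v - v') \<le> 2 * \<epsilon>"
      using that(1,2) dist_triangle3[of v v' a] by (simp add: dist_norm)
    ultimately show False using s(1) by (simp add: \<epsilon>_def)
  qed
  \<comment> \<open>A limit of points of the graph is again a preimage of the right class in the
    closed ball, so uniqueness identifies it with the value of \<open>L\<close>.\<close>
  have contL: "continuous_on (cball c R) L"
  proof (subst continuous_closed_graph_eq)
    show "compact (cball a \<epsilon>)" by simp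
    show "L \<in> cball c R \<rightarrow> cball a \<epsilon>" using L(1) by blast
    have "closed ((\<lambda>z. (z, L z)) ` cball c R)"
      unfolding closed_sequential_limits
    proof (intro allI impI)
      fix g :: "nat \<Rightarrow> (complex ^ 'n) \<times> (complex ^ 'n)" and p
      assume g: "(\<forall>j. g j \<in> (\<lambda>z. (z, L z)) ` cball c R) \<and> g \<longlonglongrightarrow> p"
      define zs where "zs = (\<lambda>j. fst (g j))"
      have zs: "zs j \<in> cball c R" "g j = (zs j, L (zs j))" for j
        using conjunct1[OF g, rule_format, of j] by (auto simp: zs_def)
      obtain z v where p: "p = (z, v)" by (cases p)
      have "(\<lambda>j. fst (g j)) \<longlonglongrightarrow> fst p" "(\<lambda>j. snd (g j)) \<longlonglongrightarrow> snd p" using g by (auto intro!: tendsto_intros)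
      then have lim: "zs \<longlonglongrightarrow> z" "(\<lambda>j. L (zs j)) \<longlonglongrightarrow> v"
        unfolding p by (simp_all add: zs(2)) 
      have z: "z \<in> cball c R" by (rule closed_sequentially[OF closed_cball _ lim(1)]) (use zs in blast)
      have v: "v \<in> cball a \<epsilon>" by (rule closed_sequentially[OF closed_cball _ lim(2)]) (use zs L in blast)
      have "(\<lambda>j. \<xi> (zs j)) \<longlonglongrightarrow> \<xi> z"
        by (rule continuous_on_tendsto_compose[OF \<xi> lim(1) z]) (use zs in auto)
      then have "e v = proj_class (\<xi> z)"
        by (rule holomorphic_to_proj_limit[OF hol _ _ lim(2)]) (use x(2) L(2) zs in auto)
      with L[OF z] v uniq have "v = L z" by metis
      with p z show "p \<in> (\<lambda>z. (z, L z)) ` cball c R" by blast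
    qed
    then show "closedin (top_of_set (cball c R \<times> cball a \<epsilon>)) ((\<lambda>z. (z, L z)) ` cball c R)"
      by (rule closed_subset[rotated]) (use L(1) in auto)
  qed
  \<comment> \<open>The kernel vector moves the centre \<open>a\<close> of the values of
    \<open>L\<close> to within \<open>\<rho>\<close> of \<open>c\<close>, wherever the ball was
    placed.\<close>
  obtain l where l: "l \<in> kern" "norm (c - a - l) \<le> \<rho>" using \<rho>(2) by blast
  have self: "L z + l \<in> cball c R" if z: "z \<in> cball c R" for z
  proof -
    have "c - (L z + l) = (c - a - l) + (a - L z)" by simp
    then have "norm (c - (L z + l)) \<le> norm (c - a - l) + norm (a - L z)" by (metis norm_triangle_ineq)
    with l(2) L(1)[OF z] show ?thesis by (simp add: R_def dist_norm)
  qed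
  have "continuous_on (cball c R) (\<lambda>z. L z + l)" by (intro continuous_intros contL)
  moreover have "(\<lambda>z. L z + l) \<in> cball c R \<rightarrow> cball c R" using self by blast
  moreover have "cball c R \<noteq> {}" using R by simp
  ultimately obtain z where z: "z \<in> cball c R" "L z + l = z"
    using brouwer[OF compact_cball convex_cball] by metis
  have "e z = e (L z)" using e_add_kern[OF l(1), of "L z"] z(2) by simp
  with L(2)[OF z(1)] x(1)[OF z(1)] show ?thesis by metis
qed

end

theorem theorem1p4:
  fixes A :: "'m::finite proj monoid"
    and exp_A :: "complex ^ 'n::finite \<Rightarrow> 'm proj"
    and V :: "((complex ^ 'n) \<times> 'm proj) set"
  assumes "abelian_variety A"
    and "variety_dim (carrier A) = enat CARD('n)"
    and "exponential_map A exp_A"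
    and exp_surj: "range exp_A = carrier A"
    and exp_kernel: "lattice_of_rank (2 * CARD('n)) {z. exp_A z = \<one>\<^bsub>A\<^esub>}"
    and V_closed: "closedin affine_proj_zariski V"
    and V_subset: "V \<subseteq> UNIV \<times> carrier A"
    and V_dominant: "affine_dim (fst ` V) = enat CARD('n)"
  shows "\<exists>z. (z, exp_A z) \<in> V"
proof -
  interpret exp_covering A exp_A
    using assms(1,3) exp_surj exp_kernel
    by (intro exp_covering.intro) (auto simp: abelian_variety_def exponential_map_def)
  show ?thesis by (rule section_meets_graph[OF V_closed V_dominant V_subset])
qed

end
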